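(* Let $0\to W_1\xrightarrow{i}W_2\xrightarrow{\pi}W_3\to0$ be a short exact sequence in $\mathrm{DVect}$. Then for any diffeological vector space $V$ there is a sequence in $\mathrm{DVect}$ (i.e. all maps, including the connecting maps $\delta_n$, are smooth linear) which is exact in the category of vector spaces: $$0\to L^\infty(V,W_1)\xrightarrow{i_*}L^\infty(V,W_2)\xrightarrow{\pi_*}L^\infty(V,W_3)\xrightarrow{\delta_0}\operatorname{Ext}^1(V,W_1)\xrightarrow{i_*}\operatorname{Ext}^1(V,W_2)\xrightarrow{\pi_*}\operatorname{Ext}^1(V,W_3)\xrightarrow{\delta_1}\operatorname{Ext}^2(V,W_1)\xrightarrow{i_*}\operatorname{Ext}^2(V,W_2)\xrightarrow{\pi_*}\cdots$$ where $i_*$ and $\pi_*$ are the maps induced by composition with $i$ and $\pi$.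
   Context: A diffeological space is a set $X$ together with a specified set of functions $U\to X$ (called plots), for every open set $U\subseteq\mathbb{R}^n$ and every $n\in\mathbb{N}=\{0,1,2,\dots\}$, such that: (1) every constant map $U\to X$ is a plot; (2) if $U\to X$ is a plot and $V\to U$ is a smooth map between open subsets of Euclidean spaces, then $V\to U\to X$ is a plot; (3) if $U=\bigcup_i U_i$ is an open cover and $U\to X$ is a map whose restrictions to all $U_i$ are plots, then $U\to X$ is a plot. A map between diffeological spaces is smooth if composing with it sends plots to plots. Products carry the product diffeology (a map into a product is a plot iff all its components are plots); subsets carry the sub-diffeology (plots are the plots of the ambient space with image in the subset); quotients carry the quotient diffeology (plots are the maps that locally lift to plots). $\mathbb{R}$ carries the standard diffeology. A diffeological vector space is a real vector space $V$ with a diffeology such that addition $V\times V\to V$ and scalar multiplication $\mathbb{R}\times V\to V$ are smooth. $\mathrm{DVect}$ is the category of diffeological vector spaces and smooth linear maps. $L^\infty(V,W)$ is the vector space of smooth linear maps $V\to W$ with the functional diffeology ($p:U\to L^\infty(V,W)$ is a plot iff $U\times V\to W$, $(u,v)\mapsto p(u)(v)$, is smooth); it is a diffeological vector space. A map $f:X\to Y$ of diffeological spaces is an induction if it is injective and a map $q:U\to X$ is a plot iff $f\circ q$ is a plot of $Y$. It is a subduction if it is smooth, surjective, and every plot of $Y$ locally (near each point of its domain) lifts along $f$ to a plot of $X$. A sequence $0\to A\xrightarrow{i}E\xrightarrow{p}B\to0$ of smooth linear maps of diffeological vector spaces is a short exact sequence in $\mathrm{DVect}$ if it is a short exact sequence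 of vector spaces, $i$ is an induction and $p$ is a subduction. A diffeological vector space $V$ is projective if for every smooth linear subduction $f:W_1\to W_2$ of diffeological vector spaces and every smooth linear map $g:V\to W_2$ there exists a smooth linear map $h:V\to W_1$ with $g=f\circ h$. A diffeological chain complex $\mathbf{V}$ is a $\mathbb{Z}$-indexed sequence of diffeological vector spaces with smooth linear maps $d_n:V_n\to V_{n-1}$, $d_n\circ d_{n+1}=0$. It is exact at the $n$-th spot if the induced sequence $0\to V_{n+1}/\ker(d_{n+1})\to V_n\to\operatorname{Im}(d_n)\to0$ is a short exact sequence in $\mathrm{DVect}$ (quotient diffeology on $V_{n+1}/\ker(d_{n+1})$, sub-diffeology of $V_{n-1}$ on $\operatorname{Im}(d_n)$); it is exact if it is exact at every spot. A diffeological projective resolution of $V$ is an exact diffeological chain complex $\mathbf{V}$ with $V_{-1}=V$, $V_n=0$ for $n<-1$, and $V_n$ projective for $n\ge0$; write $\mathbf{P}(V)$ for the complex obtained by replacing $V_{-1}$ by $0$, with terms $P_n$, $n\ge0$. Every diffeological vector space has such a resolution. Define $\operatorname{Ext}^n(V,W)=H^n(L^\infty(\mathbf{P}(V),W))$, i.e. the $n$-th cohomology (kernel modulo image, with the quotient diffeology of the sub-diffeology on the kernel) of the cochain complex $L^\infty(P_0,W)\to L^\infty(P_1,W)\to\cdots$; up to isomorphism in $\mathrm{DVect}$ it is independent of the resolution, and $\operatorname{Ext}^0(V,W)\cong L^\infty(V,W)$. *)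

theory Defs
  imports "HOL-Analysis.Analysis" "HOL-Algebra.Module" "HOL-Algebra.AbelCoset"
begin

section \<open>Smooth maps between open subsets of Euclidean spaces\<close>

text \<open>Points of n-dimensional Euclidean space are the sequences vanishing from index n on, so
  that the dimension is an ordinary natural number. All notions below depend only on the
  restriction of f to the open set U.\<close>

primrec Ck_on :: "nat \<Rightarrow> nat \<Rightarrow> (nat \<Rightarrow> real) set \<Rightarrow> ((nat \<Rightarrow> real) \<Rightarrow> real) \<Rightarrow> bool" where
  "Ck_on 0 n U f \<longleftrightarrow> continuous_map (subtopology (Euclidean_space n) U) euclideanreal f"
| "Ck_on (Suc k) n U f \<longleftrightarrow>
     continuous_map (subtopology (Euclidean_space n) U) euclideanreal f \<and>
     (\<forall>i<n. \<exists>g. (\<forall>x\<in>U. ((\<lambda>t. f (x(i := t))) has_real_derivative g x) (at (x i))) \<and> Ck_on k n U g)"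

definition smooth_on :: "nat \<Rightarrow> (nat \<Rightarrow> real) set \<Rightarrow> ((nat \<Rightarrow> real) \<Rightarrow> real) \<Rightarrow> bool" where
  "smooth_on n U f \<longleftrightarrow> (\<forall>k. Ck_on k n U f)"

section \<open>Diffeologies\<close>

text \<open>\<open>D n U\<close> is the set of plots with domain the open set U of n-dimensional Euclidean
  space. A plot is represented by a total function of which only the values on U matter;
  accordingly \<open>D n U\<close> is required to be closed under changes outside U.\<close>

type_synonym 'a plot_family = "nat \<Rightarrow> (nat \<Rightarrow> real) set \<Rightarrow> ((nat \<Rightarrow> real) \<Rightarrow> 'a) set"

definition euclidean_plots :: "nat \<Rightarrow> (nat \<Rightarrow> real) set \<Rightarrow> (nat \<Rightarrow> real) plot_family" where
  "euclidean_plots n U = (\<lambda>m U'. {s \<in> U' \<rightarrow> U. openin (Euclidean_space n) U \<and>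
     openin (Euclidean_space m) U' \<and> (\<forall>i<n. smooth_on m U' (\<lambda>x. s x i))})"

definition real_plots :: "real plot_family" where
  "real_plots = (\<lambda>n U. {f. openin (Euclidean_space n) U \<and> smooth_on n U f})"

definition diffeology :: "'a set \<Rightarrow> 'a plot_family \<Rightarrow> bool" where
  "diffeology X D \<longleftrightarrow>
     (\<forall>n U. \<forall>p\<in>D n U. openin (Euclidean_space n) U \<and> p \<in> U \<rightarrow> X) \<and>
     (\<forall>n U q. \<forall>p\<in>D n U. (\<forall>x\<in>U. q x = p x) \<longrightarrow> q \<in> D n U) \<and>
     (\<forall>n U. \<forall>c\<in>X. openin (Euclidean_space n) U \<longrightarrow> (\<lambda>_. c) \<in> D n U) \<and>
     (\<forall>n U m U'. \<forall>p\<in>D n U. \<forall>s\<in>euclidean_plots n U m U'. p \<circ> s \<in> D m U') \<and>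
     (\<forall>n \<U> p. (\<forall>U\<in>\<U>. openin (Euclidean_space n) U \<and> p \<in> D n U) \<longrightarrow> p \<in> D n (\<Union>\<U>))"

definition smooth_map :: "'a plot_family \<Rightarrow> 'b plot_family \<Rightarrow> ('a \<Rightarrow> 'b) \<Rightarrow> bool" where
  "smooth_map D E f \<longleftrightarrow> (\<forall>n U. \<forall>p\<in>D n U. f \<circ> p \<in> E n U)"

definition prod_plots :: "'a plot_family \<Rightarrow> 'b plot_family \<Rightarrow> ('a \<times> 'b) plot_family" where
  "prod_plots D E = (\<lambda>n U. {p. fst \<circ> p \<in> D n U \<and> snd \<circ> p \<in> E n U})"

definition sub_plots :: "'a plot_family \<Rightarrow> 'a set \<Rightarrow> 'a plot_family" where
  "sub_plots D A = (\<lambda>n U. {p \<in> D n U. p \<in> U \<rightarrow> A})"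

text \<open>Local liftability along f; for a quotient map f this is the quotient diffeology.\<close>

definition locally_lifts ::
    "'a plot_family \<Rightarrow> ('a \<Rightarrow> 'b) \<Rightarrow> nat \<Rightarrow> (nat \<Rightarrow> real) set \<Rightarrow> ((nat \<Rightarrow> real) \<Rightarrow> 'b) \<Rightarrow> bool" where
  "locally_lifts D f n U q \<longleftrightarrow>
     (\<forall>x\<in>U. \<exists>U'. openin (Euclidean_space n) U' \<and> x \<in> U' \<and> U' \<subseteq> U \<and>
        (\<exists>p\<in>D n U'. \<forall>y\<in>U'. f (p y) = q y))"

definition quot_plots :: "'a plot_family \<Rightarrow> ('a \<Rightarrow> 'b) \<Rightarrow> 'b plot_family" where
  "quot_plots D f = (\<lambda>n U. {q. openin (Euclidean_space n) U \<and> locally_lifts D f n U q})"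

definition induction_map :: "'a set \<Rightarrow> 'a plot_family \<Rightarrow> 'b plot_family \<Rightarrow> ('a \<Rightarrow> 'b) \<Rightarrow> bool" where
  "induction_map X D E f \<longleftrightarrow>
     inj_on f X \<and> (\<forall>n U. \<forall>q \<in> U \<rightarrow> X. q \<in> D n U \<longleftrightarrow> f \<circ> q \<in> E n U)"

definition subduction_map ::
    "'a set \<Rightarrow> 'a plot_family \<Rightarrow> 'b set \<Rightarrow> 'b plot_family \<Rightarrow> ('a \<Rightarrow> 'b) \<Rightarrow> bool" where
  "subduction_map X D Y E f \<longleftrightarrow>
     smooth_map D E f \<and> f ` X = Y \<and> (\<forall>n U. \<forall>q\<in>E n U. locally_lifts D f n U q)"

section \<open>Diffeological vector spaces\<close>

definition real_field :: "real ring" where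
  "real_field = \<lparr>carrier = UNIV, mult = (*), one = 1, zero = 0, add = (+)\<rparr>"

text \<open>The fields \<open>mult\<close> and \<open>one\<close>, which the library's module record inherits from rings, play
  no role.\<close>

record 'a dvs = "(real, 'a) module" +
  plots :: "'a plot_family"

definition dvs :: "'a dvs \<Rightarrow> bool" where
  "dvs V \<longleftrightarrow> module real_field V \<and> diffeology (carrier V) (plots V) \<and>
     smooth_map (prod_plots (plots V) (plots V)) (plots V) (\<lambda>(x, y). x \<oplus>\<^bsub>V\<^esub> y) \<and>
     smooth_map (prod_plots real_plots (plots V)) (plots V) (\<lambda>(r, x). r \<odot>\<^bsub>V\<^esub> x)"

definition smooth_linear :: "'a dvs \<Rightarrow> 'b dvs \<Rightarrow> ('a \<Rightarrow> 'b) \<Rightarrow> bool" where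
  "smooth_linear V W f \<longleftrightarrow> f \<in> carrier V \<rightarrow> carrier W \<and>
     (\<forall>x\<in>carrier V. \<forall>y\<in>carrier V. f (x \<oplus>\<^bsub>V\<^esub> y) = f x \<oplus>\<^bsub>W\<^esub> f y) \<and>
     (\<forall>r. \<forall>x\<in>carrier V. f (r \<odot>\<^bsub>V\<^esub> x) = r \<odot>\<^bsub>W\<^esub> f x) \<and>
     smooth_map (plots V) (plots W) f"

definition DVect_hom :: "'a dvs \<Rightarrow> 'b dvs \<Rightarrow> ('a \<Rightarrow> 'b) \<Rightarrow> bool" where
  "DVect_hom V W f \<longleftrightarrow> dvs V \<and> dvs W \<and> smooth_linear V W f"

definition DVect_isomorphic :: "'a dvs \<Rightarrow> 'b dvs \<Rightarrow> bool" where
  "DVect_isomorphic V W \<longleftrightarrow> (\<exists>f g. DVect_hom V W f \<and> DVect_hom W V g \<and>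
     (\<forall>x\<in>carrier V. g (f x) = x) \<and> (\<forall>y\<in>carrier W. f (g y) = y))"

abbreviation subduction :: "'a dvs \<Rightarrow> 'b dvs \<Rightarrow> ('a \<Rightarrow> 'b) \<Rightarrow> bool" where
  "subduction V W f \<equiv> subduction_map (carrier V) (plots V) (carrier W) (plots W) f"

definition dvs_sub :: "'a dvs \<Rightarrow> 'a set \<Rightarrow> 'a dvs" where
  "dvs_sub V A = V\<lparr>carrier := A, plots := sub_plots (plots V) A\<rparr>"

definition dvs_quot :: "'a dvs \<Rightarrow> 'a set \<Rightarrow> 'a set dvs" where
  "dvs_quot V K =
     \<lparr>carrier = a_rcosets\<^bsub>V\<^esub> K, mult = undefined, one = undefined,
      zero = K, add = set_add V,
      smult = (\<lambda>r X. \<Union>x\<in>X. K +>\<^bsub>V\<^esub> (r \<odot>\<^bsub>V\<^esub> x)),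
      plots = quot_plots (plots V) (\<lambda>x. K +>\<^bsub>V\<^esub> x)\<rparr>"

text \<open>Linear maps are represented by functions that are \<open>undefined\<close> outside the carrier.\<close>

definition Linf :: "'a dvs \<Rightarrow> 'b dvs \<Rightarrow> ('a \<Rightarrow> 'b) dvs" where
  "Linf V W = (let L = {f \<in> extensional (carrier V). smooth_linear V W f} in
     \<lparr>carrier = L, mult = undefined, one = undefined,
      zero = (\<lambda>x\<in>carrier V. \<zero>\<^bsub>W\<^esub>),
      add = (\<lambda>f g. \<lambda>x\<in>carrier V. f x \<oplus>\<^bsub>W\<^esub> g x),
      smult = (\<lambda>r f. \<lambda>x\<in>carrier V. r \<odot>\<^bsub>W\<^esub> f x),
      plots = (\<lambda>n U. {p \<in> U \<rightarrow> L. openin (Euclidean_space n) U \<and>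
        smooth_map (prod_plots (euclidean_plots n U) (plots V)) (plots W) (\<lambda>(u, v). p u v)})\<rparr>)"

definition short_exact ::
    "'a dvs \<Rightarrow> 'e dvs \<Rightarrow> 'b dvs \<Rightarrow> ('a \<Rightarrow> 'e) \<Rightarrow> ('e \<Rightarrow> 'b) \<Rightarrow> bool" where
  "short_exact A E B i p \<longleftrightarrow> DVect_hom A E i \<and> DVect_hom E B p \<and>
     inj_on i (carrier A) \<and> i ` carrier A = a_kernel E B p \<and> p ` carrier E = carrier B \<and>
     induction_map (carrier A) (plots A) (plots E) i \<and> subduction E B p"

definition exact_at :: "'a dvs \<Rightarrow> 'b dvs \<Rightarrow> 'c dvs \<Rightarrow> ('a \<Rightarrow> 'b) \<Rightarrow> ('b \<Rightarrow> 'c) \<Rightarrow> bool" where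
  "exact_at A B C f g \<longleftrightarrow> f ` carrier A = a_kernel B C g"

section \<open>Projective diffeological vector spaces\<close>

text \<open>A definition cannot quantify over all types, so the test spaces \<open>W1\<close>, \<open>W2\<close> range over all
  diffeological vector spaces whose elements live in fixed types. These types are large enough
  for this to be no restriction: by \<open>projective_lift\<close> below, the lifting property holds against
  every smooth linear subduction between diffeological vector spaces over arbitrary types.\<close>

type_synonym 'a test_carrier =
  "nat \<times> (nat \<Rightarrow> real) set \<times> ((nat \<Rightarrow> real) \<Rightarrow> 'a) \<times> (nat \<Rightarrow> real) \<times> (nat \<Rightarrow> real) \<Rightarrow> real"

definition projective :: "'a dvs \<Rightarrow> bool" where
  "projective V \<longleftrightarrow> dvs V \<and>
     (\<forall>(W1 :: 'a test_carrier dvs) (W2 :: 'a dvs) f g.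
        DVect_hom W1 W2 f \<and> subduction W1 W2 f \<and> DVect_hom V W2 g \<longrightarrow>
        (\<exists>h. DVect_hom V W1 h \<and> (\<forall>x\<in>carrier V. g x = f (h x))))"

subsection \<open>Independence of the choice of types\<close>

lemma Ck_on_const: "Ck_on k n U (\<lambda>_. c)"
  by (induction k arbitrary: c) (auto intro!: exI[of _ "\<lambda>_. 0"])

lemma smooth_on_coord:
  assumes "i < n" and "openin (Euclidean_space n) U"
  shows "smooth_on n U (\<lambda>x. x i)"
proof -
  have cont: "continuous_map (subtopology (Euclidean_space n) U) euclideanreal (\<lambda>x. x i)"
    unfolding Euclidean_space_def subtopology_subtopology
    by (intro continuous_map_from_subtopology continuous_map_product_projection) simp
  have "Ck_on k n U (\<lambda>x. x i)" for k
  proof (cases k)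
    case 0
    then show ?thesis using cont by simp
  next
    case (Suc k)
    have "\<exists>g. (\<forall>x\<in>U. ((\<lambda>t. (x(j := t)) i) has_real_derivative g x) (at (x j))) \<and> Ck_on k n U g"
      for j
      by (rule exI[of _ "\<lambda>_. if i = j then 1 else 0"]) (auto simp: Ck_on_const)
    then show ?thesis using cont Suc by simp
  qed
  then show ?thesis by (simp add: smooth_on_def)
qed

lemma diffeologyD:
  assumes "diffeology X D" and "p \<in> D n U"
  shows diffeology_open: "openin (Euclidean_space n) U"
    and diffeology_into: "p \<in> U \<rightarrow> X"
    and diffeology_cong: "(\<And>x. x \<in> U \<Longrightarrow> q x = p x) \<Longrightarrow> q \<in> D n U"
    and diffeology_comp: "s \<in> euclidean_plots n U m U' \<Longrightarrow> p \<circ> s \<in> D m U'"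
proof -
  note D = assms(1)[unfolded diffeology_def]
  show "openin (Euclidean_space n) U" "p \<in> U \<rightarrow> X"
    using D[THEN conjunct1, rule_format, OF assms(2)] by auto
  show "q \<in> D n U" if "\<And>x. x \<in> U \<Longrightarrow> q x = p x"
    by (rule D[THEN conjunct2, THEN conjunct1, rule_format, OF assms(2) that])
  show "p \<circ> s \<in> D m U'" if "s \<in> euclidean_plots n U m U'"
    by (rule D[THEN conjunct2, THEN conjunct2, THEN conjunct2, THEN conjunct1, rule_format,
          OF assms(2) that])
qed

lemma diffeology_const:
  assumes "diffeology X D" and "c \<in> X" and "openin (Euclidean_space n) U"
  shows "(\<lambda>_. c) \<in> D n U"
  by (rule assms(1)[unfolded diffeology_def, THEN conjunct2, THEN conjunct2, THEN conjunct1,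
        rule_format, OF assms(2,3)])

lemma diffeology_glue:
  assumes "diffeology X D"
    and "\<And>U. U \<in> \<U> \<Longrightarrow> openin (Euclidean_space n) U \<and> p \<in> D n U"
  shows "p \<in> D n (\<Union>\<U>)"
  by (rule assms(1)[unfolded diffeology_def, THEN conjunct2, THEN conjunct2, THEN conjunct2,
        THEN conjunct2, rule_format, OF assms(2)])

lemma real_field_simps [simp]:
  "carrier real_field = UNIV" "mult real_field = (*)" "one real_field = 1"
  "zero real_field = 0" "add real_field = (+)"
  by (simp_all add: real_field_def)

lemma cring_real_field: "cring real_field"
proof (rule cringI)
  show "abelian_group real_field"
  proof (rule abelian_groupI)
    fix x :: real
    show "\<exists>y\<in>carrier real_field. y \<oplus>\<^bsub>real_field\<^esub> x = \<zero>\<^bsub>real_field\<^esub>"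
      by (rule bexI[of _ "- x"]) simp_all
  qed simp_all
  show "comm_monoid real_field"
    by (rule comm_monoidI) simp_all
qed (simp add: algebra_simps)

lemma dvsD:
  assumes "dvs V"
  shows dvs_module: "module real_field V"
    and dvs_diffeology: "diffeology (carrier V) (plots V)"
    and dvs_add_plot: "p \<in> plots V n U \<Longrightarrow> q \<in> plots V n U \<Longrightarrow> (\<lambda>x. p x \<oplus>\<^bsub>V\<^esub> q x) \<in> plots V n U"
    and dvs_smult_plot:
      "r \<in> real_plots n U \<Longrightarrow> q \<in> plots V n U \<Longrightarrow> (\<lambda>x. r x \<odot>\<^bsub>V\<^esub> q x) \<in> plots V n U"
proof -
  show "module real_field V" "diffeology (carrier V) (plots V)"
    using assms by (auto simp: dvs_def)
  assume q: "q \<in> plots V n U"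
  show "(\<lambda>x. p x \<oplus>\<^bsub>V\<^esub> q x) \<in> plots V n U" if p: "p \<in> plots V n U"
  proof -
    have "(\<lambda>x. (p x, q x)) \<in> prod_plots (plots V) (plots V) n U"
      using p q by (simp add: prod_plots_def o_def)
    then have "(\<lambda>(x, y). x \<oplus>\<^bsub>V\<^esub> y) \<circ> (\<lambda>x. (p x, q x)) \<in> plots V n U"
      using assms unfolding dvs_def smooth_map_def by blast
    then show ?thesis by (simp add: o_def)
  qed
  show "(\<lambda>x. r x \<odot>\<^bsub>V\<^esub> q x) \<in> plots V n U" if p: "r \<in> real_plots n U"
  proof -
    have "(\<lambda>x. (r x, q x)) \<in> prod_plots real_plots (plots V) n U"
      using p q by (simp add: prod_plots_def o_def)
    then have "(\<lambda>(x, y). x \<odot>\<^bsub>V\<^esub> y) \<circ> (\<lambda>x. (r x, q x)) \<in> plots V n U"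
      using assms unfolding dvs_def smooth_map_def by blast
    then show ?thesis by (simp add: o_def)
  qed
qed

lemma DVect_homD:
  assumes "DVect_hom V W f"
  shows "dvs V" "dvs W" "f \<in> carrier V \<rightarrow> carrier W"
    "x \<in> carrier V \<Longrightarrow> y \<in> carrier V \<Longrightarrow> f (x \<oplus>\<^bsub>V\<^esub> y) = f x \<oplus>\<^bsub>W\<^esub> f y"
    "x \<in> carrier V \<Longrightarrow> f (r \<odot>\<^bsub>V\<^esub> x) = r \<odot>\<^bsub>W\<^esub> f x"
    "p \<in> plots V n U \<Longrightarrow> (\<lambda>x. f (p x)) \<in> plots W n U"
  using assms unfolding DVect_hom_def smooth_linear_def smooth_map_def o_def by auto

lemma DVect_hom_zero:
  assumes "DVect_hom V W f"
  shows "f \<zero>\<^bsub>V\<^esub> = \<zero>\<^bsub>W\<^esub>"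
proof -
  interpret V: module real_field V
    rewrites "carrier real_field = UNIV" and "mult real_field = (*)" and "one real_field = 1"
      and "zero real_field = 0" and "add real_field = (+)"
    using DVect_homD[OF assms] dvs_module[of V] by simp_all
  interpret W: module real_field W
    rewrites "carrier real_field = UNIV" and "mult real_field = (*)" and "one real_field = 1"
      and "zero real_field = 0" and "add real_field = (+)"
    using DVect_homD[OF assms] dvs_module[of W] by simp_all
  have fz: "f \<zero>\<^bsub>V\<^esub> \<in> carrier W" using DVect_homD(3)[OF assms] by auto
  have "f \<zero>\<^bsub>V\<^esub> = f (0 \<odot>\<^bsub>V\<^esub> \<zero>\<^bsub>V\<^esub>)" by simp
  also have "\<dots> = 0 \<odot>\<^bsub>W\<^esub> f \<zero>\<^bsub>V\<^esub>" using DVect_homD(5)[OF assms] by blast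
  finally show ?thesis using W.smult_l_null[OF fz] by simp
qed

lemma DVect_hom_id: "dvs V \<Longrightarrow> DVect_hom V V (\<lambda>x. x)"
  unfolding DVect_hom_def smooth_linear_def smooth_map_def o_def by auto

lemma DVect_hom_comp:
  assumes "DVect_hom U V f" and "DVect_hom V W g"
  shows "DVect_hom U W (\<lambda>x. g (f x))"
proof -
  have "f x \<in> carrier V" if "x \<in> carrier U" for x
    using DVect_homD(3)[OF assms(1)] that by blast
  moreover have "g x \<in> carrier W" if "x \<in> carrier V" for x
    using DVect_homD(3)[OF assms(2)] that by blast
  ultimately show ?thesis
    using DVect_homD(1,2)[OF assms(1)] DVect_homD(2)[OF assms(2)]
    by (simp add: DVect_hom_def smooth_linear_def smooth_map_def o_def
        DVect_homD(4,5,6)[OF assms(1)] DVect_homD(4,5,6)[OF assms(2)])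
qed

definition lin_comb :: "'a dvs \<Rightarrow> ('i \<Rightarrow> 'a) \<Rightarrow> ('i \<Rightarrow> real) \<Rightarrow> 'a" where
  "lin_comb M e c = finsum M (\<lambda>j. c j \<odot>\<^bsub>M\<^esub> e j) {j. c j \<noteq> 0}"

context
  fixes M :: "'a dvs" and e :: "'i \<Rightarrow> 'a"
  assumes M: "dvs M" and e: "\<And>j. e j \<in> carrier M"
begin

interpretation module real_field M
    rewrites "carrier real_field = UNIV" and "mult real_field = (*)" and "one real_field = 1"
      and "zero real_field = 0" and "add real_field = (+)"
    using dvs_module[OF M] by simp_all

lemma lin_comb_superset:
  assumes "finite A" and "{j. c j \<noteq> 0} \<subseteq> A"
  shows "lin_comb M e c = finsum M (\<lambda>j. c j \<odot>\<^bsub>M\<^esub> e j) A"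
  unfolding lin_comb_def
  by (rule M.add.finprod_mono_neutral_cong_left) (use assms e in auto)

lemma lin_comb_closed: "lin_comb M e c \<in> carrier M"
  unfolding lin_comb_def by (rule M.finsum_closed) (use e in auto)

lemma lin_comb_add:
  assumes "finite {j. c j \<noteq> 0}" and "finite {j. c' j \<noteq> 0}"
  shows "lin_comb M e (\<lambda>j. c j + c' j) = lin_comb M e c \<oplus>\<^bsub>M\<^esub> lin_comb M e c'"
proof -
  let ?A = "{j. c j \<noteq> 0} \<union> {j. c' j \<noteq> 0}"
  have A: "finite ?A" using assms by simp
  have "lin_comb M e (\<lambda>j. c j + c' j) = finsum M (\<lambda>j. (c j + c' j) \<odot>\<^bsub>M\<^esub> e j) ?A"
    by (rule lin_comb_superset[OF A]) auto
  also have "\<dots> = finsum M (\<lambda>j. c j \<odot>\<^bsub>M\<^esub> e j \<oplus>\<^bsub>M\<^esub> c' j \<odot>\<^bsub>M\<^esub> e j) ?A"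
    using e smult_l_distr by (intro M.finsum_cong') auto
  also have "\<dots> = finsum M (\<lambda>j. c j \<odot>\<^bsub>M\<^esub> e j) ?A \<oplus>\<^bsub>M\<^esub> finsum M (\<lambda>j. c' j \<odot>\<^bsub>M\<^esub> e j) ?A"
    using e by (intro M.finsum_addf) auto
  also have "\<dots> = lin_comb M e c \<oplus>\<^bsub>M\<^esub> lin_comb M e c'"
    using lin_comb_superset[OF A, of c] lin_comb_superset[OF A, of c'] by auto
  finally show ?thesis .
qed

lemma lin_comb_smult:
  assumes "finite {j. c j \<noteq> 0}"
  shows "lin_comb M e (\<lambda>j. r * c j) = r \<odot>\<^bsub>M\<^esub> lin_comb M e c"
proof -
  have "lin_comb M e (\<lambda>j. r * c j) = finsum M (\<lambda>j. (r * c j) \<odot>\<^bsub>M\<^esub> e j) {j. c j \<noteq> 0}"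
    by (rule lin_comb_superset[OF assms]) auto
  also have "\<dots> = finsum M (\<lambda>j. r \<odot>\<^bsub>M\<^esub> (c j \<odot>\<^bsub>M\<^esub> e j)) {j. c j \<noteq> 0}"
    using e smult_assoc1 by (intro M.finsum_cong') auto
  also have "\<dots> = r \<odot>\<^bsub>M\<^esub> lin_comb M e c"
    unfolding lin_comb_def using assms e by (intro finsum_smult_ldistr[symmetric]) auto
  finally show ?thesis .
qed

lemma lin_comb_unit: "lin_comb M e (\<lambda>i. if i = j then 1 else 0) = e j"
proof -
  have "lin_comb M e (\<lambda>i. if i = j then 1 else 0) =
      finsum M (\<lambda>i. (if i = j then 1 else 0) \<odot>\<^bsub>M\<^esub> e i) {j}"
    by (rule lin_comb_superset) auto
  also have "\<dots> = e j"
    using e[of j] smult_one[of "e j"] by simp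
  finally show ?thesis .
qed

end

lemma DVect_hom_lin_comb:
  assumes f: "DVect_hom M N f" and e: "\<And>j. e j \<in> carrier M" and c: "finite {j. c j \<noteq> 0}"
  shows "f (lin_comb M e c) = lin_comb N (\<lambda>j. f (e j)) c"
proof -
  interpret M: module real_field M
    rewrites "carrier real_field = UNIV" and "mult real_field = (*)" and "one real_field = 1"
      and "zero real_field = 0" and "add real_field = (+)"
    using DVect_homD[OF f] dvs_module[of M] by simp_all
  interpret N: module real_field N
    rewrites "carrier real_field = UNIV" and "mult real_field = (*)" and "one real_field = 1"
      and "zero real_field = 0" and "add real_field = (+)"
    using DVect_homD[OF f] dvs_module[of N] by simp_all
  have fe: "f x \<in> carrier N" if "x \<in> carrier M" for x using DVect_homD(3)[OF f] that by auto
  have "f (finsum M (\<lambda>j. c j \<odot>\<^bsub>M\<^esub> e j) A) = finsum N (\<lambda>j. c j \<odot>\<^bsub>N\<^esub> f (e j)) A" if "finite A" for A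
    using that
  proof induction
    case empty
    then show ?case using DVect_hom_zero[OF f] by simp
  next
    case (insert a A)
    have 1: "(\<lambda>j. c j \<odot>\<^bsub>M\<^esub> e j) \<in> A \<rightarrow> carrier M" using e by auto
    have 2: "(\<lambda>j. c j \<odot>\<^bsub>N\<^esub> f (e j)) \<in> A \<rightarrow> carrier N" using e fe by auto
    show ?case
      using insert 1 2 e fe M.M.finsum_closed[OF 1]
      by (simp add: DVect_homD(4,5)[OF f] )
  qed
  then show ?thesis using c unfolding lin_comb_def by blast
qed

definition free_pullback ::
    "'a dvs \<Rightarrow> ('i \<Rightarrow> 'a) \<Rightarrow> 'b dvs \<Rightarrow> ('i \<Rightarrow> 'b) \<Rightarrow> ('i \<Rightarrow> real) dvs" where
  "free_pullback M e N e' =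
     \<lparr>carrier = {c. finite {j. c j \<noteq> 0}}, mult = undefined, one = undefined,
      zero = (\<lambda>_. 0), add = (\<lambda>c c' j. c j + c' j), smult = (\<lambda>r c j. r * c j),
      plots = (\<lambda>n U. {q \<in> U \<rightarrow> {c. finite {j. c j \<noteq> 0}}.
        (\<lambda>x. lin_comb M e (q x)) \<in> plots M n U \<and> (\<lambda>x. lin_comb N e' (q x)) \<in> plots N n U})\<rparr>"

lemma finite_support_add:
  "finite {j. c j \<noteq> (0::real)} \<Longrightarrow> finite {j. c' j \<noteq> 0} \<Longrightarrow> finite {j. c j + c' j \<noteq> 0}"
  by (rule finite_subset[of _ "{j. c j \<noteq> 0} \<union> {j. c' j \<noteq> 0}"]) auto

lemma finite_support_smult:
  "finite {j. c j \<noteq> (0::real)} \<Longrightarrow> finite {j. r * c j \<noteq> 0}"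
  by (rule finite_subset[of _ "{j. c j \<noteq> 0}"]) auto

context
  fixes M :: "'a dvs" and e :: "'i \<Rightarrow> 'a" and N :: "'b dvs" and e' :: "'i \<Rightarrow> 'b"
  assumes M: "dvs M" and e: "\<And>j. e j \<in> carrier M"
    and N: "dvs N" and e': "\<And>j. e' j \<in> carrier N"
begin

lemma dvs_free_pullback: "dvs (free_pullback M e N e')" (is "dvs ?F")
proof -
  note DM = dvs_diffeology[OF M] and DN = dvs_diffeology[OF N]
  have "module real_field ?F"
  proof (rule moduleI[OF cring_real_field])
    show "abelian_group ?F"
    proof (rule abelian_groupI)
      fix x assume x: "x \<in> carrier ?F"
      show "\<exists>y\<in>carrier ?F. y \<oplus>\<^bsub>?F\<^esub> x = \<zero>\<^bsub>?F\<^esub>"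
        by (rule bexI[of _ "\<lambda>j. - x j"]) (use x in \<open>auto simp: free_pullback_def\<close>)
    qed (auto simp: free_pullback_def algebra_simps intro: finite_support_add)
  qed (auto simp: free_pullback_def algebra_simps intro: finite_support_smult)
  moreover have "diffeology (carrier ?F) (plots ?F)"
    unfolding diffeology_def
  proof (intro conjI allI ballI impI)
    fix n U p assume p: "p \<in> plots ?F n U"
    then have pM: "(\<lambda>x. lin_comb M e (p x)) \<in> plots M n U"
      and pN: "(\<lambda>x. lin_comb N e' (p x)) \<in> plots N n U"
      and pc: "p \<in> U \<rightarrow> {c. finite {j. c j \<noteq> 0}}"
      by (auto simp: free_pullback_def)
    show "openin (Euclidean_space n) U" using diffeology_open[OF DM pM] .
    show "p \<in> U \<rightarrow> carrier ?F" using pc by (simp add: free_pullback_def)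
    show "q \<in> plots ?F n U" if q: "\<forall>x\<in>U. q x = p x" for q
    proof -
      have "(\<lambda>x. lin_comb M e (q x)) \<in> plots M n U"
        by (rule diffeology_cong[OF DM pM]) (use q in simp)
      moreover have "(\<lambda>x. lin_comb N e' (q x)) \<in> plots N n U"
        by (rule diffeology_cong[OF DN pN]) (use q in simp)
      moreover have "q \<in> U \<rightarrow> {c. finite {j. c j \<noteq> 0}}" using pc q by (simp add: Pi_iff)
      ultimately show ?thesis by (simp add: free_pullback_def)
    qed
    show "p \<circ> s \<in> plots ?F m U'" if s: "s \<in> euclidean_plots n U m U'" for m U' s
    proof -
      have "s \<in> U' \<rightarrow> U" using s by (simp add: euclidean_plots_def)
      then show ?thesis
        using diffeology_comp[OF DM pM s] diffeology_comp[OF DN pN s] pc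
        by (auto simp: free_pullback_def o_def)
    qed
  next
    fix n U c assume "c \<in> carrier ?F" "openin (Euclidean_space n) U"
    then show "(\<lambda>_. c) \<in> plots ?F n U"
      using diffeology_const[OF DM lin_comb_closed[of M e, OF M e]]
        diffeology_const[OF DN lin_comb_closed[of N e', OF N e']]
      by (simp add: free_pullback_def)
  next
    fix n \<U> p assume *: "\<forall>U\<in>\<U>. openin (Euclidean_space n) U \<and> p \<in> plots ?F n U"
    have "(\<lambda>x. lin_comb M e (p x)) \<in> plots M n (\<Union>\<U>)"
      by (rule diffeology_glue[OF DM]) (use * in \<open>auto simp: free_pullback_def\<close>)
    moreover have "(\<lambda>x. lin_comb N e' (p x)) \<in> plots N n (\<Union>\<U>)"
      by (rule diffeology_glue[OF DN]) (use * in \<open>auto simp: free_pullback_def\<close>)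
    moreover have "p \<in> \<Union>\<U> \<rightarrow> {c. finite {j. c j \<noteq> 0}}"
      using * by (fastforce simp: free_pullback_def)
    ultimately show "p \<in> plots ?F n (\<Union>\<U>)" by (simp add: free_pullback_def)
  qed
  moreover have "(\<lambda>x. p x \<oplus>\<^bsub>?F\<^esub> q x) \<in> plots ?F n U"
    if p: "p \<in> plots ?F n U" and q: "q \<in> plots ?F n U" for n U p q
  proof -
    have pq: "finite {j. p x j \<noteq> 0}" "finite {j. q x j \<noteq> 0}" if "x \<in> U" for x
      using p q that by (auto simp: free_pullback_def)
    have "(\<lambda>x. lin_comb M e (\<lambda>j. p x j + q x j)) \<in> plots M n U"
      by (rule diffeology_cong[OF DM dvs_add_plot[OF M]])
        (use p q pq lin_comb_add[of M e, OF M e] in \<open>auto simp: free_pullback_def\<close>)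
    moreover have "(\<lambda>x. lin_comb N e' (\<lambda>j. p x j + q x j)) \<in> plots N n U"
      by (rule diffeology_cong[OF DN dvs_add_plot[OF N]])
        (use p q pq lin_comb_add[of N e', OF N e'] in \<open>auto simp: free_pullback_def\<close>)
    ultimately show ?thesis
      using pq finite_support_add by (auto simp: free_pullback_def)
  qed
  moreover have "(\<lambda>x. r x \<odot>\<^bsub>?F\<^esub> q x) \<in> plots ?F n U"
    if r: "r \<in> real_plots n U" and q: "q \<in> plots ?F n U" for n U r q
  proof -
    have qf: "finite {j. q x j \<noteq> 0}" if "x \<in> U" for x
      using q that by (auto simp: free_pullback_def)
    have "(\<lambda>x. lin_comb M e (\<lambda>j. r x * q x j)) \<in> plots M n U"
      by (rule diffeology_cong[OF DM dvs_smult_plot[OF M r]])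
        (use q qf lin_comb_smult[of M e, OF M e] in \<open>auto simp: free_pullback_def\<close>)
    moreover have "(\<lambda>x. lin_comb N e' (\<lambda>j. r x * q x j)) \<in> plots N n U"
      by (rule diffeology_cong[OF DN dvs_smult_plot[OF N r]])
        (use q qf lin_comb_smult[of N e', OF N e'] in \<open>auto simp: free_pullback_def\<close>)
    ultimately show ?thesis
      using qf finite_support_smult by (auto simp: free_pullback_def)
  qed
  ultimately show ?thesis
    by (auto simp: dvs_def smooth_map_def prod_plots_def o_def case_prod_unfold)
qed

lemma free_pullback_hom1: "DVect_hom (free_pullback M e N e') M (lin_comb M e)"
  unfolding DVect_hom_def smooth_linear_def smooth_map_def
  using dvs_free_pullback M lin_comb_closed[of M e, OF M e] lin_comb_add[of M e, OF M e] lin_comb_smult[of M e, OF M e]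
  by (auto simp: free_pullback_def o_def)

lemma free_pullback_hom2: "DVect_hom (free_pullback M e N e') N (lin_comb N e')"
  unfolding DVect_hom_def smooth_linear_def smooth_map_def
  using dvs_free_pullback N lin_comb_closed[of N e', OF N e'] lin_comb_add[of N e', OF N e'] lin_comb_smult[of N e', OF N e']
  by (auto simp: free_pullback_def o_def)

end

theorem projective_lift:
  fixes V :: "'a dvs" and W1 :: "'b dvs" and W2 :: "'c dvs"
  assumes V: "projective V" and f: "DVect_hom W1 W2 f" "subduction W1 W2 f"
    and g: "DVect_hom V W2 g"
  shows "\<exists>h. DVect_hom V W1 h \<and> (\<forall>x\<in>carrier V. g x = f (h x))"
proof -
  note dV = DVect_homD(1)[OF g] and dW1 = DVect_homD(1)[OF f(1)] and dW2 = DVect_homD(2)[OF g]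
  note DV = dvs_diffeology[OF dV] and DW1 = dvs_diffeology[OF dW1]
  interpret mV: module real_field V
    rewrites "carrier real_field = UNIV" and "mult real_field = (*)" and "one real_field = 1"
      and "zero real_field = 0" and "add real_field = (+)"
    using dvs_module[OF dV] by simp_all
  interpret mW1: module real_field W1
    rewrites "carrier real_field = UNIV" and "mult real_field = (*)" and "one real_field = 1"
      and "zero real_field = 0" and "add real_field = (+)"
    using dvs_module[OF dW1] by simp_all
  let ?P = "\<lambda>n U p x (U', r). openin (Euclidean_space n) U' \<and> x \<in> U' \<and> U' \<subseteq> U \<and>
    r \<in> plots W1 n U' \<and> (\<forall>y\<in>U'. f (r y) = g (p y))"
  have ex: "\<exists>z. ?P n U p x z" if "p \<in> plots V n U" "x \<in> U" for n U p x
  proof -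
    have "(\<lambda>y. g (p y)) \<in> plots W2 n U" using DVect_homD(6)[OF g that(1)] .
    then have "locally_lifts (plots W1) f n U (\<lambda>y. g (p y))"
      using f(2) by (auto simp: subduction_map_def)
    then show ?thesis using that(2) unfolding locally_lifts_def by fast
  qed
  define Z where "Z n U p x = (SOME z. ?P n U p x z)" for n U p x
  have Z: "?P n U p x (Z n U p x)" if "p \<in> plots V n U" "x \<in> U" for n U p x
    unfolding Z_def using someI_ex[OF ex[OF that]] .
  define ok where "ok = (\<lambda>(n, U, p, x, y). p \<in> plots V n U \<and> x \<in> U \<and> y \<in> fst (Z n U p x))"
  define e where "e = (\<lambda>(n, U, p, x, y). if ok (n, U, p, x, y) then p y else \<zero>\<^bsub>V\<^esub>)"
  define e' where "e' = (\<lambda>(n, U, p, x, y). if ok (n, U, p, x, y) then snd (Z n U p x) y else \<zero>\<^bsub>W1\<^esub>)"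
  have Z': "openin (Euclidean_space n) (fst (Z n U p x))" "x \<in> fst (Z n U p x)"
    "fst (Z n U p x) \<subseteq> U" "snd (Z n U p x) \<in> plots W1 n (fst (Z n U p x))"
    "\<And>y. y \<in> fst (Z n U p x) \<Longrightarrow> f (snd (Z n U p x) y) = g (p y)"
    if "p \<in> plots V n U" "x \<in> U" for n U p x
    using Z[OF that] by (auto simp: case_prod_unfold)
  have e: "e j \<in> carrier V" for j
  proof (cases j)
    case (fields n U p x y)
    show ?thesis
      unfolding fields e_def ok_def using Z'(3)[of p n U x] diffeology_into[OF DV, of p n U] by auto
  qed
  have e': "e' j \<in> carrier W1" for j
  proof (cases j)
    case (fields n U p x y)
    show ?thesis
      unfolding fields e'_def ok_def using diffeology_into[OF DW1 Z'(4)[of p n U x]] by auto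
  qed
  have fe: "f (e' j) = g (e j)" for j
  proof (cases j)
    case (fields n U p x y)
    show ?thesis
      unfolding fields e_def e'_def ok_def
      using Z'(5)[of p n U x] DVect_hom_zero[OF f(1)] DVect_hom_zero[OF g] by auto
  qed
  let ?F = "free_pullback V e W1 e'"
  have hom1: "DVect_hom ?F V (lin_comb V e)" by (rule free_pullback_hom1[of V e W1 e', OF dV e dW1 e'])
  have hom2: "DVect_hom ?F W1 (lin_comb W1 e')" by (rule free_pullback_hom2[of V e W1 e', OF dV e dW1 e'])
  have lifts: "locally_lifts (plots ?F) (lin_comb V e) n U p" if p: "p \<in> plots V n U" for n U p
    unfolding locally_lifts_def
  proof
    fix x assume x: "x \<in> U"
    note Zx = Z'[OF p x]
    define q where "q y = (\<lambda>j. if j = (n, U, p, x, y) then 1 else (0::real))" for y :: "nat \<Rightarrow> real"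
    have qV: "lin_comb V e (q y) = e (n, U, p, x, y)"
      and qW: "lin_comb W1 e' (q y) = e' (n, U, p, x, y)" for y
      unfolding q_def by (rule lin_comb_unit[of V e, OF dV e] lin_comb_unit[of W1 e', OF dW1 e'])+
    have "ok (n, U, p, x, y)" if "y \<in> fst (Z n U p x)" for y
      using p x that by (simp add: ok_def)
    then have eq: "lin_comb V e (q y) = p y" "lin_comb W1 e' (q y) = snd (Z n U p x) y"
      if "y \<in> fst (Z n U p x)" for y
      unfolding qV qW using that by (auto simp: e_def e'_def)
    have inc: "(\<lambda>y. y) \<in> euclidean_plots n U n (fst (Z n U p x)) \<Longrightarrow> p \<in> plots V n (fst (Z n U p x))"
      using diffeology_comp[OF DV p] by (fastforce simp: o_def)
    have "(\<lambda>y. y) \<in> euclidean_plots n U n (fst (Z n U p x))"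
      using Zx(1,3) diffeology_open[OF DV p] smooth_on_coord[OF _ Zx(1)]
      by (auto simp: euclidean_plots_def)
    from inc[OF this] have "(\<lambda>y. lin_comb V e (q y)) \<in> plots V n (fst (Z n U p x))"
      by (rule diffeology_cong[OF DV]) (use eq in auto)
    moreover have "(\<lambda>y. lin_comb W1 e' (q y)) \<in> plots W1 n (fst (Z n U p x))"
      by (rule diffeology_cong[OF DW1 Zx(4)]) (use eq in auto)
    moreover have "finite {j. q y j \<noteq> 0}" for y by (simp add: q_def)
    ultimately have "q \<in> plots ?F n (fst (Z n U p x))" by (simp add: free_pullback_def)
    then show "\<exists>U'. openin (Euclidean_space n) U' \<and> x \<in> U' \<and> U' \<subseteq> U \<and>
        (\<exists>q\<in>plots ?F n U'. \<forall>y\<in>U'. lin_comb V e (q y) = p y)"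
      using Zx(1-3) eq(1) by blast
  qed
  have "v \<in> lin_comb V e ` carrier ?F" if v: "v \<in> carrier V" for v
  proof -
    let ?U = "topspace (Euclidean_space 0)"
    have x: "(\<lambda>_. 0) \<in> ?U" by (simp add: topspace_Euclidean_space)
    have "(\<lambda>_. v) \<in> plots V 0 ?U" by (rule diffeology_const[OF DV v]) simp
    from lifts[OF this] x obtain U' q where
      q: "(\<lambda>_. 0) \<in> U'" "q \<in> plots ?F 0 U'" "\<forall>y\<in>U'. lin_comb V e (q y) = v"
      unfolding locally_lifts_def by blast
    have "q (\<lambda>_. 0) \<in> carrier ?F" using q(1,2) by (auto simp: free_pullback_def)
    moreover have "v = lin_comb V e (q (\<lambda>_. 0))" using q by simp
    ultimately show ?thesis by blast
  qed
  moreover have "lin_comb V e ` carrier ?F \<subseteq> carrier V" using DVect_homD(3)[OF hom1] by auto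
  ultimately have "subduction ?F V (lin_comb V e)"
    using lifts hom1 unfolding subduction_map_def DVect_hom_def smooth_linear_def by auto
  with V hom1 DVect_hom_id[OF dV]
  obtain h where h: "DVect_hom V ?F h" "\<And>x. x \<in> carrier V \<Longrightarrow> x = lin_comb V e (h x)"
    unfolding projective_def by blast
  have "g x = f (lin_comb W1 e' (h x))" if x: "x \<in> carrier V" for x
  proof -
    have fin: "finite {j. h x j \<noteq> 0}"
      using DVect_homD(3)[OF h(1)] x by (auto simp: free_pullback_def)
    have "f (lin_comb W1 e' (h x)) = lin_comb W2 (\<lambda>j. f (e' j)) (h x)"
      by (rule DVect_hom_lin_comb[OF f(1) e' fin])
    also have "\<dots> = lin_comb W2 (\<lambda>j. g (e j)) (h x)" by (simp add: fe)
    also have "\<dots> = g (lin_comb V e (h x))" by (rule DVect_hom_lin_comb[OF g e fin, symmetric])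
    finally show ?thesis using h(2)[OF x] by simp
  qed
  then show ?thesis using DVect_hom_comp[OF h(1) hom2] by blast
qed

section \<open>Complexes and resolutions\<close>

definition chain_complex :: "(int \<Rightarrow> 'a dvs) \<Rightarrow> (int \<Rightarrow> 'a \<Rightarrow> 'a) \<Rightarrow> bool" where
  "chain_complex C d \<longleftrightarrow> (\<forall>n. DVect_hom (C n) (C (n - 1)) (d n)) \<and>
     (\<forall>n. \<forall>x\<in>carrier (C (n + 1)). d n (d (n + 1) x) = \<zero>\<^bsub>C (n - 1)\<^esub>)"

text \<open>The map induced by \<open>d (n + 1)\<close> on cosets of its kernel sends a coset to the single element
  of its image.\<close>

definition exact_at_spot :: "(int \<Rightarrow> 'a dvs) \<Rightarrow> (int \<Rightarrow> 'a \<Rightarrow> 'a) \<Rightarrow> int \<Rightarrow> bool" where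
  "exact_at_spot C d n \<longleftrightarrow>
     short_exact (dvs_quot (C (n + 1)) (a_kernel (C (n + 1)) (C n) (d (n + 1)))) (C n)
       (dvs_sub (C (n - 1)) (d n ` carrier (C n)))
       (\<lambda>X. the_elem (d (n + 1) ` X)) (d n)"

text \<open>The term in degree -1 is only required to be isomorphic to V, since the type of the
  elements of V may be too small to accommodate the other terms of the resolution.\<close>

definition projective_resolution ::
    "'v dvs \<Rightarrow> (int \<Rightarrow> 'p dvs) \<Rightarrow> (int \<Rightarrow> 'p \<Rightarrow> 'p) \<Rightarrow> bool" where
  "projective_resolution V C d \<longleftrightarrow> chain_complex C d \<and> (\<forall>n. exact_at_spot C d n) \<and>
     DVect_isomorphic V (C (-1)) \<and> (\<forall>n < -1. carrier (C n) = {\<zero>\<^bsub>C n\<^esub>}) \<and>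
     (\<forall>n\<ge>0. projective (C n))"

text \<open>The complex with the term in degree -1 replaced by 0.\<close>

definition trunc :: "(int \<Rightarrow> 'p dvs) \<Rightarrow> int \<Rightarrow> 'p dvs" where
  "trunc C = C(-1 := dvs_sub (C (-1)) {\<zero>\<^bsub>C (-1)\<^esub>})"

definition trunc_diff :: "(int \<Rightarrow> 'p dvs) \<Rightarrow> (int \<Rightarrow> 'p \<Rightarrow> 'p) \<Rightarrow> int \<Rightarrow> 'p \<Rightarrow> 'p" where
  "trunc_diff C d = d(0 := (\<lambda>_. \<zero>\<^bsub>C (-1)\<^esub>))"

section \<open>Ext\<close>

definition cocycles :: "(int \<Rightarrow> 'a dvs) \<Rightarrow> (int \<Rightarrow> 'a \<Rightarrow> 'a) \<Rightarrow> int \<Rightarrow> 'a set" where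
  "cocycles L \<delta> n = a_kernel (L n) (L (n + 1)) (\<delta> n)"

definition coboundaries :: "(int \<Rightarrow> 'a dvs) \<Rightarrow> (int \<Rightarrow> 'a \<Rightarrow> 'a) \<Rightarrow> int \<Rightarrow> 'a set" where
  "coboundaries L \<delta> n = \<delta> (n - 1) ` carrier (L (n - 1))"

definition cohomology :: "(int \<Rightarrow> 'a dvs) \<Rightarrow> (int \<Rightarrow> 'a \<Rightarrow> 'a) \<Rightarrow> int \<Rightarrow> 'a set dvs" where
  "cohomology L \<delta> n = dvs_quot (dvs_sub (L n) (cocycles L \<delta> n)) (coboundaries L \<delta> n)"

definition Hom_complex :: "(int \<Rightarrow> 'p dvs) \<Rightarrow> 'w dvs \<Rightarrow> int \<Rightarrow> ('p \<Rightarrow> 'w) dvs" where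
  "Hom_complex P W n = Linf (P n) W"

definition Hom_diff ::
    "(int \<Rightarrow> 'p dvs) \<Rightarrow> (int \<Rightarrow> 'p \<Rightarrow> 'p) \<Rightarrow> int \<Rightarrow> ('p \<Rightarrow> 'w) \<Rightarrow> ('p \<Rightarrow> 'w)" where
  "Hom_diff P d n \<phi> = compose (carrier (P (n + 1))) \<phi> (d (n + 1))"

text \<open>\<open>Ext C d n W\<close> is the n-th Ext of V and W computed from the resolution \<open>(C, d)\<close> of V.\<close>

definition Ext ::
    "(int \<Rightarrow> 'p dvs) \<Rightarrow> (int \<Rightarrow> 'p \<Rightarrow> 'p) \<Rightarrow> nat \<Rightarrow> 'w dvs \<Rightarrow> ('p \<Rightarrow> 'w) set dvs" where
  "Ext C d n W =
     cohomology (Hom_complex (trunc C) W) (Hom_diff (trunc C) (trunc_diff C d)) (int n)"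

text \<open>Maps induced by composition with \<open>f : W \<rightarrow> W'\<close>. On Ext, the class of \<open>\<phi>\<close> goes to the class
  of \<open>f \<circ> \<phi>\<close>; the union below is that of a family of cosets which all coincide.\<close>

definition Linf_map :: "'v dvs \<Rightarrow> ('w \<Rightarrow> 'w') \<Rightarrow> ('v \<Rightarrow> 'w) \<Rightarrow> ('v \<Rightarrow> 'w')" where
  "Linf_map V f \<phi> = compose (carrier V) f \<phi>"

definition Ext_map ::
    "(int \<Rightarrow> 'p dvs) \<Rightarrow> (int \<Rightarrow> 'p \<Rightarrow> 'p) \<Rightarrow> nat \<Rightarrow> 'w' dvs \<Rightarrow> ('w \<Rightarrow> 'w') \<Rightarrow>
     ('p \<Rightarrow> 'w) set \<Rightarrow> ('p \<Rightarrow> 'w') set" where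
  "Ext_map C d n W' f X =
     (let L = Hom_complex (trunc C) W'; B = coboundaries L (Hom_diff (trunc C) (trunc_diff C d)) (int n)
      in \<Union>\<phi>\<in>X. B +>\<^bsub>L (int n)\<^esub> Linf_map (trunc C (int n)) f \<phi>)"

end

theory Submission
  imports Defs
begin

text \<open>The sequence is the long exact cohomology sequence of
  \<open>0 \<rightarrow> L(P, W1) \<rightarrow> L(P, W2) \<rightarrow> L(P, W3) \<rightarrow> 0\<close> for the projective resolution P. Smoothness of the
  connecting maps requires more than surjectivity of \<open>L(P\<^sub>n, W2) \<rightarrow> L(P\<^sub>n, W3)\<close>: plots of the
  right-hand side have to lift locally, that is, a smooth family of maps from \<open>P\<^sub>n\<close> to W3 must lift
  to a smooth family of maps to W2. Plots of W3 lift to W2 not just locally but over neighbourhoods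
  of compact boxes, since two lifts can be glued with a cutoff function: the lifts of a plot form an
  affine space. Hence such families lift over boxes, by projectivity of \<open>P\<^sub>n\<close>.\<close>

section \<open>Calculus on open subsets of Euclidean spaces\<close>

text \<open>The lifting property of P concerns single linear maps, whereas a plot p of L(P, W3) is a
  family of them. Read as one linear map v \<mapsto> (u \<mapsto> p u v) into the smooth functions
  on a box U0, it would call for a subduction between spaces of smooth functions on U0; but plots of
  such functions need not extend past the boundary of U0, so compactness gives no lift over all of
  it. Hence a fibre product over P is formed: only the functions p u (r y) have to be lifted, and
  they live on the larger set U, which contains the closed box.

  Cohomology adds a second obstacle: lifts of cocycles and representatives of classes are smooth
  only locally, so the connecting map has no evidently smooth global formula. It is built as a
  linear relation with locally smooth selections, single-valued because its fibre over 0 is 0.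

  In degree 0 the cocycles are merely isomorphic to L(V, W). Leaving the quotient of the cocycles as
  a parameter lets one diagram chase produce all connecting maps.\<close>

abbreviation Espace :: "nat \<Rightarrow> (nat \<Rightarrow> real) set" where
  "Espace n \<equiv> topspace (Euclidean_space n)"

abbreviation eopen :: "nat \<Rightarrow> (nat \<Rightarrow> real) set \<Rightarrow> bool" where
  "eopen n \<equiv> openin (Euclidean_space n)"

abbreviation cont_on :: "nat \<Rightarrow> (nat \<Rightarrow> real) set \<Rightarrow> ((nat \<Rightarrow> real) \<Rightarrow> real) \<Rightarrow> bool" where
  "cont_on n U \<equiv> continuous_map (subtopology (Euclidean_space n) U) euclideanreal"

abbreviation has_partial :: "((nat \<Rightarrow> real) \<Rightarrow> real) \<Rightarrow> nat \<Rightarrow> (nat \<Rightarrow> real) \<Rightarrow> real \<Rightarrow> bool" where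
  "has_partial f i x D \<equiv> ((\<lambda>t. f (x(i := t))) has_real_derivative D) (at (x i))"

definition obox :: "nat \<Rightarrow> (nat \<Rightarrow> real) \<Rightarrow> (nat \<Rightarrow> real) \<Rightarrow> (nat \<Rightarrow> real) set" where
  "obox n a b = {y \<in> Espace n. \<forall>i<n. a i < y i \<and> y i < b i}"

abbreviation cube :: "nat \<Rightarrow> (nat \<Rightarrow> real) \<Rightarrow> real \<Rightarrow> (nat \<Rightarrow> real) set" where
  "cube n x e \<equiv> obox n (\<lambda>i. x i - e) (\<lambda>i. x i + e)"

lemma in_topspace_Euclidean: "x \<in> Espace n \<longleftrightarrow> (\<forall>i\<ge>n. x i = 0)"
  by (simp add: topspace_Euclidean_space)

lemma cube_iff:
  "y \<in> cube n x e \<longleftrightarrow> y \<in> Espace n \<and> (\<forall>i<n. \<bar>y i - x i\<bar> < e)"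
  unfolding obox_def by (auto simp: abs_less_iff algebra_simps)

lemma continuous_map_Euclidean_coord:
  "continuous_map (Euclidean_space n) euclideanreal (\<lambda>x. x i)"
  unfolding Euclidean_space_def
  by (intro continuous_map_from_subtopology continuous_map_product_projection) simp

lemma openin_obox: "eopen n (obox n a b)"
proof -
  have 1: "eopen n {y \<in> Espace n. y i \<in> {a i<..<b i}}" for i
    by (rule openin_continuous_map_preimage[OF continuous_map_Euclidean_coord]) simp
  have "eopen n {y \<in> Espace n. \<forall>i\<in>A. a i < y i \<and> y i < b i}"
    if "finite A" for A
    using that
  proof induction
    case (insert j A)
    have "{y \<in> Espace n. \<forall>i\<in>insert j A. a i < y i \<and> y i < b i} =
      {y \<in> Espace n. \<forall>i\<in>A. a i < y i \<and> y i < b i} \<inter>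
      {y \<in> Espace n. y j \<in> {a j<..<b j}}" by auto
    then show ?case using openin_Int[OF insert(3) 1[of j]] by simp
  qed simp
  from this[of "{..<n}"] show ?thesis by (simp add: obox_def Ball_def)
qed

text \<open>A basic open set of the product topology constrains only finitely many coordinates, so
  the radii have a positive minimum; coordinates from n on agree since both points vanish
  there.\<close>

lemma openin_cube_subset:
  assumes U: "eopen n U" and x: "x \<in> U"
  obtains e where "e > 0" and "cube n x e \<subseteq> U"
proof -
  obtain T where T: "openin (powertop_real UNIV) T" "U = T \<inter> {y. \<forall>i\<ge>n. y i = 0}"
    using U unfolding Euclidean_space_def openin_subtopology by auto
  then obtain B where B: "finite {i. B i \<noteq> UNIV}" "\<And>i. open (B i)" "x \<in> PiE UNIV B" "PiE UNIV B \<subseteq> T"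
    using x unfolding openin_product_topology_alt by force
  have "\<exists>e>0. \<forall>t. \<bar>t - x i\<bar> < e \<longrightarrow> t \<in> B i" for i
    using B(2)[of i] B(3) by (force simp: open_real)
  then obtain r where r: "\<And>i. r i > 0" "\<And>i t. \<bar>t - x i\<bar> < r i \<Longrightarrow> t \<in> B i" by metis
  \<comment> \<open>The 1 keeps the set nonempty when no factor is a proper subset.\<close>
  define e where "e = Min (insert 1 (r ` {i. B i \<noteq> UNIV}))"
  have e: "e > 0" "\<And>i. B i \<noteq> UNIV \<Longrightarrow> e \<le> r i"
    unfolding e_def using B(1) r(1) by (auto intro: Min_le)
  have "y \<in> U" if y: "y \<in> cube n x e" for y
  proof -
    have "y i \<in> B i" for i
    proof (cases "i < n")
      case True
      then show ?thesis using y e(2)[of i] r(2)[of "y i" i] unfolding cube_iff by force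
    next
      case False
      then have "y i = x i" using y x T(2) by (auto simp: cube_iff in_topspace_Euclidean)
      then show ?thesis using r(1)[of i] r(2)[of "y i" i] by simp
    qed
    then show ?thesis using B(4) T(2) y by (auto simp: cube_iff in_topspace_Euclidean)
  qed
  then show thesis using that e(1) by blast
qed

lemma openin_update:
  assumes "eopen n U" and "x \<in> U" and "i < n"
  obtains e where "e > 0" and "\<And>t. \<bar>t - x i\<bar> < e \<Longrightarrow> x(i := t) \<in> U"
proof -
  obtain e where e: "e > 0" "cube n x e \<subseteq> U" using openin_cube_subset[OF assms(1,2)] .
  have x: "x \<in> Espace n" using assms(1,2) openin_subset by blast
  have "x(i := t) \<in> cube n x e" if "\<bar>t - x i\<bar> < e" for t
    using that x assms(3) e(1) by (auto simp: cube_iff in_topspace_Euclidean)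
  then show thesis using that e by blast
qed

lemma continuous_map_cube:
  assumes f: "cont_on n U f"
    and U: "eopen n U" and x: "x \<in> U" and e: "e > (0::real)"
  obtains r where "r > 0" and "\<And>y. y \<in> cube n x r \<Longrightarrow> y \<in> U \<and> \<bar>f y - f x\<bar> < e"
proof -
  have "openin (subtopology (Euclidean_space n) U) {y \<in> topspace (subtopology (Euclidean_space n) U). f y \<in> {f x - e<..<f x + e}}"
    by (rule openin_continuous_map_preimage[OF f]) simp
  then have "eopen n {y \<in> topspace (subtopology (Euclidean_space n) U). f y \<in> {f x - e<..<f x + e}}"
    using U openin_trans_full by blast
  moreover have "x \<in> {y \<in> topspace (subtopology (Euclidean_space n) U). f y \<in> {f x - e<..<f x + e}}"
    using x e openin_subset[OF U] by auto
  ultimately obtain r where "r > 0"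
    "cube n x r \<subseteq> {y \<in> topspace (subtopology (Euclidean_space n) U). f y \<in> {f x - e<..<f x + e}}"
    using openin_cube_subset by blast
  then show thesis using that by (force simp: abs_less_iff)
qed

subsection \<open>The chain rule\<close>

lemma MVT_unordered:
  fixes h h' :: "real \<Rightarrow> real"
  assumes "\<And>t. min a b \<le> t \<Longrightarrow> t \<le> max a b \<Longrightarrow> (h has_real_derivative h' t) (at t)"
  obtains t where "min a b \<le> t" and "t \<le> max a b" and "h b - h a = h' t * (b - a)"
proof (cases a b rule: linorder_cases)
  case less
  then show ?thesis using MVT2[of a b h h'] assms that by (smt (verit) mult.commute)
next
  case equal
  then show ?thesis using that[of a] by simp
next
  case greater
  then obtain z where "b < z" "z < a" "h a - h b = (a - b) * h' z"
    using MVT2[of b a h h'] assms by (smt (verit))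
  then show ?thesis using that[of z] by (simp add: algebra_simps)
qed

text \<open>The hybrid points take coordinates from y below i and from x above i. Moving coordinate
  i between x i and y i stays inside the cube, so the one-variable mean value theorem applies along
  that segment.\<close>

lemma partial_increment:
  assumes U: "eopen n U" and box: "cube n x e \<subseteq> U" and x: "x \<in> U"
    and D: "\<And>w. w \<in> U \<Longrightarrow> has_partial f i w (g w)"
    and y: "y \<in> cube n x e" and i: "i < n"
  obtains w where "w \<in> cube n x e"
    and "f (\<lambda>j. if j < Suc i then y j else x j) - f (\<lambda>j. if j < i then y j else x j) =
      g w * (y i - x i)"
proof -
  define z where "z = (\<lambda>j. if j < i then y j else x j)"
  have xt: "x \<in> Espace n" using U x openin_subset by blast
  have mem: "z(i := t) \<in> cube n x e" if "min (x i) (y i) \<le> t" "t \<le> max (x i) (y i)" for t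
  proof -
    have "\<bar>y i - x i\<bar> < e" using y i by (simp add: cube_iff)
    then have "\<bar>t - x i\<bar> < e" and "e > 0" using that by linarith+
    then show ?thesis
      using y xt i by (auto simp: cube_iff in_topspace_Euclidean z_def)
  qed
  have "((\<lambda>s. f (z(i := s))) has_real_derivative g (z(i := t))) (at t)"
    if "min (x i) (y i) \<le> t" "t \<le> max (x i) (y i)" for t
    using D[of "z(i := t)"] mem[OF that] box by auto
  then obtain t where t: "min (x i) (y i) \<le> t" "t \<le> max (x i) (y i)"
    "f (z(i := y i)) - f (z(i := x i)) = g (z(i := t)) * (y i - x i)"
    using MVT_unordered[of "x i" "y i" "\<lambda>s. f (z(i := s))" "\<lambda>t. g (z(i := t))"] by blast
  have "z(i := y i) = (\<lambda>j. if j < Suc i then y j else x j)" "z(i := x i) = z"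
    by (auto simp: z_def fun_eq_iff)
  then show thesis using that[OF mem[OF t(1,2)]] t(3) by (simp add: z_def)
qed

text \<open>\<open>Ck_on\<close> supplies only partial derivatives, so the classical argument is
  carried out: the increment of f telescopes over the hybrid points, and by continuity of the
  partials each difference quotient tends to its value at c t0. The condition on
  \<open>Espace n\<close> controls the coordinates from n on, about which the derivatives of c say
  nothing.\<close>

lemma chain_rule_curve:
  assumes U: "eopen n U"
    and D: "\<And>i w. i < n \<Longrightarrow> w \<in> U \<Longrightarrow> has_partial f i w (g i w)"
    and g: "\<And>i. i < n \<Longrightarrow> cont_on n U (g i)"
    and c: "\<And>i. i < n \<Longrightarrow> ((\<lambda>t. c t i) has_real_derivative c' i) (at t0)"
    and cU: "c t0 \<in> U" "eventually (\<lambda>t. c t \<in> Espace n) (at t0)"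
  shows "((\<lambda>t. f (c t)) has_real_derivative (\<Sum>i<n. g i (c t0) * c' i)) (at t0)"
proof -
  define x where "x = c t0"
  have xU: "x \<in> U" using cU by (simp add: x_def)
  have xt: "x \<in> Espace n" using U xU openin_subset by blast
  define z where "z y k = (\<lambda>j. if j < k then y j else x j)" for y and k :: nat
  \<comment> \<open>The value at y i = x i fills the gap of the difference quotient continuously and
    makes the increment formula valid there too.\<close>
  define G where "G i y = (if y i = x i then g i x else (f (z y (Suc i)) - f (z y i)) / (y i - x i))" for i y
  have near: "eventually (\<lambda>t. c t \<in> cube n x e) (at t0)" if "e > 0" for e
  proof -
    have "eventually (\<lambda>t. \<bar>c t i - x i\<bar> < e) (at t0)" if "i < n" for i
    proof -
      have "((\<lambda>t. c t i) \<longlongrightarrow> c t0 i) (at t0)"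
        using DERIV_isCont[OF c[OF that]] by (simp add: isCont_def)
      then show ?thesis using tendstoD[OF _ \<open>e > 0\<close>] by (fastforce simp: x_def dist_real_def)
    qed
    then have "eventually (\<lambda>t. \<forall>i\<in>{..<n}. \<bar>c t i - x i\<bar> < e) (at t0)"
      by (subst eventually_ball_finite_distrib) auto
    then show ?thesis using cU(2) by eventually_elim (simp add: cube_iff)
  qed
  obtain e where e: "e > 0" "cube n x e \<subseteq> U" using openin_cube_subset[OF U xU] .
  have inc: "f y - f x = (\<Sum>i<n. G i y * (y i - x i))" if y: "y \<in> cube n x e" for y
  proof -
    have "f y - f x = f (z y n) - f (z y 0)"
    proof -
      have "z y n = y" using y xt by (auto simp: z_def cube_iff in_topspace_Euclidean)
      then show ?thesis by (simp add: z_def)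
    qed
    also have "\<dots> = (\<Sum>i<n. f (z y (Suc i)) - f (z y i))" by (rule sum_lessThan_telescope[symmetric])
    also have "\<dots> = (\<Sum>i<n. G i y * (y i - x i))"
    proof (rule sum.cong)
      fix i assume "i \<in> {..<n}"
      have "z y (Suc i) = z y i" if "y i = x i"
        using that by (auto simp: z_def fun_eq_iff less_Suc_eq)
      then show "f (z y (Suc i)) - f (z y i) = G i y * (y i - x i)" by (auto simp: G_def)
    qed simp
    finally show ?thesis .
  qed
  have Glim: "((\<lambda>t. G i (c t)) \<longlongrightarrow> g i x) (at t0)" if i: "i < n" for i
  proof (rule tendstoI)
    fix r :: real assume r: "r > 0"
    obtain s where s: "s > 0" "\<And>y. y \<in> cube n x s \<Longrightarrow> y \<in> U \<and> \<bar>g i y - g i x\<bar> < r"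
      using continuous_map_cube[OF g[OF i] U xU r] by blast
    have "\<bar>G i y - g i x\<bar> < r" if y: "y \<in> cube n x s" for y
    proof (cases "y i = x i")
      case False
      have "cube n x s \<subseteq> U" using s by blast
      then obtain w where "w \<in> cube n x s" "f (z y (Suc i)) - f (z y i) = g i w * (y i - x i)"
        unfolding z_def using partial_increment[OF U _ xU D[OF i] y i] by blast
      then show ?thesis using False s(2) by (simp add: G_def)
    qed (simp add: G_def r)
    then show "\<forall>\<^sub>F t in at t0. dist (G i (c t)) (g i x) < r"
      using near[OF s(1)] by (auto elim!: eventually_mono simp: dist_real_def)
  qed
  have "((\<lambda>t. \<Sum>i<n. G i (c t) * ((c t i - c t0 i) / (t - t0))) \<longlongrightarrow> (\<Sum>i<n. g i x * c' i)) (at t0)"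
    by (intro tendsto_sum tendsto_mult Glim) (use c in \<open>auto simp: has_field_derivative_iff\<close>)
  moreover have "\<forall>\<^sub>F t in at t0. (\<Sum>i<n. G i (c t) * ((c t i - c t0 i) / (t - t0))) =
      (f (c t) - f (c t0)) / (t - t0)"
    using near[OF e(1)] by eventually_elim (simp add: inc[unfolded x_def] x_def sum_divide_distrib)
  ultimately have "((\<lambda>t. (f (c t) - f (c t0)) / (t - t0)) \<longlongrightarrow> (\<Sum>i<n. g i x * c' i)) (at t0)"
    using tendsto_cong by fast
  then show ?thesis by (simp add: has_field_derivative_iff x_def)
qed

subsection \<open>Closure properties of smooth functions\<close>

lemma Ck_on_continuous:
  "Ck_on k n U f \<Longrightarrow> cont_on n U f"
  by (cases k) auto

text \<open>Openness of U matters: near each point of U the coordinate segments used by the partial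
  derivatives stay in U, where the two functions agree.\<close>

lemma Ck_on_cong:
  assumes "Ck_on k n U f" and "\<And>x. x \<in> U \<Longrightarrow> h x = f x" and U: "eopen n U"
  shows "Ck_on k n U h"
proof -
  have cont: "cont_on n U h"
    by (rule continuous_map_eq[OF Ck_on_continuous[OF assms(1)]]) (use assms(2) in auto)
  show ?thesis
  proof (cases k)
    case (Suc k')
    have "\<exists>g. (\<forall>x\<in>U. has_partial h i x (g x)) \<and> Ck_on k' n U g"
      if i: "i < n" for i
    proof -
      obtain g where g: "\<And>x. x \<in> U \<Longrightarrow> has_partial f i x (g x)"
        "Ck_on k' n U g" using assms(1) i unfolding Suc Ck_on.simps by blast
      have "has_partial h i x (g x)" if x: "x \<in> U" for x
      proof -
        obtain e where e: "e > 0" "\<And>t. \<bar>t - x i\<bar> < e \<Longrightarrow> x(i := t) \<in> U"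
          using openin_update[OF U x i] by blast
        show ?thesis
          by (rule has_field_derivative_transform_within[OF g(1)[OF x] e(1)])
            (use e(2) assms(2) in \<open>auto simp: dist_real_def\<close>)
      qed
      then show ?thesis using g(2) by blast
    qed
    then show ?thesis using cont Suc by simp
  qed (use cont in simp)
qed

lemma Ck_on_SucI:
  assumes "cont_on n U f"
    and "\<And>i x. i < n \<Longrightarrow> x \<in> U \<Longrightarrow> has_partial f i x (g i x)"
    and "\<And>i. i < n \<Longrightarrow> Ck_on k n U (g i)"
  shows "Ck_on (Suc k) n U f"
  using assms by auto

lemma Ck_on_SucE:
  assumes "Ck_on (Suc k) n U f"
  obtains g where "cont_on n U f"
    and "\<And>i x. i < n \<Longrightarrow> x \<in> U \<Longrightarrow> has_partial f i x (g i x)"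
    and "\<And>i. i < n \<Longrightarrow> Ck_on k n U (g i)"
proof -
  have "\<forall>i. \<exists>g. i < n \<longrightarrow> (\<forall>x\<in>U. has_partial f i x (g x)) \<and> Ck_on k n U g"
    using assms by auto
  then obtain g where "\<And>i. i < n \<Longrightarrow> (\<forall>x\<in>U. has_partial f i x (g i x)) \<and> Ck_on k n U (g i)"
    by metis
  then show thesis using that[of g] Ck_on_continuous[OF assms] by blast
qed

lemma Ck_on_Suc_imp: "Ck_on (Suc k) n U f \<Longrightarrow> Ck_on k n U f"
proof (induction k arbitrary: f)
  case (Suc k)
  obtain g where g: "cont_on n U f"
    "\<And>i x. i < n \<Longrightarrow> x \<in> U \<Longrightarrow> has_partial f i x (g i x)"
    "\<And>i. i < n \<Longrightarrow> Ck_on (Suc k) n U (g i)" by (rule Ck_on_SucE[OF Suc(2)]) (rule that)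
  show ?case by (rule Ck_on_SucI[OF g(1,2) Suc.IH[OF g(3)]])
qed simp

lemma Ck_on_subset: "Ck_on k n U f \<Longrightarrow> T \<subseteq> U \<Longrightarrow> Ck_on k n T f"
proof (induction k arbitrary: f)
  case 0
  have "cont_on n T f"
    by (rule continuous_map_from_subtopology_mono[OF Ck_on_continuous[OF 0(1)] 0(2)])
  then show ?case by simp
next
  case (Suc k)
  have "cont_on n T f"
    by (rule continuous_map_from_subtopology_mono[OF Ck_on_continuous[OF Suc(2)] Suc(3)])
  moreover obtain g where g: "cont_on n U f"
    "\<And>i x. i < n \<Longrightarrow> x \<in> U \<Longrightarrow> has_partial f i x (g i x)"
    "\<And>i. i < n \<Longrightarrow> Ck_on k n U (g i)" by (rule Ck_on_SucE[OF Suc(2)]) (rule that)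
  ultimately show ?case
    using Suc.IH Suc.prems(2) by (intro Ck_on_SucI[of _ _ _ g]) blast+
qed

lemma Ck_on_add: "Ck_on k n U f \<Longrightarrow> Ck_on k n U h \<Longrightarrow> Ck_on k n U (\<lambda>x. f x + h x)"
proof (induction k arbitrary: f h)
  case 0
  then show ?case by (simp add: continuous_map_add)
next
  case (Suc k)
  obtain g1 where 1: "cont_on n U f"
    "\<And>i x. i < n \<Longrightarrow> x \<in> U \<Longrightarrow> has_partial f i x (g1 i x)"
    "\<And>i. i < n \<Longrightarrow> Ck_on k n U (g1 i)" by (rule Ck_on_SucE[OF Suc(2)]) (rule that)
  obtain g2 where 2: "cont_on n U h"
    "\<And>i x. i < n \<Longrightarrow> x \<in> U \<Longrightarrow> has_partial h i x (g2 i x)"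
    "\<And>i. i < n \<Longrightarrow> Ck_on k n U (g2 i)" by (rule Ck_on_SucE[OF Suc(3)]) (rule that)
  show ?case
    by (rule Ck_on_SucI[where g = "\<lambda>i x. g1 i x + g2 i x"])
      (rule continuous_map_add DERIV_add Suc.IH; use 1 2 in blast)+
qed

lemma Ck_on_mult: "Ck_on k n U f \<Longrightarrow> Ck_on k n U h \<Longrightarrow> Ck_on k n U (\<lambda>x. f x * h x)"
proof (induction k arbitrary: f h)
  case 0
  then show ?case by (simp add: continuous_map_real_mult)
next
  case (Suc k)
  obtain g1 where 1: "cont_on n U f"
    "\<And>i x. i < n \<Longrightarrow> x \<in> U \<Longrightarrow> has_partial f i x (g1 i x)"
    "\<And>i. i < n \<Longrightarrow> Ck_on k n U (g1 i)" by (rule Ck_on_SucE[OF Suc(2)]) (rule that)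
  obtain g2 where 2: "cont_on n U h"
    "\<And>i x. i < n \<Longrightarrow> x \<in> U \<Longrightarrow> has_partial h i x (g2 i x)"
    "\<And>i. i < n \<Longrightarrow> Ck_on k n U (g2 i)" by (rule Ck_on_SucE[OF Suc(3)]) (rule that)
  show ?case
  proof (rule Ck_on_SucI[where g = "\<lambda>i x. g1 i x * h x + g2 i x * f x"])
    show "cont_on n U (\<lambda>x. f x * h x)"
      using 1(1) 2(1) by (rule continuous_map_real_mult)
    show "((\<lambda>t. f (x(i := t)) * h (x(i := t))) has_real_derivative g1 i x * h x + g2 i x * f x) (at (x i))"
      if "i < n" "x \<in> U" for i x
      using DERIV_mult[OF 1(2)[OF that] 2(2)[OF that]] by simp
    show "Ck_on k n U (\<lambda>x. g1 i x * h x + g2 i x * f x)" if "i < n" for i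
      using 1(3) 2(3) that Suc.IH Suc.prems[THEN Ck_on_Suc_imp] by (intro Ck_on_add) auto
  qed
qed

lemma Ck_on_sum:
  "(\<And>i. i < (m::nat) \<Longrightarrow> Ck_on k n U (f i)) \<Longrightarrow> Ck_on k n U (\<lambda>x. \<Sum>i<m. f i x)"
  by (induction m) (auto intro: Ck_on_add Ck_on_const)

lemma Ck_on_inverse:
  assumes "\<And>x. x \<in> U \<Longrightarrow> f x \<noteq> 0"
  shows "Ck_on k n U f \<Longrightarrow> Ck_on k n U (\<lambda>x. inverse (f x))"
proof (induction k)
  case 0
  have "cont_on n U (\<lambda>x. inverse (f x))"
    using 0 assms by (intro continuous_map_real_inverse) auto
  then show ?case by simp
next
  case (Suc k)
  obtain g where g: "cont_on n U f"
    "\<And>i x. i < n \<Longrightarrow> x \<in> U \<Longrightarrow> has_partial f i x (g i x)"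
    "\<And>i. i < n \<Longrightarrow> Ck_on k n U (g i)" by (rule Ck_on_SucE[OF Suc(2)]) (rule that)
  have inv: "Ck_on k n U (\<lambda>x. inverse (f x))" using Suc Ck_on_Suc_imp by blast
  show ?case
  \<comment> \<open>The derivative is written with products only, so that \<open>Ck_on_mult\<close>
    and the induction hypothesis for the inverse cover it.\<close>
  proof (rule Ck_on_SucI[where g = "\<lambda>i x. (-1) * ((inverse (f x) * g i x) * inverse (f x))"])
    show "cont_on n U (\<lambda>x. inverse (f x))"
      by (rule Ck_on_continuous[OF inv])
    show "((\<lambda>t. inverse (f (x(i := t)))) has_real_derivative (-1) * (inverse (f x) * g i x * inverse (f x))) (at (x i))"
      if "i < n" "x \<in> U" for i x
      using DERIV_inverse'[OF g(2)[OF that]] assms[OF that(2)] by simp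
    show "Ck_on k n U (\<lambda>x. (-1) * (inverse (f x) * g i x * inverse (f x)))" if "i < n" for i
      using g(3)[OF that] inv by (intro Ck_on_mult Ck_on_const)
  qed
qed

lemma euclidean_plots_continuous:
  assumes "s \<in> euclidean_plots n U m U'"
  shows "continuous_map (subtopology (Euclidean_space m) U') (subtopology (Euclidean_space n) U) s"
proof -
  have U: "U \<subseteq> Espace n" "s \<in> U' \<rightarrow> U"
    and s: "\<And>i. i < n \<Longrightarrow> smooth_on m U' (\<lambda>x. s x i)"
    using assms openin_subset by (auto simp: euclidean_plots_def)
  have "cont_on m U' (\<lambda>x. s x i)" for i
  proof (cases "i < n")
    case True
    then show ?thesis using s Ck_on_continuous unfolding smooth_on_def by blast
  next
    \<comment> \<open>Continuity into the product topology also concerns the coordinates from n on;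
      these vanish identically.\<close>
    case False
    then have "s x i = 0" if "x \<in> U'" for x
      using U that by (force simp: in_topspace_Euclidean)
    then have "\<And>x. x \<in> topspace (subtopology (Euclidean_space m) U') \<Longrightarrow> 0 = s x i" by simp
    moreover have "cont_on m U' (\<lambda>_. 0)" by simp
    ultimately show ?thesis by (rule continuous_map_eq[rotated])
  qed
  then have "continuous_map (subtopology (Euclidean_space m) U') (powertop_real UNIV) s"
    by (auto simp: continuous_map_componentwise_UNIV)
  then show ?thesis
    using U by (force simp: continuous_map_in_subtopology Euclidean_space_def in_topspace_Euclidean topspace_subtopology)
qed

text \<open>By the chain rule the partials of f o s are sums of products of (g i) o s and partials
  of s. The former are of class k by induction, the latter because s is smooth to every
  order.\<close>

lemma Ck_on_compose:
  assumes s: "s \<in> euclidean_plots n U m U'"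
  shows "Ck_on k n U f \<Longrightarrow> Ck_on k m U' (\<lambda>x. f (s x))"
proof (induction k arbitrary: f)
  case 0
  then show ?case
    using continuous_map_compose[OF euclidean_plots_continuous[OF s]] by (fastforce simp: o_def)
next
  case (Suc k)
  have U: "eopen n U" "eopen m U'" "s \<in> U' \<rightarrow> U"
    using s by (auto simp: euclidean_plots_def)
  obtain g where g: "cont_on n U f"
    "\<And>i x. i < n \<Longrightarrow> x \<in> U \<Longrightarrow> has_partial f i x (g i x)"
    "\<And>i. i < n \<Longrightarrow> Ck_on k n U (g i)" by (rule Ck_on_SucE[OF Suc(2)]) (rule that)
  have "\<exists>h. (\<forall>j<m. (\<forall>x\<in>U'. ((\<lambda>t. s (x(j := t)) i) has_real_derivative h j x) (at (x j)))
      \<and> Ck_on k m U' (h j))" if "i < n" for i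
  proof -
    have "Ck_on (Suc k) m U' (\<lambda>x. s x i)"
      using s that unfolding euclidean_plots_def smooth_on_def by blast
    then show ?thesis by (rule Ck_on_SucE) (metis)
  qed
  then obtain h where h: "\<And>i j x. i < n \<Longrightarrow> j < m \<Longrightarrow> x \<in> U' \<Longrightarrow>
      ((\<lambda>t. s (x(j := t)) i) has_real_derivative h i j x) (at (x j))"
    "\<And>i j. i < n \<Longrightarrow> j < m \<Longrightarrow> Ck_on k m U' (h i j)" by metis
  show ?case
  proof (rule Ck_on_SucI[where g = "\<lambda>j x. \<Sum>i<n. g i (s x) * h i j x"])
    show "cont_on m U' (\<lambda>x. f (s x))"
      using continuous_map_compose[OF euclidean_plots_continuous[OF s] g(1)] by (simp add: o_def)
    show "Ck_on k m U' (\<lambda>x. \<Sum>i<n. g i (s x) * h i j x)" if "j < m" for j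
      using g(3) h(2) that Suc.IH by (intro Ck_on_sum Ck_on_mult) auto
    fix j x assume j: "j < m" and x: "x \<in> U'"
    obtain e where e: "e > 0" "\<And>t. \<bar>t - x j\<bar> < e \<Longrightarrow> x(j := t) \<in> U'"
      using openin_update[OF U(2) x j] by blast
    have "eventually (\<lambda>t. s (x(j := t)) \<in> Espace n) (at (x j))"
      unfolding eventually_at
      by (rule exI[of _ e]) (use e U openin_subset[OF U(1)] in \<open>auto simp: dist_real_def Pi_iff\<close>)
    moreover have "s (x(j := x j)) \<in> U" using U(3) x by auto
    ultimately show "((\<lambda>t. f (s (x(j := t)))) has_real_derivative (\<Sum>i<n. g i (s x) * h i j x)) (at (x j))"
      using chain_rule_curve[OF U(1) g(2) Ck_on_continuous[OF g(3)] h(1)[OF _ j x]] by simp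
  qed
qed

lemma smooth_on_compose:
  "s \<in> euclidean_plots n U m U' \<Longrightarrow> smooth_on n U f \<Longrightarrow> smooth_on m U' (\<lambda>x. f (s x))"
  unfolding smooth_on_def using Ck_on_compose by blast

lemma smooth_on_subset: "smooth_on n U f \<Longrightarrow> T \<subseteq> U \<Longrightarrow> smooth_on n T f"
  unfolding smooth_on_def using Ck_on_subset by blast

lemma smooth_on_cong:
  "smooth_on n U f \<Longrightarrow> (\<And>x. x \<in> U \<Longrightarrow> h x = f x) \<Longrightarrow> eopen n U \<Longrightarrow> smooth_on n U h"
  unfolding smooth_on_def using Ck_on_cong by blast

lemma smooth_on_const: "smooth_on n U (\<lambda>_. c)"
  by (simp add: smooth_on_def Ck_on_const)

lemma smooth_on_add: "smooth_on n U f \<Longrightarrow> smooth_on n U h \<Longrightarrow> smooth_on n U (\<lambda>x. f x + h x)"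
  and smooth_on_mult: "smooth_on n U f \<Longrightarrow> smooth_on n U h \<Longrightarrow> smooth_on n U (\<lambda>x. f x * h x)"
  unfolding smooth_on_def by (auto intro: Ck_on_add Ck_on_mult)

section \<open>Locality of smoothness and the diffeology of an open set\<close>

lemma Ck_on_Union:
  assumes "\<And>U. U \<in> \<U> \<Longrightarrow> eopen n U \<and> Ck_on k n U f"
  shows "Ck_on k n (\<Union>\<U>) f"
  using assms
proof (induction k arbitrary: f)
  case 0
  have sub: "U \<subseteq> Espace n" if "U \<in> \<U>" for U
    using 0 that openin_subset by blast
  have "openin (subtopology (Euclidean_space n) (\<Union>\<U>)) {x \<in> topspace (subtopology (Euclidean_space n) (\<Union>\<U>)). f x \<in> W}"
    if W: "open W" for W
  proof -
    have "eopen n {x \<in> U. f x \<in> W}" if U: "U \<in> \<U>" for U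
    proof -
      have "openin (subtopology (Euclidean_space n) U) {x \<in> topspace (subtopology (Euclidean_space n) U). f x \<in> W}"
        by (rule openin_continuous_map_preimage[of _ euclideanreal]) (use 0[OF U] W in auto)
      then show ?thesis using 0[OF U] sub[OF U] openin_trans_full by (auto simp: inf.absorb2)
    qed
    then have "eopen n (\<Union>U\<in>\<U>. {x \<in> U. f x \<in> W})" by auto
    moreover have "(\<Union>U\<in>\<U>. {x \<in> U. f x \<in> W}) = {x \<in> topspace (subtopology (Euclidean_space n) (\<Union>\<U>)). f x \<in> W}"
      using sub by auto
    ultimately show ?thesis by (auto intro: openin_subset_topspace_eq simp: openin_subtopology_alt)
  qed
  then show ?case by (simp add: continuous_map_def)
next
  case (Suc k)
  \<comment> \<open>A single function has to serve as partial derivative on every member of the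
    cover. The local witnesses all coincide with \<open>deriv\<close> by uniqueness of
    derivatives.\<close>
  define g where "g i x = deriv (\<lambda>t. f (x(i := t))) (x i)" for i x
  have g: "(\<forall>x\<in>U. has_partial f i x (g i x)) \<and> Ck_on k n U (g i)"
    if i: "i < n" and U: "U \<in> \<U>" for i U
  proof -
    obtain h where h: "\<And>y. y \<in> U \<Longrightarrow> has_partial f i y (h y)"
      "Ck_on k n U h" using Suc.prems[OF U] i unfolding Ck_on.simps by blast
    have "g i y = h y" if "y \<in> U" for y
      unfolding g_def by (rule DERIV_imp_deriv[OF h(1)[OF that]])
    then show ?thesis using h Ck_on_cong[OF h(2)] Suc.prems[OF U] by simp
  qed
  have "Ck_on k n (\<Union>\<U>) f"
    using Suc.IH Suc.prems Ck_on_Suc_imp by blast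
  then have "cont_on n (\<Union>\<U>) f"
    by (rule Ck_on_continuous)
  then show ?case
    by (rule Ck_on_SucI[where g = g]) (use g Suc.IH Suc.prems in auto)
qed

text \<open>Stability under precomposition is the chain rule.\<close>

lemma diffeology_euclidean_plots:
  assumes U: "eopen n U"
  shows "diffeology U (euclidean_plots n U)"
  unfolding diffeology_def
proof (intro conjI allI ballI impI)
  fix m T p
  assume p: "p \<in> euclidean_plots n U m T"
  show "eopen m T" "p \<in> T \<rightarrow> U"
    using p by (auto simp: euclidean_plots_def)
  show "q \<in> euclidean_plots n U m T" if "\<forall>x\<in>T. q x = p x" for q
    using p that smooth_on_cong[of m T "\<lambda>x. p x i" "\<lambda>x. q x i" for i]
    by (auto simp: euclidean_plots_def)
  show "p \<circ> s \<in> euclidean_plots n U k T'" if s: "s \<in> euclidean_plots m T k T'" for k T' s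
    using p smooth_on_compose[OF s, of "\<lambda>x. p x i" for i] s by (auto simp: euclidean_plots_def Pi_iff)
next
  fix m T c assume "c \<in> U" "eopen m T"
  then show "(\<lambda>_. c) \<in> euclidean_plots n U m T"
    using U by (simp add: euclidean_plots_def smooth_on_const)
next
  fix m \<T> p assume *: "\<forall>T\<in>\<T>. eopen m T \<and> p \<in> euclidean_plots n U m T"
  then have "smooth_on m (\<Union>\<T>) (\<lambda>x. p x i)" if "i < n" for i
    using that Ck_on_Union[of \<T> m _ "\<lambda>x. p x i"] unfolding smooth_on_def euclidean_plots_def
    by blast
  then show "p \<in> euclidean_plots n U m (\<Union>\<T>)"
    using * U by (auto simp: euclidean_plots_def)
qed

section \<open>Restrictions and preimages of plots\<close>

lemma euclidean_plots_subset:
  assumes "s \<in> euclidean_plots n U m T" "eopen n U'" "s \<in> T' \<rightarrow> U'" "T' \<subseteq> T"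
    and "eopen m T'"
  shows "s \<in> euclidean_plots n U' m T'"
  using assms smooth_on_subset[OF _ assms(4)] by (auto simp: euclidean_plots_def)

lemma euclidean_plots_id:
  assumes "eopen n U" "eopen n T" "T \<subseteq> U"
  shows "(\<lambda>x. x) \<in> euclidean_plots n U n T"
  using assms smooth_on_coord[OF _ assms(2)] by (auto simp: euclidean_plots_def)

lemma diffeology_restrict:
  assumes "diffeology X D" "p \<in> D n U" "eopen n T" "T \<subseteq> U"
  shows "p \<in> D n T"
  using diffeology_comp[OF assms(1,2) euclidean_plots_id[OF diffeology_open[OF assms(1,2)] assms(3,4)]]
  by (simp add: o_def)

lemma openin_euclidean_plots_preimage:
  assumes s: "s \<in> euclidean_plots n U m T" and W: "eopen n W"
  shows "eopen m {x \<in> T. s x \<in> W}"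
proof -
  have T: "eopen m T" "s \<in> T \<rightarrow> U" using s by (auto simp: euclidean_plots_def)
  have "openin (subtopology (Euclidean_space n) U) (U \<inter> W)"
    using W by (simp add: openin_subtopology_Int2)
  from openin_continuous_map_preimage[OF euclidean_plots_continuous[OF s] this]
  have "openin (subtopology (Euclidean_space m) T) {x \<in> topspace (subtopology (Euclidean_space m) T). s x \<in> U \<inter> W}" .
  moreover have "{x \<in> topspace (subtopology (Euclidean_space m) T). s x \<in> U \<inter> W} = {x \<in> T. s x \<in> W}"
    using T openin_subset[OF T(1)] by auto
  ultimately show ?thesis using T(1) openin_trans_full by auto
qed

lemma real_plots_compose:
  "r \<in> real_plots n U \<Longrightarrow> s \<in> euclidean_plots n U m T \<Longrightarrow> (\<lambda>x. r (s x)) \<in> real_plots m T"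
  using smooth_on_compose by (auto simp: real_plots_def euclidean_plots_def)

section \<open>Smooth cutoff functions\<close>

text \<open>The functions q(1/t) e^(-1/t), extended by 0. Carrying the polynomial q along gives a
  family closed under differentiation, so that smoothness follows by induction over all q at
  once.\<close>

definition flat :: "real poly \<Rightarrow> real \<Rightarrow> real" where
  "flat q t = (if t > 0 then poly q (1 / t) * exp (- (1 / t)) else 0)"

lemma flat_tendsto_0: "(flat q \<longlongrightarrow> 0) (at_right 0)"
proof -
  have "((\<lambda>x. \<Sum>i\<le>degree q. coeff q i * (x ^ i / exp x)) \<longlongrightarrow> (\<Sum>i\<le>degree q. coeff q i * 0)) at_top"
    by (intro tendsto_intros tendsto_power_div_exp_0)
  moreover have "(\<Sum>i\<le>degree q. coeff q i * (x ^ i / exp x)) = poly q x * exp (- x)" for x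
    by (simp add: poly_altdef sum_distrib_right exp_minus divide_inverse mult.assoc)
  ultimately have "((\<lambda>x. poly q x * exp (- x)) \<longlongrightarrow> 0) at_top" by simp
  then have "((\<lambda>t. poly q (inverse t) * exp (- inverse t)) \<longlongrightarrow> 0) (at_right 0)"
    by (rule filterlim_compose[OF _ filterlim_inverse_at_top_right])
  moreover have "\<forall>\<^sub>F t in at_right 0. poly q (inverse t) * exp (- inverse t) = flat q t"
    by (auto simp: eventually_at_filter flat_def inverse_eq_divide)
  ultimately show ?thesis using tendsto_cong by fast
qed

text \<open>With s = 1/t one has d/dt = -s^2 d/ds, and q(s) e^(-s) has s-derivative (q' - q)(s)
  e^(-s). At 0 the right difference quotient is again a member of the family, with polynomial s
  q(s), and tends to 0.\<close>

lemma DERIV_flat: "(flat q has_real_derivative flat ([:0, 0, 1:] * (q - pderiv q)) t) (at t)"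
proof (cases t "0 :: real" rule: linorder_cases)
  case less
  have "(flat q has_real_derivative 0) (at t)"
    by (rule has_field_derivative_transform_within_open[OF DERIV_const[of 0] open_lessThan[of 0]])
      (use less in \<open>auto simp: flat_def\<close>)
  then show ?thesis using less by (simp add: flat_def)
next
  case equal
  have "((\<lambda>h. flat q h / h) \<longlongrightarrow> 0) (at 0)"
  proof (subst at_eq_sup_left_right, rule filterlim_sup)
    have "\<forall>\<^sub>F h in at_left 0. 0 = flat q h / h"
      by (auto simp: eventually_at_filter flat_def)
    then show "((\<lambda>h. flat q h / h) \<longlongrightarrow> 0) (at_left 0)"
      by (rule Lim_transform_eventually[OF tendsto_const])
    have "\<forall>\<^sub>F h in at_right 0. flat ([:0, 1:] * q) h = flat q h / h"
      by (auto simp: eventually_at_filter flat_def)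
    then show "((\<lambda>h. flat q h / h) \<longlongrightarrow> 0) (at_right 0)"
      by (rule Lim_transform_eventually[OF flat_tendsto_0])
  qed
  then have "(flat q has_real_derivative 0) (at t)"
    using equal by (simp add: DERIV_def flat_def[of q 0])
  then show ?thesis using equal by (simp add: flat_def)
next
  case greater
  have "((\<lambda>t. poly q (1 / t) * exp (- (1 / t))) has_real_derivative
      flat ([:0, 0, 1:] * (q - pderiv q)) t) (at t)"
    using greater
    by (auto intro!: derivative_eq_intros DERIV_chain'[OF _ poly_DERIV]
        simp: flat_def field_simps power2_eq_square)
  then show ?thesis
    by (rule has_field_derivative_transform_within_open[OF _ open_greaterThan[of 0]])
      (use greater in \<open>auto simp: flat_def\<close>)
qed

lemma smooth_on_flat:
  assumes \<phi>: "smooth_on n U \<phi>" and U: "eopen n U"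
  shows "smooth_on n U (\<lambda>x. flat q (\<phi> x))"
proof -
  have \<phi>': "Ck_on k n U \<phi>" for k using \<phi> by (simp add: smooth_on_def)
  have cont: "cont_on n U (\<lambda>x. flat q (\<phi> x))" for q
  proof -
    have "continuous_on UNIV (flat q)"
      using DERIV_flat DERIV_isCont by (blast intro: continuous_at_imp_continuous_on)
    then have "continuous_map euclideanreal euclideanreal (flat q)" by simp
    from continuous_map_compose[OF Ck_on_continuous[OF \<phi>'[of 0]] this] show ?thesis by (simp add: o_def)
  qed
  have "Ck_on k n U (\<lambda>x. flat q (\<phi> x))" for k
  proof (induction k arbitrary: q)
    case 0
    then show ?case using cont by simp
  next
    case (Suc k)
    obtain g where g: "continuous_map (subtopology (Euclidean_space n) U) euclideanreal \<phi>"
      "\<And>i x. i < n \<Longrightarrow> x \<in> U \<Longrightarrow> ((\<lambda>t. \<phi> (x(i := t))) has_real_derivative g i x) (at (x i))"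
      "\<And>i. i < n \<Longrightarrow> Ck_on k n U (g i)"
      by (rule Ck_on_SucE[OF \<phi>'[of "Suc k"]]) (rule that)
    show ?case
    proof (rule Ck_on_SucI[OF cont, where g = "\<lambda>i x. flat ([:0, 0, 1:] * (q - pderiv q)) (\<phi> x) * g i x"])
      fix i x assume i: "i < n" and x: "x \<in> U"
      show "((\<lambda>t. flat q (\<phi> (x(i := t)))) has_real_derivative
          flat ([:0, 0, 1:] * (q - pderiv q)) (\<phi> x) * g i x) (at (x i))"
        using DERIV_chain2[OF DERIV_flat g(2)[OF i x]] by simp
    qed (intro Ck_on_mult Suc.IH g(3))
  qed
  then show ?thesis by (simp add: smooth_on_def)
qed

text \<open>The standard smooth step rising from 0 at -1 to 1 at 1, built from e^(-1/t) (the
  polynomial 1). The denominator never vanishes since 1 + t and 1 - t are not both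
  nonpositive.\<close>

definition cutoff :: "real \<Rightarrow> real" where
  "cutoff t = flat 1 (1 + t) * inverse (flat 1 (1 + t) + flat 1 (1 + (-1) * t))"

lemma cutoff_cases:
  "t \<le> -1 \<Longrightarrow> cutoff t = 0" "t \<ge> 1 \<Longrightarrow> cutoff t = 1"
  by (auto simp: cutoff_def flat_def)

lemma smooth_on_cutoff:
  assumes \<phi>: "smooth_on n U \<phi>" and U: "eopen n U"
  shows "smooth_on n U (\<lambda>x. cutoff (\<phi> x))"
proof -
  have 1: "smooth_on n U (\<lambda>x. flat 1 (1 + \<phi> x))" "smooth_on n U (\<lambda>x. flat 1 (1 + (-1) * \<phi> x))"
    by (intro smooth_on_flat smooth_on_add smooth_on_mult smooth_on_const \<phi> U)+
  have "flat 1 (1 + t) + flat 1 (1 + (-1) * t) \<noteq> 0" for t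
  proof -
    have "1 + t > 0 \<or> 1 + (-1) * t > 0" by linarith
    moreover have "flat 1 s \<ge> 0" "s > 0 \<Longrightarrow> flat 1 s > 0" for s by (auto simp: flat_def)
    ultimately show ?thesis by (smt (verit))
  qed
  then have "smooth_on n U (\<lambda>x. inverse (flat 1 (1 + \<phi> x) + flat 1 (1 + (-1) * \<phi> x)))"
    using smooth_on_add[OF 1] unfolding smooth_on_def by (auto intro: Ck_on_inverse)
  then show ?thesis unfolding cutoff_def by (intro smooth_on_mult 1)
qed

section \<open>Lifting plots over compact boxes\<close>

text \<open>Compactness enters through one-dimensional bisection, applied to one coordinate at a time.\<close>

lemma box_bisection:
  fixes a b :: "nat \<Rightarrow> real"
  assumes ab: "\<And>i. i < n \<Longrightarrow> a i \<le> b i"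
    and join: "\<And>\<alpha> \<beta> j c. j < n \<Longrightarrow> (\<forall>i<n. a i \<le> \<alpha> i \<and> \<alpha> i \<le> \<beta> i \<and> \<beta> i \<le> b i) \<Longrightarrow>
      \<alpha> j \<le> c \<Longrightarrow> c \<le> \<beta> j \<Longrightarrow> P \<alpha> (\<beta>(j := c)) \<Longrightarrow> P (\<alpha>(j := c)) \<beta> \<Longrightarrow> P \<alpha> \<beta>"
    and local: "\<And>x. (\<forall>i<n. a i \<le> x i \<and> x i \<le> b i) \<Longrightarrow> \<exists>e>0. \<forall>\<alpha> \<beta>.
      (\<forall>i<n. a i \<le> \<alpha> i \<and> \<alpha> i \<le> \<beta> i \<and> \<beta> i \<le> b i \<and> x i - e < \<alpha> i \<and> \<beta> i < x i + e) \<longrightarrow> P \<alpha> \<beta>"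
  shows "P a b"
proof -
  \<comment> \<open>Induction on j: the sides in directions below j are arbitrary within [a, b],
    those from j on must be close to x. The case j = 0 is \<open>local\<close>, and j = n leaves no
    condition of closeness.\<close>
  let ?near = "\<lambda>j x e \<alpha> \<beta>. (\<forall>i<n. a i \<le> \<alpha> i \<and> \<alpha> i \<le> \<beta> i \<and> \<beta> i \<le> b i) \<and>
    (\<forall>i<n. j \<le> i \<longrightarrow> x i - e < \<alpha> i \<and> \<beta> i < x i + e)"
  have "j \<le> n \<Longrightarrow> (\<forall>i<n. a i \<le> x i \<and> x i \<le> b i) \<Longrightarrow> \<exists>e>0. \<forall>\<alpha> \<beta>. ?near j x e \<alpha> \<beta> \<longrightarrow> P \<alpha> \<beta>" for j x
  proof (induction j arbitrary: x)
    case 0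
    then show ?case using local[of x] by (metis (no_types, lifting) zero_le)
  next
    case (Suc j)
    then have j: "j < n" by simp
    \<comment> \<open>The side in direction j is only required to lie in [s, t];
      \<open>Bolzano\<close> extends this from short intervals to [a j, b j]. The radius e for the
      later directions may depend on s and t.\<close>
    define Q where "Q s t \<longleftrightarrow> (\<exists>e>0. \<forall>\<alpha> \<beta>. ?near (Suc j) x e \<alpha> \<beta> \<and> s \<le> \<alpha> j \<and> \<beta> j \<le> t \<longrightarrow> P \<alpha> \<beta>)" for s t
    have "Q (a j) (b j)"
    proof (rule Bolzano[OF ab[OF j], of Q])
      fix s t u assume "Q s t" "Q t u" "s \<le> t" "t \<le> u"
      from \<open>Q s t\<close> obtain e1 where e1: "e1 > 0"
        "\<forall>\<alpha> \<beta>. ?near (Suc j) x e1 \<alpha> \<beta> \<and> s \<le> \<alpha> j \<and> \<beta> j \<le> t \<longrightarrow> P \<alpha> \<beta>"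
        unfolding Q_def by (elim exE conjE) (rule that)
      from \<open>Q t u\<close> obtain e2 where e2: "e2 > 0"
        "\<forall>\<alpha> \<beta>. ?near (Suc j) x e2 \<alpha> \<beta> \<and> t \<le> \<alpha> j \<and> \<beta> j \<le> u \<longrightarrow> P \<alpha> \<beta>"
        unfolding Q_def by (elim exE conjE) (rule that)
      note P1 = e1(2)[rule_format, OF conjI, OF _ conjI] and P2 = e2(2)[rule_format, OF conjI, OF _ conjI]
      have "P \<alpha> \<beta>" if near: "?near (Suc j) x (min e1 e2) \<alpha> \<beta>" and su: "s \<le> \<alpha> j" "\<beta> j \<le> u" for \<alpha> \<beta>
      proof -
        have n1: "?near (Suc j) x e \<alpha> \<beta>" if e: "e = e1 \<or> e = e2" for e
        proof -
          have "x i - e < \<alpha> i \<and> \<beta> i < x i + e" if "i < n" "Suc j \<le> i" for i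
          proof -
            have "x i - min e1 e2 < \<alpha> i" "\<beta> i < x i + min e1 e2" using near that by blast+
            then show ?thesis using e by auto
          qed
          then have "\<forall>i<n. Suc j \<le> i \<longrightarrow> x i - e < \<alpha> i \<and> \<beta> i < x i + e" by blast
          then show ?thesis by (rule conjI[OF near[THEN conjunct1]])
        qed
        consider "\<beta> j \<le> t" | "t \<le> \<alpha> j" | "\<alpha> j \<le> t" "t \<le> \<beta> j" by linarith
        then show ?thesis
        proof cases
          case 1
          show ?thesis by (rule P1[OF n1 su(1) 1]) simp
        next
          case 2
          show ?thesis by (rule P2[OF n1 2 su(2)]) simp
        next
          case 3
          \<comment> \<open>The box straddles t. Cutting it at t in direction j gives one half for
            each of the two intervals, and \<open>join\<close> reassembles them.\<close>
          have "?near (Suc j) x e1 \<alpha> (\<beta>(j := t))" "?near (Suc j) x e2 (\<alpha>(j := t)) \<beta>"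
            using n1[of e1] n1[of e2] 3 j by (auto intro: order_trans)
          then have "P \<alpha> (\<beta>(j := t))" "P (\<alpha>(j := t)) \<beta>" using su P1[of \<alpha> "\<beta>(j := t)"] P2[of "\<alpha>(j := t)" \<beta>] by simp_all
          then show ?thesis by (intro join[of j \<alpha> \<beta> t] j 3) (use near in blast)+
        qed
      qed
      then show "Q s u" unfolding Q_def using e1(1) e2(1) by (intro exI[of _ "min e1 e2"]) auto
    next
      fix t assume t: "a j \<le> t" "t \<le> b j"
      have "\<forall>i<n. a i \<le> (x(j := t)) i \<and> (x(j := t)) i \<le> b i" using Suc.prems t by simp
      then obtain e where e: "e > 0" "\<And>\<alpha> \<beta>. ?near j (x(j := t)) e \<alpha> \<beta> \<Longrightarrow> P \<alpha> \<beta>"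
        using Suc.IH[of "x(j := t)"] j by (metis (no_types, lifting) less_imp_le)
      have "Q s u" if su: "s \<le> t" "t \<le> u" "u - s < e" for s u
        unfolding Q_def
      proof (intro exI conjI allI impI)
        fix \<alpha> \<beta> assume *: "?near (Suc j) x e \<alpha> \<beta> \<and> s \<le> \<alpha> j \<and> \<beta> j \<le> u"
        have "(x(j := t)) i - e < \<alpha> i \<and> \<beta> i < (x(j := t)) i + e" if "i < n" "j \<le> i" for i
        proof (cases "i = j")
          case True
          then show ?thesis using * su by auto
        next
          case False
          then show ?thesis using * that by (simp add: Suc_le_eq)
        qed
        then show "P \<alpha> \<beta>" using * e(2) by blast
      qed (rule e(1))
      then show "\<exists>d>0. \<forall>s u. s \<le> t \<and> t \<le> u \<and> u - s < d \<longrightarrow> Q s u" using e(1) by blast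
    qed
    then obtain e where "e > 0" "\<And>\<alpha> \<beta>. ?near (Suc j) x e \<alpha> \<beta> \<Longrightarrow> a j \<le> \<alpha> j \<Longrightarrow> \<beta> j \<le> b j \<Longrightarrow> P \<alpha> \<beta>"
      unfolding Q_def by blast
    then show ?case using j by blast
  qed
  \<comment> \<open>No direction is close to x any more, so the point a is an arbitrary
    choice.\<close>
  from this[of n a] obtain e where "\<And>\<alpha> \<beta>. ?near n a e \<alpha> \<beta> \<Longrightarrow> P \<alpha> \<beta>"
    using ab by blast
  then show ?thesis using ab by (simp add: not_le[symmetric])
qed

section \<open>Diffeological vector spaces as modules over the reals\<close>

locale dvspace =
  fixes V :: "'a dvs"
  assumes dvs: "dvs V"
begin

sublocale module real_field V
  rewrites "carrier real_field = UNIV" and "mult real_field = (*)" and "one real_field = 1"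
    and "zero real_field = 0" and "add real_field = (+)"
  using dvs_module[OF dvs] by simp_all

lemmas diffeo = dvs_diffeology[OF dvs]
  and add_plot = dvs_add_plot[OF dvs]
  and smult_plot = dvs_smult_plot[OF dvs]

lemma plot_closed: "p \<in> plots V n U \<Longrightarrow> x \<in> U \<Longrightarrow> p x \<in> carrier V"
  using diffeology_into[OF diffeo] by blast

lemma add_convex: "r + s = 1 \<Longrightarrow> x \<in> carrier V \<Longrightarrow> r \<odot>\<^bsub>V\<^esub> x \<oplus>\<^bsub>V\<^esub> s \<odot>\<^bsub>V\<^esub> x = x"
  using smult_l_distr[of r s x] by simp

end

text \<open>Bisection leaves two adjacent boxes cut at x j = c with lifts p1 and p2. On the overlap
  (1 - \<phi>) p1 + \<phi> p2 is again a lift: f is linear, both lifts have value q x, and the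
  weights add up to 1 (\<open>add_convex\<close>).\<close>

theorem box_lift:
  assumes hom: "DVect_hom W2 W3 f" and sub: "subduction W2 W3 f" and q: "q \<in> plots W3 n U"
    and ab: "\<And>i. i < n \<Longrightarrow> a i \<le> b i"
    and box: "{x \<in> Espace n. \<forall>i<n. a i \<le> x i \<and> x i \<le> b i} \<subseteq> U"
  shows "\<exists>\<delta>>0. \<exists>p\<in>plots W2 n (obox n (\<lambda>i. a i - \<delta>) (\<lambda>i. b i + \<delta>)).
    \<forall>x\<in>obox n (\<lambda>i. a i - \<delta>) (\<lambda>i. b i + \<delta>). f (p x) = q x"
proof -
  interpret W2: dvspace W2 using DVect_homD(1)[OF hom] by unfold_locales
  interpret W3: dvspace W3 using DVect_homD(2)[OF hom] by unfold_locales
  define B where "B \<alpha> \<beta> \<delta> = obox n (\<lambda>i. \<alpha> i - \<delta>) (\<lambda>i. \<beta> i + \<delta>)" for \<alpha> \<beta> \<delta>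
  \<comment> \<open>The lift is demanded on an open \<delta>-neighbourhood of the closed box;
    otherwise adjacent boxes would not overlap and nothing could be glued.\<close>
  define P where "P \<alpha> \<beta> \<longleftrightarrow> (\<exists>\<delta>>0. \<exists>p\<in>plots W2 n (B \<alpha> \<beta> \<delta>). \<forall>x\<in>B \<alpha> \<beta> \<delta>. f (p x) = q x)" for \<alpha> \<beta>
  have "P a b"
  proof (rule box_bisection[of n a b P, OF ab])
    fix x :: "nat \<Rightarrow> real"
    assume x: "\<forall>i<n. a i \<le> x i \<and> x i \<le> b i"
    \<comment> \<open>The bisection argument leaves coordinates from n on unconstrained; setting
      them to 0 gives a point of \<open>Espace n\<close>.\<close>
    define x0 where "x0 = (\<lambda>i. if i < n then x i else 0)"
    have "x0 \<in> U" using x box by (force simp: x0_def in_topspace_Euclidean)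
    moreover have "locally_lifts (plots W2) f n U q" using sub q by (auto simp: subduction_map_def)
    ultimately obtain U' p where U': "eopen n U'" "x0 \<in> U'" "p \<in> plots W2 n U'"
      "\<forall>y\<in>U'. f (p y) = q y"
      unfolding locally_lifts_def by blast
    obtain e where e: "e > 0" "cube n x0 e \<subseteq> U'" using openin_cube_subset[OF U'(1,2)] .
    \<comment> \<open>Endpoints within e / 2 of x, enlarged by \<delta> = e / 2, still lie in the
      cube of radius e.\<close>
    have *: "P \<alpha> \<beta>"
      if *: "\<forall>i<n. a i \<le> \<alpha> i \<and> \<alpha> i \<le> \<beta> i \<and> \<beta> i \<le> b i \<and> x i - e / 2 < \<alpha> i \<and> \<beta> i < x i + e / 2" for \<alpha> \<beta>
    proof -
      have "B \<alpha> \<beta> (e / 2) \<subseteq> cube n x0 e"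
      proof
        fix y assume y: "y \<in> B \<alpha> \<beta> (e / 2)"
        have "\<bar>y i - x0 i\<bar> < e" if "i < n" for i
        proof -
          have "x i - e / 2 < \<alpha> i" "\<beta> i < x i + e / 2" "\<alpha> i - e / 2 < y i" "y i < \<beta> i + e / 2"
            using * y that by (auto simp: B_def obox_def)
          then show ?thesis using that by (simp add: x0_def)
        qed
        then show "y \<in> cube n x0 e" using y unfolding cube_iff unfolding B_def obox_def by blast
      qed
      then have s: "B \<alpha> \<beta> (e / 2) \<subseteq> U'" using e by blast
      have "p \<in> plots W2 n (B \<alpha> \<beta> (e / 2))"
        using diffeology_restrict[OF W2.diffeo U'(3) _ s] by (simp add: B_def openin_obox)
      then show ?thesis unfolding P_def using s e(1) U'(4) by (intro exI[of _ "e / 2"]) auto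
    qed
    then show "\<exists>e>0. \<forall>\<alpha> \<beta>. (\<forall>i<n. a i \<le> \<alpha> i \<and> \<alpha> i \<le> \<beta> i \<and> \<beta> i \<le> b i \<and> x i - e < \<alpha> i \<and> \<beta> i < x i + e) \<longrightarrow> P \<alpha> \<beta>"
      using e(1) by (intro exI[of _ "e / 2"] conjI allI impI *) simp_all
  next
    fix \<alpha> \<beta> :: "nat \<Rightarrow> real" and j c
    assume j: "j < n" and c: "\<alpha> j \<le> c" "c \<le> \<beta> j"
      and P1: "P \<alpha> (\<beta>(j := c))" and P2: "P (\<alpha>(j := c)) \<beta>"
    obtain \<delta>1 p1 where 1: "\<delta>1 > 0" "p1 \<in> plots W2 n (B \<alpha> (\<beta>(j := c)) \<delta>1)"
      "\<forall>x\<in>B \<alpha> (\<beta>(j := c)) \<delta>1. f (p1 x) = q x" using P1 unfolding P_def by blast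
    obtain \<delta>2 p2 where 2: "\<delta>2 > 0" "p2 \<in> plots W2 n (B (\<alpha>(j := c)) \<beta> \<delta>2)"
      "\<forall>x\<in>B (\<alpha>(j := c)) \<beta> \<delta>2. f (p2 x) = q x" using P2 unfolding P_def by blast
    define \<delta> where "\<delta> = min \<delta>1 \<delta>2"
    have \<delta>: "\<delta> > 0" "\<delta> \<le> \<delta>1" "\<delta> \<le> \<delta>2" using 1 2 by (auto simp: \<delta>_def)
    define T where "T = B \<alpha> \<beta> \<delta>"
    \<comment> \<open>Three open pieces: left, right and middle. The middle one reaches to distance
      \<delta> from the cut while the outer ones start at \<delta> / 2, which leaves overlaps on
      which the cutoff is constant.\<close>
    define O1 where "O1 = obox n (\<lambda>i. \<alpha> i - \<delta>) ((\<lambda>i. \<beta> i + \<delta>)(j := c - \<delta> / 2))"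
    define O2 where "O2 = obox n ((\<lambda>i. \<alpha> i - \<delta>)(j := c + \<delta> / 2)) (\<lambda>i. \<beta> i + \<delta>)"
    define O3 where "O3 = obox n ((\<lambda>i. \<alpha> i - \<delta>)(j := c - \<delta>)) ((\<lambda>i. \<beta> i + \<delta>)(j := c + \<delta>))"
    have O1: "x \<in> O1 \<longleftrightarrow> x \<in> T \<and> x j < c - \<delta> / 2" for x
    proof -
      have "i < n \<Longrightarrow> x j < c - \<delta> / 2 \<Longrightarrow> x j < \<beta> j + \<delta>" for i using c \<delta> by linarith
      then show ?thesis using j unfolding O1_def T_def B_def obox_def by auto
    qed
    have O2: "x \<in> O2 \<longleftrightarrow> x \<in> T \<and> c + \<delta> / 2 < x j" for x
    proof -
      have "i < n \<Longrightarrow> c + \<delta> / 2 < x j \<Longrightarrow> \<alpha> j - \<delta> < x j" for i using c \<delta> by linarith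
      then show ?thesis using j unfolding O2_def T_def B_def obox_def by auto
    qed
    have O3: "x \<in> O3 \<longleftrightarrow> x \<in> T \<and> c - \<delta> < x j \<and> x j < c + \<delta>" for x
    proof -
      have "c - \<delta> < x j \<Longrightarrow> \<alpha> j - \<delta> < x j" "x j < c + \<delta> \<Longrightarrow> x j < \<beta> j + \<delta>" using c \<delta> by linarith+
      then show ?thesis using j unfolding O3_def T_def B_def obox_def by auto
    qed
    have open_O: "eopen n O1" "eopen n O2" "eopen n O3"
      unfolding O1_def O2_def O3_def by (rule openin_obox)+
    have T_Un: "T = \<Union>{O1, O2, O3}"
    proof -
      have "x j < c - \<delta> / 2 \<or> c + \<delta> / 2 < x j \<or> c - \<delta> < x j \<and> x j < c + \<delta>" for x :: "nat \<Rightarrow> real"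
        using \<delta> by linarith
      then show ?thesis using O1 O2 O3 by auto
    qed
    have lower: "x \<in> B \<alpha> (\<beta>(j := c)) \<delta>1" if "x \<in> T" "x j < c + \<delta>" for x
      unfolding B_def obox_def
    proof (intro CollectI conjI allI impI)
      show "x \<in> Espace n" using that by (simp add: T_def B_def obox_def)
      fix i assume "i < n"
      then have "\<alpha> i - \<delta> < x i \<and> x i < \<beta> i + \<delta>" using that by (simp add: T_def B_def obox_def)
      then show "\<alpha> i - \<delta>1 < x i" "x i < (\<beta>(j := c)) i + \<delta>1" using that \<delta> by auto
    qed
    have upper: "x \<in> B (\<alpha>(j := c)) \<beta> \<delta>2" if "x \<in> T" "c - \<delta> < x j" for x
      unfolding B_def obox_def
    proof (intro CollectI conjI allI impI)
      show "x \<in> Espace n" using that by (simp add: T_def B_def obox_def)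
      fix i assume "i < n"
      then have "\<alpha> i - \<delta> < x i \<and> x i < \<beta> i + \<delta>" using that by (simp add: T_def B_def obox_def)
      then show "(\<alpha>(j := c)) i - \<delta>2 < x i" "x i < \<beta> i + \<delta>2" using that \<delta> by auto
    qed
    have subs: "O1 \<subseteq> B \<alpha> (\<beta>(j := c)) \<delta>1" "O3 \<subseteq> B \<alpha> (\<beta>(j := c)) \<delta>1"
      "O2 \<subseteq> B (\<alpha>(j := c)) \<beta> \<delta>2" "O3 \<subseteq> B (\<alpha>(j := c)) \<beta> \<delta>2"
      using lower upper O1 O2 O3 \<delta>(1) by force+
    have p1: "p1 \<in> plots W2 n O1" "p1 \<in> plots W2 n O3"
      and p2: "p2 \<in> plots W2 n O2" "p2 \<in> plots W2 n O3"
      by (rule diffeology_restrict[OF W2.diffeo 1(2)] diffeology_restrict[OF W2.diffeo 2(2)];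
          rule open_O subs)+
    \<comment> \<open>The factor 2 / \<delta> moves the transition of \<open>cutoff\<close> from
      [-1, 1] to [c - \<delta> / 2, c + \<delta> / 2].\<close>
    define \<phi> where "\<phi> x = cutoff ((2 / \<delta>) * (x j + (- c)))" for x :: "nat \<Rightarrow> real"
    have \<phi>0: "\<phi> x = 0" if "x j \<le> c - \<delta> / 2" for x
      unfolding \<phi>_def using that \<delta>(1) by (intro cutoff_cases) (simp add: field_simps)
    have \<phi>1: "\<phi> x = 1" if "x j \<ge> c + \<delta> / 2" for x
      unfolding \<phi>_def using that \<delta>(1) by (intro cutoff_cases) (simp add: field_simps)
    have sm: "smooth_on n O3 \<phi>" "smooth_on n O3 (\<lambda>x. 1 + (-1) * \<phi> x)"
      unfolding \<phi>_def
      by (intro smooth_on_cutoff smooth_on_add smooth_on_mult smooth_on_const smooth_on_coord open_O j)+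
    define p where "p x = (if x j < c - \<delta> / 2 then p1 x else if x j > c + \<delta> / 2 then p2 x
      else (1 + (-1) * \<phi> x) \<odot>\<^bsub>W2\<^esub> p1 x \<oplus>\<^bsub>W2\<^esub> \<phi> x \<odot>\<^bsub>W2\<^esub> p2 x)" for x
    have pO1: "p x = p1 x" if "x \<in> O1" for x using that by (simp add: O1 p_def)
    have pO2: "p x = p2 x" if "x \<in> O2" for x using that \<delta>(1) by (simp add: O2 p_def)
    \<comment> \<open>In the outer parts of O3 the cutoff is 0 or 1, so the combination reduces to
      p1 or p2 and matches the case distinction.\<close>
    have pO3: "p x = (1 + (-1) * \<phi> x) \<odot>\<^bsub>W2\<^esub> p1 x \<oplus>\<^bsub>W2\<^esub> \<phi> x \<odot>\<^bsub>W2\<^esub> p2 x" if "x \<in> O3" for x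
      using that \<phi>0[of x] \<phi>1[of x] W2.plot_closed[OF p1(2) that] W2.plot_closed[OF p2(2) that]
      by (auto simp: p_def)
    have "p \<in> plots W2 n O1" "p \<in> plots W2 n O2"
      by (rule diffeology_cong[OF W2.diffeo p1(1) pO1] diffeology_cong[OF W2.diffeo p2(1) pO2]; assumption)+
    moreover have "p \<in> plots W2 n O3"
      by (rule diffeology_cong[OF W2.diffeo W2.add_plot[OF W2.smult_plot[OF _ p1(2)] W2.smult_plot[OF _ p2(2)]] pO3])
        (use sm open_O in \<open>simp_all add: real_plots_def\<close>)
    ultimately have "p \<in> plots W2 n T"
      unfolding T_Un by (intro diffeology_glue[OF W2.diffeo]) (use open_O in auto)
    moreover have "f (p x) = q x" if "x \<in> T" for x
    proof -
      consider "x \<in> O1" | "x \<in> O2" | "x \<in> O3" using \<open>x \<in> T\<close> unfolding T_Un by auto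
      then show ?thesis
      proof cases
        case 3
        note cl = W2.plot_closed[OF p1(2) 3] W2.plot_closed[OF p2(2) 3]
        have "f (p1 x) = q x" "f (p2 x) = q x" using 1(3) 2(3) subs 3 by auto
        moreover have "q x \<in> carrier W3" using calculation(1) funcset_mem[OF DVect_homD(3)[OF hom] cl(1)] by simp
        ultimately show ?thesis
          unfolding pO3[OF 3] using cl
          by (simp add: DVect_homD(4,5)[OF hom] W3.add_convex)
      qed (use 1(3) 2(3) subs pO1 pO2 in auto)
    qed
    ultimately show "P \<alpha> \<beta>" unfolding P_def T_def using \<delta>(1) by blast
  qed
  then show ?thesis by (simp add: P_def B_def)
qed

section \<open>Constructions of diffeological vector spaces\<close>

text \<open>Additive inverses are produced by the scalar -1: \<open>distr\<close> together with
  \<open>smult0\<close> and \<open>smult1\<close> gives (-1) x + x = 0.\<close>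

lemma dvsI:
  fixes V :: "'a dvs"
  assumes zero: "\<zero>\<^bsub>V\<^esub> \<in> carrier V"
    and add: "\<And>x y. x \<in> carrier V \<Longrightarrow> y \<in> carrier V \<Longrightarrow> x \<oplus>\<^bsub>V\<^esub> y \<in> carrier V"
    and smult: "\<And>r x. x \<in> carrier V \<Longrightarrow> r \<odot>\<^bsub>V\<^esub> x \<in> carrier V"
    and assoc: "\<And>x y z. x \<in> carrier V \<Longrightarrow> y \<in> carrier V \<Longrightarrow> z \<in> carrier V \<Longrightarrow>
      x \<oplus>\<^bsub>V\<^esub> y \<oplus>\<^bsub>V\<^esub> z = x \<oplus>\<^bsub>V\<^esub> (y \<oplus>\<^bsub>V\<^esub> z)"
    and comm: "\<And>x y. x \<in> carrier V \<Longrightarrow> y \<in> carrier V \<Longrightarrow> x \<oplus>\<^bsub>V\<^esub> y = y \<oplus>\<^bsub>V\<^esub> x"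
    and l_zero: "\<And>x. x \<in> carrier V \<Longrightarrow> \<zero>\<^bsub>V\<^esub> \<oplus>\<^bsub>V\<^esub> x = x"
    and smult0: "\<And>x. x \<in> carrier V \<Longrightarrow> 0 \<odot>\<^bsub>V\<^esub> x = \<zero>\<^bsub>V\<^esub>"
    and smult1: "\<And>x. x \<in> carrier V \<Longrightarrow> 1 \<odot>\<^bsub>V\<^esub> x = x"
    and distr: "\<And>r s x. x \<in> carrier V \<Longrightarrow> (r + s) \<odot>\<^bsub>V\<^esub> x = r \<odot>\<^bsub>V\<^esub> x \<oplus>\<^bsub>V\<^esub> s \<odot>\<^bsub>V\<^esub> x"
      "\<And>r x y. x \<in> carrier V \<Longrightarrow> y \<in> carrier V \<Longrightarrow> r \<odot>\<^bsub>V\<^esub> (x \<oplus>\<^bsub>V\<^esub> y) = r \<odot>\<^bsub>V\<^esub> x \<oplus>\<^bsub>V\<^esub> r \<odot>\<^bsub>V\<^esub> y"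
    and smult_assoc: "\<And>r s x. x \<in> carrier V \<Longrightarrow> (r * s) \<odot>\<^bsub>V\<^esub> x = r \<odot>\<^bsub>V\<^esub> (s \<odot>\<^bsub>V\<^esub> x)"
    and D: "diffeology (carrier V) (plots V)"
    and addp: "\<And>n U p q. p \<in> plots V n U \<Longrightarrow> q \<in> plots V n U \<Longrightarrow> (\<lambda>x. p x \<oplus>\<^bsub>V\<^esub> q x) \<in> plots V n U"
    and smultp: "\<And>n U r q. r \<in> real_plots n U \<Longrightarrow> q \<in> plots V n U \<Longrightarrow> (\<lambda>x. r x \<odot>\<^bsub>V\<^esub> q x) \<in> plots V n U"
  shows "dvs V"
proof -
  have "module real_field V"
  proof (rule moduleI[OF cring_real_field])
    show "abelian_group V"
    proof (rule abelian_groupI)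
      fix x assume x: "x \<in> carrier V"
      have "(-1) \<odot>\<^bsub>V\<^esub> x \<oplus>\<^bsub>V\<^esub> x = \<zero>\<^bsub>V\<^esub>"
        using distr(1)[of x "-1" 1] x by (simp add: smult0 smult1)
      then show "\<exists>y\<in>carrier V. y \<oplus>\<^bsub>V\<^esub> x = \<zero>\<^bsub>V\<^esub>" using smult[OF x] by blast
    qed (use assms in auto)
  qed (use assms in auto)
  then show ?thesis
    using D addp smultp by (auto simp: dvs_def smooth_map_def prod_plots_def o_def case_prod_unfold)
qed

lemma dvs_dvs_sub:
  assumes V: "dvs V" and A: "A \<subseteq> carrier V" "\<zero>\<^bsub>V\<^esub> \<in> A"
    "\<And>x y. x \<in> A \<Longrightarrow> y \<in> A \<Longrightarrow> x \<oplus>\<^bsub>V\<^esub> y \<in> A" "\<And>r x. x \<in> A \<Longrightarrow> r \<odot>\<^bsub>V\<^esub> x \<in> A"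
  shows "dvs (dvs_sub V A)"
proof -
  interpret dvspace V using V by unfold_locales
  have cl: "x \<in> carrier V" if "x \<in> A" for x using A(1) that by blast
  have D: "diffeology A (sub_plots (plots V) A)"
    unfolding diffeology_def
  proof (intro conjI allI ballI impI)
    fix n U p assume p: "p \<in> sub_plots (plots V) A n U"
    then have p': "p \<in> plots V n U" "p \<in> U \<rightarrow> A" by (auto simp: sub_plots_def)
    show "eopen n U" "p \<in> U \<rightarrow> A" using p' diffeology_open[OF diffeo] by auto
    show "q \<in> sub_plots (plots V) A n U" if "\<forall>x\<in>U. q x = p x" for q
      using p' that diffeology_cong[OF diffeo p'(1)] by (auto simp: sub_plots_def Pi_iff)
    show "p \<circ> s \<in> sub_plots (plots V) A m U'" if "s \<in> euclidean_plots n U m U'" for m U' s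
      using p'(2) that diffeology_comp[OF diffeo p'(1) that]
      by (auto simp: sub_plots_def euclidean_plots_def)
  next
    fix n U c assume "c \<in> A" "eopen n U"
    then show "(\<lambda>_. c) \<in> sub_plots (plots V) A n U"
      using diffeology_const[OF diffeo] cl by (auto simp: sub_plots_def)
  next
    fix n \<U> p assume "\<forall>U\<in>\<U>. eopen n U \<and> p \<in> sub_plots (plots V) A n U"
    then show "p \<in> sub_plots (plots V) A n (\<Union>\<U>)"
      using diffeology_glue[OF diffeo, of \<U> n p] by (auto simp: sub_plots_def Pi_iff)
  qed
  show ?thesis
  proof (rule dvsI)
    show "diffeology (carrier (dvs_sub V A)) (plots (dvs_sub V A))" using D by (simp add: dvs_sub_def)
  qed (use A cl add_plot smult_plot in
      \<open>auto simp: dvs_sub_def sub_plots_def Pi_iff a_assoc smult_assoc1 smult_l_distr smult_r_distr intro: a_comm\<close>)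
qed

definition dvs_prod :: "'a dvs \<Rightarrow> 'b dvs \<Rightarrow> ('a \<times> 'b) dvs" where
  "dvs_prod V W =
     \<lparr>carrier = carrier V \<times> carrier W, mult = undefined, one = undefined,
      zero = (\<zero>\<^bsub>V\<^esub>, \<zero>\<^bsub>W\<^esub>),
      add = (\<lambda>x y. (fst x \<oplus>\<^bsub>V\<^esub> fst y, snd x \<oplus>\<^bsub>W\<^esub> snd y)),
      smult = (\<lambda>r x. (r \<odot>\<^bsub>V\<^esub> fst x, r \<odot>\<^bsub>W\<^esub> snd x)),
      plots = prod_plots (plots V) (plots W)\<rparr>"

lemma diffeology_prod_plots:
  assumes D: "diffeology X D" and E: "diffeology Y E"
  shows "diffeology (X \<times> Y) (prod_plots D E)"
  unfolding diffeology_def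
proof (intro conjI allI ballI impI)
  fix n U p assume "p \<in> prod_plots D E n U"
  then have p: "(\<lambda>x. fst (p x)) \<in> D n U" "(\<lambda>x. snd (p x)) \<in> E n U"
    by (auto simp: prod_plots_def o_def)
  show "eopen n U" "p \<in> U \<rightarrow> X \<times> Y"
    using diffeology_open[OF D p(1)] diffeology_into[OF D p(1)] diffeology_into[OF E p(2)]
    by (auto simp: Pi_iff mem_Times_iff)
  show "q \<in> prod_plots D E n U" if "\<forall>x\<in>U. q x = p x" for q
    using that diffeology_cong[OF D p(1), of "\<lambda>x. fst (q x)"] diffeology_cong[OF E p(2), of "\<lambda>x. snd (q x)"]
    by (auto simp: prod_plots_def o_def)
  show "p \<circ> s \<in> prod_plots D E m U'" if "s \<in> euclidean_plots n U m U'" for m U' s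
    using diffeology_comp[OF D p(1) that] diffeology_comp[OF E p(2) that]
    by (auto simp: prod_plots_def o_def)
next
  fix n U c assume "c \<in> X \<times> Y" "eopen n U"
  then show "(\<lambda>_. c) \<in> prod_plots D E n U"
    using diffeology_const[OF D] diffeology_const[OF E] by (auto simp: prod_plots_def o_def)
next
  fix n \<U> p assume "\<forall>U\<in>\<U>. eopen n U \<and> p \<in> prod_plots D E n U"
  then show "p \<in> prod_plots D E n (\<Union>\<U>)"
    using diffeology_glue[OF D, of \<U> n "fst \<circ> p"] diffeology_glue[OF E, of \<U> n "snd \<circ> p"]
    by (auto simp: prod_plots_def)
qed

lemma dvs_dvs_prod:
  assumes "dvs V" and "dvs W"
  shows "dvs (dvs_prod V W)"
proof -
  interpret V: dvspace V using assms by unfold_locales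
  interpret W: dvspace W using assms by unfold_locales
  show ?thesis
  proof (rule dvsI)
    show "diffeology (carrier (dvs_prod V W)) (plots (dvs_prod V W))"
      using diffeology_prod_plots[OF V.diffeo W.diffeo] by (simp add: dvs_prod_def)
  qed (auto simp: dvs_prod_def prod_plots_def o_def V.add_plot W.add_plot V.smult_plot W.smult_plot
      V.a_assoc W.a_assoc V.smult_assoc1 W.smult_assoc1 V.smult_l_distr W.smult_l_distr
      V.smult_r_distr W.smult_r_distr intro: V.a_comm W.a_comm)
qed

text \<open>The functional diffeology on smooth maps that are not assumed linear. It covers two
  cases: \<open>Linf\<close> is a subspace of it, and lifts over a fixed box are elements of
  it.\<close>

definition smooth_fun :: "'t set \<Rightarrow> 't plot_family \<Rightarrow> 'w dvs \<Rightarrow> ('t \<Rightarrow> 'w) dvs" where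
  "smooth_fun T E W = (let S = {s \<in> extensional T. s \<in> T \<rightarrow> carrier W \<and> smooth_map E (plots W) s} in
     \<lparr>carrier = S, mult = undefined, one = undefined,
      zero = (\<lambda>t\<in>T. \<zero>\<^bsub>W\<^esub>),
      add = (\<lambda>f g. \<lambda>t\<in>T. f t \<oplus>\<^bsub>W\<^esub> g t),
      smult = (\<lambda>r f. \<lambda>t\<in>T. r \<odot>\<^bsub>W\<^esub> f t),
      plots = (\<lambda>n U. {p \<in> U \<rightarrow> S. eopen n U \<and>
        smooth_map (prod_plots (euclidean_plots n U) E) (plots W) (\<lambda>(u, t). p u t)})\<rparr>)"

lemma smooth_map_prod_iff:
  "smooth_map (prod_plots D E) F (\<lambda>(u, t). f u t) \<longleftrightarrow>
    (\<forall>n U. \<forall>a\<in>D n U. \<forall>b\<in>E n U. (\<lambda>x. f (a x) (b x)) \<in> F n U)"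
proof
  assume *: "smooth_map (prod_plots D E) F (\<lambda>(u, t). f u t)"
  show "\<forall>n U. \<forall>a\<in>D n U. \<forall>b\<in>E n U. (\<lambda>x. f (a x) (b x)) \<in> F n U"
  proof (intro allI ballI)
    fix n U a b assume "a \<in> D n U" "b \<in> E n U"
    then have "(\<lambda>x. (a x, b x)) \<in> prod_plots D E n U" by (simp add: prod_plots_def o_def)
    then have "(\<lambda>(u, t). f u t) \<circ> (\<lambda>x. (a x, b x)) \<in> F n U" using * unfolding smooth_map_def by blast
    then show "(\<lambda>x. f (a x) (b x)) \<in> F n U" by (simp add: o_def)
  qed
next
  assume *: "\<forall>n U. \<forall>a\<in>D n U. \<forall>b\<in>E n U. (\<lambda>x. f (a x) (b x)) \<in> F n U"
  show "smooth_map (prod_plots D E) F (\<lambda>(u, t). f u t)"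
    unfolding smooth_map_def prod_plots_def
  proof (intro allI ballI)
    fix n U p assume "p \<in> {p. fst \<circ> p \<in> D n U \<and> snd \<circ> p \<in> E n U}"
    then have "(\<lambda>x. f ((fst \<circ> p) x) ((snd \<circ> p) x)) \<in> F n U" using * by blast
    then show "(\<lambda>(u, t). f u t) \<circ> p \<in> F n U" by (simp add: o_def case_prod_unfold)
  qed
qed

lemma smooth_fun_carrier_iff:
  "s \<in> carrier (smooth_fun T E W) \<longleftrightarrow> s \<in> extensional T \<and> s \<in> T \<rightarrow> carrier W \<and>
    (\<forall>m S. \<forall>b\<in>E m S. (\<lambda>z. s (b z)) \<in> plots W m S)"
  by (simp add: smooth_fun_def Let_def smooth_map_def o_def)

lemma smooth_fun_plots_iff:
  "p \<in> plots (smooth_fun T E W) n U \<longleftrightarrow> eopen n U \<and>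
    p \<in> U \<rightarrow> carrier (smooth_fun T E W) \<and>
    (\<forall>m S. \<forall>a\<in>euclidean_plots n U m S. \<forall>b\<in>E m S. (\<lambda>z. p (a z) (b z)) \<in> plots W m S)"
  by (auto simp: smooth_fun_def Let_def smooth_map_prod_iff)

lemma smooth_fun_simps:
  "zero (smooth_fun T E W) = (\<lambda>t\<in>T. \<zero>\<^bsub>W\<^esub>)"
  "add (smooth_fun T E W) = (\<lambda>f g. \<lambda>t\<in>T. f t \<oplus>\<^bsub>W\<^esub> g t)"
  "smult (smooth_fun T E W) = (\<lambda>r f. \<lambda>t\<in>T. r \<odot>\<^bsub>W\<^esub> f t)"
  by (simp_all add: smooth_fun_def Let_def)

lemma diffeology_smooth_fun:
  assumes W: "dvs W" and E: "diffeology T E"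
  shows "diffeology (carrier (smooth_fun T E W)) (plots (smooth_fun T E W))" (is "diffeology ?X ?D")
  unfolding diffeology_def
proof (intro conjI allI ballI impI)
  note DW = dvs_diffeology[OF W]
  fix n U p assume "p \<in> ?D n U"
  then have p: "eopen n U" "p \<in> U \<rightarrow> ?X"
    "\<And>m S a b. a \<in> euclidean_plots n U m S \<Longrightarrow> b \<in> E m S \<Longrightarrow> (\<lambda>z. p (a z) (b z)) \<in> plots W m S"
    by (auto simp: smooth_fun_plots_iff)
  show "eopen n U" "p \<in> U \<rightarrow> ?X" by (rule p)+
  show "q \<in> ?D n U" if q: "\<forall>x\<in>U. q x = p x" for q
    unfolding smooth_fun_plots_iff
  proof (intro conjI allI ballI p(1))
    show "q \<in> U \<rightarrow> ?X" using p(2) q by (simp add: Pi_iff)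
    fix m S a b assume a: "a \<in> euclidean_plots n U m S" and b: "b \<in> E m S"
    show "(\<lambda>z. q (a z) (b z)) \<in> plots W m S"
      by (rule diffeology_cong[OF DW p(3)[OF a b]]) (use a q in \<open>auto simp: euclidean_plots_def Pi_iff\<close>)
  qed
  show "p \<circ> s \<in> ?D k V" if s: "s \<in> euclidean_plots n U k V" for k V s
    unfolding smooth_fun_plots_iff
  proof (intro conjI allI ballI)
    show "eopen k V" "p \<circ> s \<in> V \<rightarrow> ?X"
      using s p(2) by (auto simp: euclidean_plots_def)
    fix m S a b assume a: "a \<in> euclidean_plots k V m S" and b: "b \<in> E m S"
    show "(\<lambda>z. (p \<circ> s) (a z) (b z)) \<in> plots W m S"
      using p(3)[OF diffeology_comp[OF diffeology_euclidean_plots[OF p(1)] s a] b] by simp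
  qed
next
  fix n U c assume "c \<in> ?X" "eopen n U"
  then show "(\<lambda>_. c) \<in> ?D n U" by (auto simp: smooth_fun_plots_iff smooth_fun_carrier_iff)
next
  note DW = dvs_diffeology[OF W]
  fix n \<U> p assume *: "\<forall>U\<in>\<U>. eopen n U \<and> p \<in> ?D n U"
  show "p \<in> ?D n (\<Union>\<U>)"
    unfolding smooth_fun_plots_iff
  proof (intro conjI allI ballI)
    show "eopen n (\<Union>\<U>)" "p \<in> \<Union>\<U> \<rightarrow> ?X"
      using * by (auto simp: smooth_fun_plots_iff)
    fix m S a b assume a: "a \<in> euclidean_plots n (\<Union>\<U>) m S" and b: "b \<in> E m S"
    have S: "eopen m S" "a \<in> S \<rightarrow> \<Union>\<U>" using a by (auto simp: euclidean_plots_def)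
    \<comment> \<open>A plot a into the union need not stay in one member, so its domain is cut into
      the open preimages and the evaluated plot is glued in W.\<close>
    let ?S = "\<lambda>U. {z \<in> S. a z \<in> U}"
    have "eopen m (?S U) \<and> (\<lambda>z. p (a z) (b z)) \<in> plots W m (?S U)" if U: "U \<in> \<U>" for U
    proof
      show o: "eopen m (?S U)"
        using openin_euclidean_plots_preimage[OF a] * U by blast
      have "a \<in> euclidean_plots n U m (?S U)"
        by (rule euclidean_plots_subset[OF a _ _ _ o]) (use * U in auto)
      moreover have "b \<in> E m (?S U)" by (rule diffeology_restrict[OF E b o]) auto
      ultimately show "(\<lambda>z. p (a z) (b z)) \<in> plots W m (?S U)"
        using * U by (auto simp: smooth_fun_plots_iff)
    qed
    then have "(\<lambda>z. p (a z) (b z)) \<in> plots W m (\<Union>(?S ` \<U>))"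
      by (intro diffeology_glue[OF DW]) auto
    moreover have "\<Union>(?S ` \<U>) = S" using S(2) by auto
    ultimately show "(\<lambda>z. p (a z) (b z)) \<in> plots W m S" by simp
  qed
qed

lemma dvs_smooth_fun:
  assumes W: "dvs W" and E: "diffeology T E"
  shows "dvs (smooth_fun T E W)" (is "dvs ?F")
proof -
  interpret W: dvspace W using W by unfold_locales
  have bT: "b z \<in> T" if "b \<in> E m S" "z \<in> S" for b m S z
    using diffeology_into[OF E that(1)] that(2) by blast
  have into: "s t \<in> carrier W" if "s \<in> carrier ?F" "t \<in> T" for s t
    using that by (auto simp: smooth_fun_carrier_iff)
  have ext: "f = g" if "f \<in> extensional T" "g \<in> extensional T" "\<And>t. t \<in> T \<Longrightarrow> f t = g t"
    for f g :: "_ \<Rightarrow> 'a" using that by (rule extensionalityI)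
  have addc: "x \<oplus>\<^bsub>?F\<^esub> y \<in> carrier ?F" if x: "x \<in> carrier ?F" and y: "y \<in> carrier ?F" for x y
    unfolding smooth_fun_carrier_iff
  proof (intro conjI allI ballI)
    fix m S b assume b: "b \<in> E m S"
    have "(\<lambda>z. x (b z)) \<in> plots W m S" "(\<lambda>z. y (b z)) \<in> plots W m S"
      using x y b by (auto simp: smooth_fun_carrier_iff)
    from W.add_plot[OF this] show "(\<lambda>z. (x \<oplus>\<^bsub>?F\<^esub> y) (b z)) \<in> plots W m S"
      by (rule diffeology_cong[OF W.diffeo]) (simp add: smooth_fun_simps bT[OF b])
  qed (use into x y in \<open>auto simp: smooth_fun_simps\<close>)
  have smultc: "r \<odot>\<^bsub>?F\<^esub> x \<in> carrier ?F" if x: "x \<in> carrier ?F" for r x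
    unfolding smooth_fun_carrier_iff
  proof (intro conjI allI ballI)
    fix m S b assume b: "b \<in> E m S"
    have *: "(\<lambda>z. x (b z)) \<in> plots W m S"
      using x b by (auto simp: smooth_fun_carrier_iff)
    have "(\<lambda>_. r) \<in> real_plots m S"
      using diffeology_open[OF E b] by (simp add: real_plots_def smooth_on_const)
    from W.smult_plot[OF this *] show "(\<lambda>z. (r \<odot>\<^bsub>?F\<^esub> x) (b z)) \<in> plots W m S"
      by (rule diffeology_cong[OF W.diffeo]) (simp add: smooth_fun_simps bT[OF b])
  qed (use into x in \<open>auto simp: smooth_fun_simps\<close>)
  have e: "x \<in> extensional T" if "x \<in> carrier ?F" for x using that by (simp add: smooth_fun_carrier_iff)
  show ?thesis
  proof (rule dvsI)
    show "diffeology (carrier ?F) (plots ?F)" by (rule diffeology_smooth_fun[OF W E])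
    show "\<zero>\<^bsub>?F\<^esub> \<in> carrier ?F"
      unfolding smooth_fun_carrier_iff
    proof (intro conjI allI ballI)
      fix m S b assume b: "b \<in> E m S"
      have "(\<lambda>_. \<zero>\<^bsub>W\<^esub>) \<in> plots W m S"
        by (rule diffeology_const[OF W.diffeo _ diffeology_open[OF E b]]) simp
      then show "(\<lambda>z. \<zero>\<^bsub>?F\<^esub> (b z)) \<in> plots W m S"
        by (rule diffeology_cong[OF W.diffeo]) (simp add: smooth_fun_simps bT[OF b])
    qed (auto simp: smooth_fun_simps)
    show "x \<oplus>\<^bsub>?F\<^esub> y \<oplus>\<^bsub>?F\<^esub> z = x \<oplus>\<^bsub>?F\<^esub> (y \<oplus>\<^bsub>?F\<^esub> z)"
      if "x \<in> carrier ?F" "y \<in> carrier ?F" "z \<in> carrier ?F" for x y z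
      by (rule ext) (use into that in \<open>auto simp: smooth_fun_simps W.a_assoc\<close>)
    show "x \<oplus>\<^bsub>?F\<^esub> y = y \<oplus>\<^bsub>?F\<^esub> x" if "x \<in> carrier ?F" "y \<in> carrier ?F" for x y
      by (rule ext) (use into that W.a_comm in \<open>auto simp: smooth_fun_simps\<close>)
    show "\<zero>\<^bsub>?F\<^esub> \<oplus>\<^bsub>?F\<^esub> x = x" "0 \<odot>\<^bsub>?F\<^esub> x = \<zero>\<^bsub>?F\<^esub>" "1 \<odot>\<^bsub>?F\<^esub> x = x" if "x \<in> carrier ?F" for x
      by (rule ext; use into e that in \<open>auto simp: smooth_fun_simps\<close>)+
    show "(r + s) \<odot>\<^bsub>?F\<^esub> x = r \<odot>\<^bsub>?F\<^esub> x \<oplus>\<^bsub>?F\<^esub> s \<odot>\<^bsub>?F\<^esub> x" "(r * s) \<odot>\<^bsub>?F\<^esub> x = r \<odot>\<^bsub>?F\<^esub> (s \<odot>\<^bsub>?F\<^esub> x)"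
      if "x \<in> carrier ?F" for r s x
      by (rule ext; use into that in \<open>auto simp: smooth_fun_simps W.smult_l_distr W.smult_assoc1\<close>)+
    show "r \<odot>\<^bsub>?F\<^esub> (x \<oplus>\<^bsub>?F\<^esub> y) = r \<odot>\<^bsub>?F\<^esub> x \<oplus>\<^bsub>?F\<^esub> r \<odot>\<^bsub>?F\<^esub> y"
      if "x \<in> carrier ?F" "y \<in> carrier ?F" for r x y
      by (rule ext) (use into that in \<open>auto simp: smooth_fun_simps W.smult_r_distr\<close>)
    fix n U q assume q: "q \<in> plots ?F n U"
    then have q': "eopen n U" "q \<in> U \<rightarrow> carrier ?F"
      "\<And>m S a b. a \<in> euclidean_plots n U m S \<Longrightarrow> b \<in> E m S \<Longrightarrow> (\<lambda>z. q (a z) (b z)) \<in> plots W m S"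
      by (auto simp: smooth_fun_plots_iff)
    show "(\<lambda>x. p x \<oplus>\<^bsub>?F\<^esub> q x) \<in> plots ?F n U" if p: "p \<in> plots ?F n U" for p
      unfolding smooth_fun_plots_iff
    proof (intro conjI allI ballI q'(1))
      show "(\<lambda>x. p x \<oplus>\<^bsub>?F\<^esub> q x) \<in> U \<rightarrow> carrier ?F"
        using p q' addc by (auto simp: smooth_fun_plots_iff Pi_iff)
      fix m S a b assume a: "a \<in> euclidean_plots n U m S" and b: "b \<in> E m S"
      have "(\<lambda>z. p (a z) (b z)) \<in> plots W m S" using p a b by (auto simp: smooth_fun_plots_iff)
      from W.add_plot[OF this q'(3)[OF a b]]
      show "(\<lambda>z. (p (a z) \<oplus>\<^bsub>?F\<^esub> q (a z)) (b z)) \<in> plots W m S"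
        by (rule diffeology_cong[OF W.diffeo]) (simp add: smooth_fun_simps bT[OF b])
    qed
    show "(\<lambda>x. r x \<odot>\<^bsub>?F\<^esub> q x) \<in> plots ?F n U" if r: "r \<in> real_plots n U" for r
      unfolding smooth_fun_plots_iff
    proof (intro conjI allI ballI q'(1))
      show "(\<lambda>x. r x \<odot>\<^bsub>?F\<^esub> q x) \<in> U \<rightarrow> carrier ?F"
        using q' smultc by (auto simp: Pi_iff)
      fix m S a b assume a: "a \<in> euclidean_plots n U m S" and b: "b \<in> E m S"
      from W.smult_plot[OF real_plots_compose[OF r a] q'(3)[OF a b]]
      show "(\<lambda>z. (r (a z) \<odot>\<^bsub>?F\<^esub> q (a z)) (b z)) \<in> plots W m S"
        by (rule diffeology_cong[OF W.diffeo]) (simp add: smooth_fun_simps bT[OF b])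
    qed
  qed (use addc smultc in auto)
qed

subsection \<open>Spaces of smooth linear maps\<close>

text \<open>With this, the vector space axioms and the diffeology of \<open>Linf\<close> are
  inherited from \<open>smooth_fun\<close>; only closure of the linear maps under the operations
  remains for \<open>dvs_Linf\<close>.\<close>

lemma Linf_eq_dvs_sub:
  "Linf V W = dvs_sub (smooth_fun (carrier V) (plots V) W)
    {f \<in> carrier (smooth_fun (carrier V) (plots V) W).
      (\<forall>x\<in>carrier V. \<forall>y\<in>carrier V. f (x \<oplus>\<^bsub>V\<^esub> y) = f x \<oplus>\<^bsub>W\<^esub> f y) \<and>
      (\<forall>r. \<forall>x\<in>carrier V. f (r \<odot>\<^bsub>V\<^esub> x) = r \<odot>\<^bsub>W\<^esub> f x)}" (is "_ = dvs_sub ?F ?A")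
proof -
  have A: "{f \<in> extensional (carrier V). smooth_linear V W f} = ?A"
    by (auto simp: smooth_fun_carrier_iff smooth_linear_def smooth_map_def o_def)
  then have "p \<in> U \<rightarrow> ?A \<longleftrightarrow> p \<in> U \<rightarrow> carrier ?F \<and> p \<in> U \<rightarrow> ?A" for p :: "(nat \<Rightarrow> real) \<Rightarrow> _" and U
    by (auto simp: Pi_iff)
  then show ?thesis
    unfolding Linf_def Let_def A
    by (auto simp: dvs_sub_def smooth_fun_def Let_def sub_plots_def fun_eq_iff)
qed

lemma Linf_carrier_iff:
  "f \<in> carrier (Linf V W) \<longleftrightarrow> f \<in> extensional (carrier V) \<and> smooth_linear V W f"
  by (simp add: Linf_def Let_def)

lemma Linf_plots_iff:
  "p \<in> plots (Linf V W) n U \<longleftrightarrow> eopen n U \<and> p \<in> U \<rightarrow> carrier (Linf V W) \<and>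
    (\<forall>m S. \<forall>a\<in>euclidean_plots n U m S. \<forall>b\<in>plots V m S. (\<lambda>z. p (a z) (b z)) \<in> plots W m S)"
  by (auto simp: Linf_def Let_def smooth_map_prod_iff)

lemma Linf_simps:
  "zero (Linf V W) = (\<lambda>x\<in>carrier V. \<zero>\<^bsub>W\<^esub>)"
  "add (Linf V W) = (\<lambda>f g. \<lambda>x\<in>carrier V. f x \<oplus>\<^bsub>W\<^esub> g x)"
  "smult (Linf V W) = (\<lambda>r f. \<lambda>x\<in>carrier V. r \<odot>\<^bsub>W\<^esub> f x)"
  by (simp_all add: Linf_def Let_def)

lemma Linf_hom:
  "dvs V \<Longrightarrow> dvs W \<Longrightarrow> f \<in> carrier (Linf V W) \<Longrightarrow> DVect_hom V W f"
  by (simp add: Linf_carrier_iff DVect_hom_def)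

lemma restrict_in_Linf:
  assumes "DVect_hom V W f"
  shows "(\<lambda>x\<in>carrier V. f x) \<in> carrier (Linf V W)"
proof -
  interpret V: dvspace V using DVect_homD(1)[OF assms] by unfold_locales
  interpret W: dvspace W using DVect_homD(2)[OF assms] by unfold_locales
  have "(\<lambda>z. (\<lambda>x\<in>carrier V. f x) (b z)) \<in> plots W m S" if b: "b \<in> plots V m S" for m S b
    by (rule diffeology_cong[OF W.diffeo DVect_homD(6)[OF assms b]]) (use V.plot_closed[OF b] in simp)
  then show ?thesis
    using DVect_homD(3,4,5)[OF assms]
    by (auto simp: Linf_carrier_iff smooth_linear_def smooth_map_def o_def)
qed

lemma dvs_Linf:
  assumes "dvs V" and "dvs W"
  shows "dvs (Linf V W)"
proof -
  interpret V: dvspace V using assms by unfold_locales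
  interpret W: dvspace W using assms by unfold_locales
  interpret F: dvspace "smooth_fun (carrier V) (plots V) W"
    using dvs_smooth_fun[OF assms(2) V.diffeo] by unfold_locales
  have into: "f x \<in> carrier W" if "f \<in> carrier (smooth_fun (carrier V) (plots V) W)" "x \<in> carrier V" for f x
    using that by (auto simp: smooth_fun_carrier_iff)
  have swap: "a \<oplus>\<^bsub>W\<^esub> b \<oplus>\<^bsub>W\<^esub> (c \<oplus>\<^bsub>W\<^esub> d) = a \<oplus>\<^bsub>W\<^esub> c \<oplus>\<^bsub>W\<^esub> (b \<oplus>\<^bsub>W\<^esub> d)"
    if "a \<in> carrier W" "b \<in> carrier W" "c \<in> carrier W" "d \<in> carrier W" for a b c d
    using that by (simp add: W.a_ac)
  show ?thesis
    unfolding Linf_eq_dvs_sub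
  proof (rule dvs_dvs_sub[OF F.dvs], goal_cases)
    case 3
    then show ?case using F.a_closed swap into
      by (auto simp: smooth_fun_simps W.smult_r_distr)
  next
    case (4 r f)
    have "s \<odot>\<^bsub>W\<^esub> (r \<odot>\<^bsub>W\<^esub> w) = r \<odot>\<^bsub>W\<^esub> (s \<odot>\<^bsub>W\<^esub> w)" if "w \<in> carrier W" for s w
      using W.smult_assoc1[of s r w] W.smult_assoc1[of r s w] that by (simp add: mult.commute)
    then show ?case using 4 F.smult_closed[of r f] into
      by (auto simp: smooth_fun_simps W.smult_r_distr)
  qed (use F.zero_closed in \<open>auto simp: smooth_fun_simps\<close>)
qed

lemma Linf_map_apply: "x \<in> carrier V \<Longrightarrow> Linf_map V f \<phi> x = f (\<phi> x)"
  by (simp add: Linf_map_def compose_def)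

lemma Linf_eqI:
  assumes "\<phi> \<in> carrier (Linf V W)" and "\<psi> \<in> carrier (Linf V W)"
    and "\<And>x. x \<in> carrier V \<Longrightarrow> \<phi> x = \<psi> x"
  shows "\<phi> = \<psi>"
  using assms by (auto simp: Linf_carrier_iff intro: extensionalityI)

lemma Linf_map_hom:
  assumes V: "dvs V" and f: "DVect_hom W W' f"
  shows "DVect_hom (Linf V W) (Linf V W') (Linf_map V f)"
proof -
  note W = DVect_homD(1,2)[OF f]
  interpret V: dvspace V using V by unfold_locales
  interpret W': dvspace W' using W by unfold_locales
  have closed: "Linf_map V f \<phi> \<in> carrier (Linf V W')" if "\<phi> \<in> carrier (Linf V W)" for \<phi>
    using restrict_in_Linf[OF DVect_hom_comp[OF Linf_hom[OF V W(1) that] f]]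
    by (simp add: Linf_map_def compose_def)
  have into: "\<phi> x \<in> carrier W" if "\<phi> \<in> carrier (Linf V W)" "x \<in> carrier V" for \<phi> x
    using that by (auto simp: Linf_carrier_iff smooth_linear_def)
  have "(\<lambda>u. Linf_map V f (p u)) \<in> plots (Linf V W') n U" if p: "p \<in> plots (Linf V W) n U" for p n U
    unfolding Linf_plots_iff
  proof (intro conjI allI ballI)
    show "eopen n U" "(\<lambda>u. Linf_map V f (p u)) \<in> U \<rightarrow> carrier (Linf V W')"
      using p closed by (auto simp: Linf_plots_iff)
    fix m S a b assume a: "a \<in> euclidean_plots n U m S" and b: "b \<in> plots V m S"
    have "(\<lambda>z. p (a z) (b z)) \<in> plots W m S" using p a b by (auto simp: Linf_plots_iff)
    from DVect_homD(6)[OF f this] show "(\<lambda>z. Linf_map V f (p (a z)) (b z)) \<in> plots W' m S"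
      by (rule diffeology_cong[OF W'.diffeo]) (use V.plot_closed[OF b] in \<open>simp add: Linf_map_apply\<close>)
  qed
  then show ?thesis
    using closed into dvs_Linf[OF V W(1)] dvs_Linf[OF V W(2)]
    by (auto simp: DVect_hom_def smooth_linear_def smooth_map_def o_def Linf_simps Linf_map_def
        compose_def fun_eq_iff DVect_homD(4,5)[OF f])
qed

lemma Linf_precompose_hom:
  assumes g: "DVect_hom V' V g" and W: "dvs W"
  shows "DVect_hom (Linf V W) (Linf V' W) (\<lambda>\<phi>. compose (carrier V') \<phi> g)"
proof -
  note V = DVect_homD(1,2)[OF g]
  interpret V': dvspace V' using V by unfold_locales
  interpret W: dvspace W using W by unfold_locales
  have closed: "compose (carrier V') \<phi> g \<in> carrier (Linf V' W)" if "\<phi> \<in> carrier (Linf V W)" for \<phi>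
    using restrict_in_Linf[OF DVect_hom_comp[OF g Linf_hom[OF V(2) W that]]]
    by (simp add: compose_def)
  have into: "g x \<in> carrier V" if "x \<in> carrier V'" for x
    using DVect_homD(3)[OF g] that by auto
  have "(\<lambda>u. compose (carrier V') (p u) g) \<in> plots (Linf V' W) n U" if p: "p \<in> plots (Linf V W) n U" for p n U
    unfolding Linf_plots_iff
  proof (intro conjI allI ballI)
    show "eopen n U" "(\<lambda>u. compose (carrier V') (p u) g) \<in> U \<rightarrow> carrier (Linf V' W)"
      using p closed by (auto simp: Linf_plots_iff)
    fix m S a b assume a: "a \<in> euclidean_plots n U m S" and b: "b \<in> plots V' m S"
    have "(\<lambda>z. p (a z) (g (b z))) \<in> plots W m S" using p a DVect_homD(6)[OF g b] by (auto simp: Linf_plots_iff)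
    then show "(\<lambda>z. compose (carrier V') (p (a z)) g (b z)) \<in> plots W m S"
      by (rule diffeology_cong[OF W.diffeo]) (use V'.plot_closed[OF b] in \<open>simp add: compose_def\<close>)
  qed
  then show ?thesis
    using closed into dvs_Linf[OF V(1) W] dvs_Linf[OF V(2) W]
    by (auto simp: DVect_hom_def smooth_linear_def smooth_map_def o_def Linf_simps
        compose_def fun_eq_iff)
qed

section \<open>Lifting families of maps on a projective space\<close>

text \<open>Surjectivity comes for free: a vector is a constant plot on the one-point space of
  dimension 0, and a local lift of that plot provides a preimage.\<close>

lemma subductionI:
  assumes hom: "DVect_hom V W f"
    and lifts: "\<And>n U q. q \<in> plots W n U \<Longrightarrow> locally_lifts (plots V) f n U q"
  shows "subduction V W f"
proof -
  interpret V: dvspace V using DVect_homD(1)[OF hom] by unfold_locales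
  interpret W: dvspace W using DVect_homD(2)[OF hom] by unfold_locales
  have "w \<in> f ` carrier V" if w: "w \<in> carrier W" for w
  proof -
    let ?U = "Espace 0"
    have x: "(\<lambda>_. 0) \<in> ?U" by (simp add: topspace_Euclidean_space)
    have "(\<lambda>_. w) \<in> plots W 0 ?U" by (rule diffeology_const[OF W.diffeo w]) simp
    from lifts[OF this] x obtain U' q where
      q: "(\<lambda>_. 0) \<in> U'" "q \<in> plots V 0 U'" "\<forall>y\<in>U'. f (q y) = w"
      unfolding locally_lifts_def by blast
    show ?thesis by (rule image_eqI[OF _ V.plot_closed[OF q(2,1)]]) (use q in simp)
  qed
  then have "f ` carrier V = carrier W" using DVect_homD(3)[OF hom] by auto
  then show ?thesis
    using hom lifts by (auto simp: subduction_map_def DVect_hom_def smooth_linear_def)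
qed

section \<open>Coordinates on a product of Euclidean spaces\<close>

definition concat_coords :: "nat \<Rightarrow> (nat \<Rightarrow> real) \<Rightarrow> (nat \<Rightarrow> real) \<Rightarrow> nat \<Rightarrow> real" where
  "concat_coords n u y = (\<lambda>i. if i < n then u i else y (i - n))"

text \<open>Padding by 0 is what places the projection of a point of dimension n + m back in
  \<open>Espace n\<close>.\<close>

definition fst_coords :: "nat \<Rightarrow> (nat \<Rightarrow> real) \<Rightarrow> nat \<Rightarrow> real" where
  "fst_coords n z = (\<lambda>i. if i < n then z i else 0)"

definition snd_coords :: "nat \<Rightarrow> nat \<Rightarrow> (nat \<Rightarrow> real) \<Rightarrow> nat \<Rightarrow> real" where
  "snd_coords n m z = (\<lambda>i. if i < m then z (n + i) else 0)"

lemma coords_concat: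
  "u \<in> Espace n \<Longrightarrow> fst_coords n (concat_coords n u y) = u"
  "y \<in> Espace m \<Longrightarrow> snd_coords n m (concat_coords n u y) = y"
  by (auto simp: fst_coords_def snd_coords_def concat_coords_def in_topspace_Euclidean fun_eq_iff)

lemma fst_coords_plot:
  assumes "eopen n U" "eopen (n + m) Q"
    "\<And>z. z \<in> Q \<Longrightarrow> fst_coords n z \<in> U"
  shows "fst_coords n \<in> euclidean_plots n U (n + m) Q"
  using assms by (auto simp: euclidean_plots_def fst_coords_def smooth_on_coord)

lemma snd_coords_plot:
  assumes "eopen m U" "eopen (n + m) Q"
    "\<And>z. z \<in> Q \<Longrightarrow> snd_coords n m z \<in> U"
  shows "snd_coords n m \<in> euclidean_plots m U (n + m) Q"
  using assms by (auto simp: euclidean_plots_def snd_coords_def smooth_on_coord)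

lemma concat_coords_plot:
  assumes "a \<in> euclidean_plots n U k S" "b \<in> euclidean_plots m T k S"
    "eopen (n + m) Q" "\<And>z. z \<in> S \<Longrightarrow> concat_coords n (a z) (b z) \<in> Q"
  shows "(\<lambda>z. concat_coords n (a z) (b z)) \<in> euclidean_plots (n + m) Q k S"
proof -
  have "smooth_on k S (\<lambda>z. concat_coords n (a z) (b z) i)" if "i < n + m" for i
    using assms(1,2) that by (cases "i < n") (auto simp: euclidean_plots_def concat_coords_def)
  then show ?thesis using assms by (auto simp: euclidean_plots_def)
qed

lemma openin_coords:
  assumes U: "eopen n U" and T: "eopen m T"
  shows "eopen (n + m)
    {z \<in> Espace (n + m). fst_coords n z \<in> U \<and> snd_coords n m z \<in> T}"
proof -
  let ?E = "\<lambda>n. Espace n"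
  have "fst_coords n \<in> euclidean_plots n (?E n) (n + m) (?E (n + m))"
    by (rule fst_coords_plot) (auto simp: fst_coords_def in_topspace_Euclidean)
  from openin_euclidean_plots_preimage[OF this U]
  have 1: "eopen (n + m) {z \<in> ?E (n + m). fst_coords n z \<in> U}" .
  have "snd_coords n m \<in> euclidean_plots m (?E m) (n + m) (?E (n + m))"
    by (rule snd_coords_plot) (auto simp: snd_coords_def in_topspace_Euclidean)
  from openin_euclidean_plots_preimage[OF this T]
  have 2: "eopen (n + m) {z \<in> ?E (n + m). snd_coords n m z \<in> T}" .
  have "{z \<in> ?E (n + m). fst_coords n z \<in> U \<and> snd_coords n m z \<in> T} =
      {z \<in> ?E (n + m). fst_coords n z \<in> U} \<inter> {z \<in> ?E (n + m). snd_coords n m z \<in> T}" by auto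
  then show ?thesis using openin_Int[OF 1 2] by simp
qed

text \<open>A lift of the family \<open>p\<close> near \<open>x\<close> is a linear map from P to the space of pairs (s, v) where
  \<open>s\<close> is a smooth lift of \<open>u \<mapsto> p u v\<close> over a fixed box around \<open>x\<close>; it exists as the projection
  of this space to P is a subduction. The box has to be the same for all \<open>v\<close>, which is why plots
  must be lifted over whole boxes and not just near points.\<close>

theorem subduction_Linf_projective:
  assumes P: "projective P" and hom: "DVect_hom W2 W3 f" and sub: "subduction W2 W3 f"
  shows "subduction (Linf P W2) (Linf P W3) (Linf_map P f)"
proof (rule subductionI)
  have dP: "dvs P" using P by (simp add: projective_def)
  note dW = DVect_homD(1,2)[OF hom]
  show "DVect_hom (Linf P W2) (Linf P W3) (Linf_map P f)" by (rule Linf_map_hom[OF dP hom])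
  interpret P: dvspace P using dP by unfold_locales
  interpret W2: dvspace W2 using dW by unfold_locales
  interpret W3: dvspace W3 using dW by unfold_locales
  fix n U p assume p: "p \<in> plots (Linf P W3) n U"
  then have oU: "eopen n U" and pL: "\<And>u. u \<in> U \<Longrightarrow> p u \<in> carrier (Linf P W3)"
    and pp: "\<And>m S a b. a \<in> euclidean_plots n U m S \<Longrightarrow> b \<in> plots P m S \<Longrightarrow>
      (\<lambda>z. p (a z) (b z)) \<in> plots W3 m S"
    by (auto simp: Linf_plots_iff)
  note ph = Linf_hom[OF dP dW(2) pL]
  show "locally_lifts (plots (Linf P W2)) (Linf_map P f) n U p"
    unfolding locally_lifts_def
  proof
    fix x assume x: "x \<in> U"
    obtain e where e: "e > 0" "cube n x e \<subseteq> U" using openin_cube_subset[OF oU x] .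
    have xt: "x \<in> Espace n" using oU x openin_subset by blast
    \<comment> \<open>Half the radius, so that the closed box around U0 still lies in U, where p is
      defined.\<close>
    define U0 where "U0 = cube n x (e / 2)"
    have oU0: "eopen n U0" by (simp add: U0_def openin_obox)
    have U0U: "U0 \<subseteq> U" using e by (force simp: U0_def cube_iff)
    have xU0: "x \<in> U0" using e xt by (simp add: U0_def cube_iff)
    note EU0 = diffeology_euclidean_plots[OF oU0]
    define F where "F = smooth_fun U0 (euclidean_plots n U0) W2"
    \<comment> \<open>The fibre product of P with the smooth functions on U0 over v \<mapsto> (u
      \<mapsto> p u v). It is a subspace because f and all p u are linear.\<close>
    define A where "A = {(s, v) \<in> carrier F \<times> carrier P. \<forall>u\<in>U0. f (s u) = p u v}"
    define X where "X = dvs_sub (dvs_prod F P) A"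
    have dF: "dvs F" unfolding F_def by (rule dvs_smooth_fun[OF dW(1) EU0])
    interpret F: dvspace F using dF by unfold_locales
    have Finto: "s u \<in> carrier W2" if "s \<in> carrier F" "u \<in> U0" for s u
      using that by (auto simp: F_def smooth_fun_carrier_iff)
    have X_simps: "carrier X = A" "plots X = sub_plots (prod_plots (plots F) (plots P)) A"
      "add X = (\<lambda>x y. (fst x \<oplus>\<^bsub>F\<^esub> fst y, snd x \<oplus>\<^bsub>P\<^esub> snd y))"
      "smult X = (\<lambda>r x. (r \<odot>\<^bsub>F\<^esub> fst x, r \<odot>\<^bsub>P\<^esub> snd x))"
      by (simp_all add: X_def dvs_sub_def dvs_prod_def)
    have dX: "dvs X"
      unfolding X_def
    proof (rule dvs_dvs_sub[OF dvs_dvs_prod[OF dF dP]])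
      show "A \<subseteq> carrier (dvs_prod F P)" by (auto simp: A_def dvs_prod_def)
      have "f \<zero>\<^bsub>W2\<^esub> = p u \<zero>\<^bsub>P\<^esub>" if "u \<in> U0" for u
        using DVect_hom_zero[OF hom] DVect_hom_zero[OF ph] that U0U by auto
      moreover have "\<zero>\<^bsub>F\<^esub> u = \<zero>\<^bsub>W2\<^esub>" if "u \<in> U0" for u using that by (simp add: F_def smooth_fun_simps)
      ultimately show "\<zero>\<^bsub>dvs_prod F P\<^esub> \<in> A" by (simp add: A_def dvs_prod_def)
    next
      fix a b assume a: "a \<in> A" and b: "b \<in> A"
      have "f ((fst a \<oplus>\<^bsub>F\<^esub> fst b) u) = p u (snd a \<oplus>\<^bsub>P\<^esub> snd b)" if u: "u \<in> U0" for u
      proof -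
        have "(fst a \<oplus>\<^bsub>F\<^esub> fst b) u = fst a u \<oplus>\<^bsub>W2\<^esub> fst b u" using u by (simp add: F_def smooth_fun_simps)
        then show ?thesis
          using a b u U0U Finto DVect_homD(4)[OF hom] DVect_homD(4)[OF ph] by (auto simp: A_def)
      qed
      then show "a \<oplus>\<^bsub>dvs_prod F P\<^esub> b \<in> A" using a b by (auto simp: A_def dvs_prod_def)
    next
      fix r a assume a: "a \<in> A"
      have "f ((r \<odot>\<^bsub>F\<^esub> fst a) u) = p u (r \<odot>\<^bsub>P\<^esub> snd a)" if u: "u \<in> U0" for u
      proof -
        have "(r \<odot>\<^bsub>F\<^esub> fst a) u = r \<odot>\<^bsub>W2\<^esub> fst a u" using u by (simp add: F_def smooth_fun_simps)
        then show ?thesis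
          using a u U0U Finto DVect_homD(5)[OF hom] DVect_homD(5)[OF ph] by (auto simp: A_def)
      qed
      then show "r \<odot>\<^bsub>dvs_prod F P\<^esub> a \<in> A" using a by (auto simp: A_def dvs_prod_def)
    qed
    have hsnd: "DVect_hom X P snd"
      using dX dP by (auto simp: DVect_hom_def smooth_linear_def smooth_map_def X_simps A_def
          sub_plots_def prod_plots_def)
    have "subduction X P snd"
    proof (rule subductionI[OF hsnd])
      fix m T r assume r: "r \<in> plots P m T"
      have oT: "eopen m T" using diffeology_open[OF P.diffeo r] .
      show "locally_lifts (plots X) snd m T r"
        unfolding locally_lifts_def
      proof
        fix y assume y: "y \<in> T"
        obtain e' where e': "e' > 0" "cube m y e' \<subseteq> T" using openin_cube_subset[OF oT y] .
        have yt: "y \<in> Espace m" using oT y openin_subset by blast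
        define T0 where "T0 = cube m y (e' / 2)"
        have oT0: "eopen m T0" by (simp add: T0_def openin_obox)
        have T0T: "T0 \<subseteq> T" using e' by (force simp: T0_def cube_iff)
        have yT0: "y \<in> T0" using e' yt by (simp add: T0_def cube_iff)
        \<comment> \<open>On Q the function q (u, y) = p u (r y) is a plot of W3 in all n + m
          variables together, so one application of \<open>box_lift\<close> lifts it in u and y
          simultaneously.\<close>
        define Q where "Q = {z \<in> Espace (n + m). fst_coords n z \<in> U \<and> snd_coords n m z \<in> T}"
        have oQ: "eopen (n + m) Q" unfolding Q_def by (rule openin_coords[OF oU oT])
        define q where "q z = p (fst_coords n z) (r (snd_coords n m z))" for z
        have "r \<circ> snd_coords n m \<in> plots P (n + m) Q"
          by (rule diffeology_comp[OF P.diffeo r snd_coords_plot[OF oT oQ]]) (simp add: Q_def)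
        then have q: "q \<in> plots W3 (n + m) Q"
          unfolding q_def using pp[OF fst_coords_plot[OF oU oQ]] by (simp add: Q_def o_def)
        \<comment> \<open>The closed box with radii e / 2 and e' / 2 contains U0 x T0 and lies in Q,
          since the cubes with radii e and e' lie in U and T.\<close>
        define \<alpha> where "\<alpha> = concat_coords n (\<lambda>i. x i - e / 2) (\<lambda>i. y i - e' / 2)"
        define \<beta> where "\<beta> = concat_coords n (\<lambda>i. x i + e / 2) (\<lambda>i. y i + e' / 2)"
        have "{z \<in> Espace (n + m). \<forall>i<n + m. \<alpha> i \<le> z i \<and> z i \<le> \<beta> i} \<subseteq> Q"
        proof clarify
          fix z assume zt: "z \<in> Espace (n + m)" and z: "\<forall>i<n + m. \<alpha> i \<le> z i \<and> z i \<le> \<beta> i"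
          have "\<bar>z i - x i\<bar> < e" if "i < n" for i
          proof -
            have "x i - e / 2 \<le> z i" "z i \<le> x i + e / 2"
              using z[rule_format, of i] that by (auto simp: \<alpha>_def \<beta>_def concat_coords_def)
            then show ?thesis using e(1) by linarith
          qed
          then have "fst_coords n z \<in> cube n x e"
            by (auto simp: cube_iff fst_coords_def in_topspace_Euclidean)
          moreover have "\<bar>z (n + i) - y i\<bar> < e'" if "i < m" for i
          proof -
            have "y i - e' / 2 \<le> z (n + i)" "z (n + i) \<le> y i + e' / 2"
              using z[rule_format, of "n + i"] that by (auto simp: \<alpha>_def \<beta>_def concat_coords_def)
            then show ?thesis using e'(1) by linarith
          qed
          then have "snd_coords n m z \<in> cube m y e'"
            by (auto simp: cube_iff snd_coords_def in_topspace_Euclidean)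
          ultimately show "z \<in> Q" using zt e e' by (auto simp: Q_def)
        qed
        moreover have "\<alpha> i \<le> \<beta> i" for i using e(1) e'(1) by (simp add: \<alpha>_def \<beta>_def concat_coords_def)
        ultimately obtain \<delta> t where \<delta>: "\<delta> > 0"
          and t: "t \<in> plots W2 (n + m) (obox (n + m) (\<lambda>i. \<alpha> i - \<delta>) (\<lambda>i. \<beta> i + \<delta>))"
            "\<And>z. z \<in> obox (n + m) (\<lambda>i. \<alpha> i - \<delta>) (\<lambda>i. \<beta> i + \<delta>) \<Longrightarrow> f (t z) = q z"
          using box_lift[OF hom sub q] by blast
        have cc: "concat_coords n u v \<in> obox (n + m) (\<lambda>i. \<alpha> i - \<delta>) (\<lambda>i. \<beta> i + \<delta>)"
          if u: "u \<in> U0" and v: "v \<in> T0" for u v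
          unfolding obox_def
        proof (intro CollectI conjI allI impI)
          show "concat_coords n u v \<in> Espace (n + m)"
            using u v by (auto simp: in_topspace_Euclidean concat_coords_def U0_def T0_def cube_iff)
          fix i assume "i < n + m"
          then have "i < n \<Longrightarrow> x i - e / 2 < u i \<and> u i < x i + e / 2"
            "\<not> i < n \<Longrightarrow> y (i - n) - e' / 2 < v (i - n) \<and> v (i - n) < y (i - n) + e' / 2"
            using u v by (simp_all add: U0_def T0_def obox_def)
          then show "\<alpha> i - \<delta> < concat_coords n u v i" "concat_coords n u v i < \<beta> i + \<delta>"
            using \<delta> by (cases "i < n"; simp add: \<alpha>_def \<beta>_def concat_coords_def)+
        qed
        have ut: "u \<in> Espace n" if "u \<in> U0" for u
          using that oU0 openin_subset by blast
        have vt: "v \<in> Espace m" if "v \<in> T0" for v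
          using that oT0 openin_subset by blast
        have tp: "(\<lambda>z. t (concat_coords n (b z) (a z))) \<in> plots W2 k S"
          if a: "a \<in> euclidean_plots m T0 k S" and b: "b \<in> euclidean_plots n U0 k S" for k S a b
        proof -
          have "concat_coords n (b z) (a z) \<in> obox (n + m) (\<lambda>i. \<alpha> i - \<delta>) (\<lambda>i. \<beta> i + \<delta>)" if "z \<in> S" for z
            using cc a b that by (auto simp: euclidean_plots_def Pi_iff)
          from diffeology_comp[OF W2.diffeo t(1) concat_coords_plot[OF b a openin_obox this]]
          show ?thesis by (simp add: o_def)
        qed
        \<comment> \<open>Fixing y turns the joint lift into a function of u alone; that the lift is
          smooth in both variables is exactly the condition for R to be a plot of F.\<close>
        define R where "R v = (\<lambda>u\<in>U0. t (concat_coords n u v))" for v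
        have Rp: "(\<lambda>z. R (a z) (b z)) \<in> plots W2 k S"
          if a: "a \<in> euclidean_plots m T0 k S" and b: "b \<in> euclidean_plots n U0 k S" for k S a b
          by (rule diffeology_cong[OF W2.diffeo tp[OF a b]])
            (use b in \<open>auto simp: R_def euclidean_plots_def Pi_iff\<close>)
        have RF: "R v \<in> carrier F" if v: "v \<in> T0" for v
          unfolding F_def smooth_fun_carrier_iff
        proof (intro conjI allI ballI)
          show "R v \<in> extensional U0" by (simp add: R_def)
          show "R v \<in> U0 \<rightarrow> carrier W2"
            using W2.plot_closed[OF t(1) cc] v by (auto simp: R_def)
          fix k S b assume b: "b \<in> euclidean_plots n U0 k S"
          then have "eopen k S" by (simp add: euclidean_plots_def)
          from diffeology_const[OF diffeology_euclidean_plots[OF oT0] v this]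
          show "(\<lambda>z. R v (b z)) \<in> plots W2 k S" by (rule Rp[OF _ b])
        qed
        have Rq: "f (R v u) = p u (r v)" if "u \<in> U0" "v \<in> T0" for u v
          using that t(2)[OF cc] by (simp add: R_def q_def coords_concat ut vt)
        have "R \<in> plots F m T0"
          unfolding F_def smooth_fun_plots_iff using Rp RF oT0 by (auto simp: F_def)
        moreover have "r \<in> plots P m T0" by (rule diffeology_restrict[OF P.diffeo r oT0 T0T])
        moreover have "(\<lambda>v. (R v, r v)) \<in> T0 \<rightarrow> A"
          using RF Rq P.plot_closed[OF r] T0T by (auto simp: A_def)
        ultimately have "(\<lambda>v. (R v, r v)) \<in> plots X m T0"
          by (simp add: X_simps sub_plots_def prod_plots_def o_def)
        then show "\<exists>U'. eopen m U' \<and> y \<in> U' \<and> U' \<subseteq> T \<and>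
            (\<exists>p\<in>plots X m U'. \<forall>y\<in>U'. snd (p y) = r y)"
          using oT0 yT0 T0T by (intro exI[of _ T0] conjI bexI[of _ "\<lambda>v. (R v, r v)"]) auto
      qed
    qed
    \<comment> \<open>Projectivity applied to the identity of P yields a smooth linear section of X
      \<rightarrow> P. As the test space X lives in a type outside the definition of
      \<open>projective\<close>, \<open>projective_lift\<close> is required.\<close>
    from projective_lift[OF P hsnd this DVect_hom_id[OF dP]]
    obtain h where h: "DVect_hom P X h" "\<And>v. v \<in> carrier P \<Longrightarrow> v = snd (h v)" by blast
    have hA: "h v \<in> A" if "v \<in> carrier P" for v
      using DVect_homD(3)[OF h(1)] that by (auto simp: X_simps)
    define p' where "p' u = (\<lambda>v\<in>carrier P. fst (h v) u)" for u
    have p'p: "(\<lambda>z. p' (a z) (b z)) \<in> plots W2 k S"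
      if a: "a \<in> euclidean_plots n U0 k S" and b: "b \<in> plots P k S" for k S a b
    proof -
      have oS: "eopen k S" using a by (simp add: euclidean_plots_def)
      have "(\<lambda>z. fst (h (b z))) \<in> plots F k S"
        using DVect_homD(6)[OF h(1) b] by (simp add: X_simps sub_plots_def prod_plots_def o_def)
      then have "(\<lambda>z. fst (h (b (c z))) (a z)) \<in> plots W2 k S" if "c \<in> euclidean_plots k S k S" for c
        using a that by (auto simp: F_def smooth_fun_plots_iff)
      \<comment> \<open>Taking c to be the identity evaluates the function attached to b z at the
        point a z with the same parameter z.\<close>
      from this[OF euclidean_plots_id[OF oS oS subset_refl]] show ?thesis
        by (rule diffeology_cong[OF W2.diffeo]) (use P.plot_closed[OF b] in \<open>simp add: p'_def\<close>)
    qed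
    have p'L: "p' u \<in> carrier (Linf P W2)" if u: "u \<in> U0" for u
      unfolding Linf_carrier_iff smooth_linear_def smooth_map_def
    proof (intro conjI ballI allI)
      show "p' u \<in> extensional (carrier P)" by (simp add: p'_def)
      show "p' u \<in> carrier P \<rightarrow> carrier W2" using hA Finto u by (force simp: p'_def A_def)
      fix v assume v: "v \<in> carrier P"
      show "p' u (v \<oplus>\<^bsub>P\<^esub> w) = p' u v \<oplus>\<^bsub>W2\<^esub> p' u w" if "w \<in> carrier P" for w
        using v that u by (simp add: p'_def DVect_homD(4)[OF h(1)] X_simps) (simp add: F_def smooth_fun_simps)
      show "p' u (r \<odot>\<^bsub>P\<^esub> v) = r \<odot>\<^bsub>W2\<^esub> p' u v" for r
        using v u by (simp add: p'_def DVect_homD(5)[OF h(1)] X_simps) (simp add: F_def smooth_fun_simps)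
    next
      fix k S b assume b: "b \<in> plots P k S"
      show "p' u \<circ> b \<in> plots W2 k S"
        using p'p[OF diffeology_const[OF EU0 u diffeology_open[OF P.diffeo b]] b] by (simp add: o_def)
    qed
    have "p' \<in> plots (Linf P W2) n U0"
      unfolding Linf_plots_iff using oU0 p'L p'p by auto
    moreover have "Linf_map P f (p' u) = p u" if u: "u \<in> U0" for u
    proof (rule Linf_eqI)
      show "p u \<in> carrier (Linf P W3)" using pL u U0U by blast
      show "Linf_map P f (p' u) \<in> carrier (Linf P W3)"
        using DVect_homD(3)[OF Linf_map_hom[OF dP hom]] p'L[OF u] by auto
      fix v assume v: "v \<in> carrier P"
      then have "f (fst (h v) u) = p u (snd (h v))" using hA[OF v] u by (auto simp: A_def case_prod_unfold)
      then show "Linf_map P f (p' u) v = p u v" using v h(2)[OF v] by (simp add: Linf_map_apply p'_def)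
    qed
    ultimately show "\<exists>U'. eopen n U' \<and> x \<in> U' \<and> U' \<subseteq> U \<and>
        (\<exists>p'\<in>plots (Linf P W2) n U'. \<forall>y\<in>U'. Linf_map P f (p' y) = p y)"
      using oU0 xU0 U0U by blast
  qed
qed

lemma plot_local:
  assumes D: "diffeology X D"
    and "\<And>x. x \<in> U \<Longrightarrow> \<exists>U'. eopen n U' \<and> x \<in> U' \<and> U' \<subseteq> U \<and> p \<in> D n U'"
  shows "p \<in> D n U"
proof -
  let ?\<U> = "{U'. eopen n U' \<and> U' \<subseteq> U \<and> p \<in> D n U'}"
  have "\<Union>?\<U> = U" using assms(2) by blast
  moreover have "p \<in> D n (\<Union>?\<U>)" by (rule diffeology_glue[OF D]) blast
  ultimately show ?thesis by simp
qed

section \<open>Quotients\<close>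

lemma locally_liftsI:
  assumes "eopen n U" "p \<in> D n U" "\<And>x. x \<in> U \<Longrightarrow> f (p x) = q x"
  shows "locally_lifts D f n U q"
  unfolding locally_lifts_def using assms by (intro ballI exI[of _ U] conjI bexI[of _ p]) auto

lemma locally_liftsE:
  assumes "locally_lifts D f n U q" and "x \<in> U"
  obtains U' p where "eopen n U'" "x \<in> U'" "U' \<subseteq> U" "p \<in> D n U'"
    "\<And>y. y \<in> U' \<Longrightarrow> f (p y) = q y"
  using assms(1)[unfolded locally_lifts_def, rule_format, OF assms(2)]
  by (elim exE conjE bexE) (rule that, assumption+, erule (1) bspec)

lemma diffeology_quot_plots:
  assumes D: "diffeology X D" and f: "f ` X = Y"
  shows "diffeology Y (quot_plots D f)"
  unfolding diffeology_def
proof (intro conjI allI ballI impI)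
  fix n U q assume "q \<in> quot_plots D f n U"
  then have q: "eopen n U" "locally_lifts D f n U q" by (auto simp: quot_plots_def)
  show "eopen n U" by (rule q)
  show "q \<in> U \<rightarrow> Y"
  proof
    fix x assume x: "x \<in> U"
    obtain U' p where U': "eopen n U'" "x \<in> U'" "U' \<subseteq> U" "p \<in> D n U'"
      "\<And>y. y \<in> U' \<Longrightarrow> f (p y) = q y"
      by (rule locally_liftsE[OF q(2) x]) (rule that)
    then show "q x \<in> Y" using diffeology_into[OF D, of p n U'] f by (metis PiE imageI)
  qed
  show "q' \<in> quot_plots D f n U" if "\<forall>x\<in>U. q' x = q x" for q'
    unfolding quot_plots_def locally_lifts_def
  proof (intro CollectI conjI ballI q(1))
    fix x assume x: "x \<in> U"
    obtain U' p where U': "eopen n U'" "x \<in> U'" "U' \<subseteq> U" "p \<in> D n U'"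
      "\<And>y. y \<in> U' \<Longrightarrow> f (p y) = q y"
      by (rule locally_liftsE[OF q(2) x]) (rule that)
    then have "\<forall>y\<in>U'. f (p y) = q' y" using that by auto
    then show "\<exists>U'. eopen n U' \<and> x \<in> U' \<and> U' \<subseteq> U \<and>
        (\<exists>p\<in>D n U'. \<forall>y\<in>U'. f (p y) = q' y)"
      using U' by blast
  qed
  show "q \<circ> s \<in> quot_plots D f m T" if s: "s \<in> euclidean_plots n U m T" for m T s
    unfolding quot_plots_def locally_lifts_def
  proof (intro CollectI conjI ballI)
    show T: "eopen m T" using s by (simp add: euclidean_plots_def)
    fix x assume x: "x \<in> T"
    then have sx: "s x \<in> U" using s by (auto simp: euclidean_plots_def)
    obtain U' p where U': "eopen n U'" "s x \<in> U'" "U' \<subseteq> U" "p \<in> D n U'"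
      "\<And>y. y \<in> U' \<Longrightarrow> f (p y) = q y"
      by (rule locally_liftsE[OF q(2) sx]) (rule that)
    let ?T = "{z \<in> T. s z \<in> U'}"
    have o: "eopen m ?T" by (rule openin_euclidean_plots_preimage[OF s U'(1)])
    have "s \<in> euclidean_plots n U' m ?T" by (rule euclidean_plots_subset[OF s U'(1) _ _ o]) auto
    from diffeology_comp[OF D U'(4) this]
    show "\<exists>T'. eopen m T' \<and> x \<in> T' \<and> T' \<subseteq> T \<and>
        (\<exists>p\<in>D m T'. \<forall>y\<in>T'. f (p y) = (q \<circ> s) y)"
      using o x U' by (intro exI[of _ ?T] conjI bexI[of _ "p \<circ> s"]) auto
  qed
next
  fix n U c assume c: "c \<in> Y" and U: "eopen n U"
  then obtain x where x: "x \<in> X" "f x = c" using f by auto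
  show "(\<lambda>_. c) \<in> quot_plots D f n U"
    unfolding quot_plots_def
    using U by (intro CollectI conjI locally_liftsI[where p = "\<lambda>_. x"] diffeology_const[OF D x(1) U] x(2))
next
  fix n \<U> q assume *: "\<forall>U\<in>\<U>. eopen n U \<and> q \<in> quot_plots D f n U"
  show "q \<in> quot_plots D f n (\<Union>\<U>)"
    unfolding quot_plots_def locally_lifts_def
  proof (intro CollectI conjI ballI)
    show "eopen n (\<Union>\<U>)" using * by blast
    fix x assume "x \<in> \<Union>\<U>"
    then obtain U where U: "x \<in> U" "U \<in> \<U>" by blast
    then have "locally_lifts D f n U q" using * by (simp add: quot_plots_def)
    from locally_liftsE[OF this U(1)]
    obtain U' p where "eopen n U'" "x \<in> U'" "U' \<subseteq> U" "p \<in> D n U'" "\<forall>y\<in>U'. f (p y) = q y"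
      by metis
    then show "\<exists>U'. eopen n U' \<and> x \<in> U' \<and> U' \<subseteq> \<Union>\<U> \<and> (\<exists>p\<in>D n U'. \<forall>y\<in>U'. f (p y) = q y)"
      using U(2) by blast
  qed
qed

text \<open>Each axiom of W is the f-image of the same axiom of V, and plots of W are added and
  scaled through local lifts on a common neighbourhood. Quotients are the intended instance.\<close>

lemma dvs_image:
  fixes V :: "'a dvs" and W :: "'b dvs"
  assumes V: "dvs V"
    and carrier: "f ` carrier V = carrier W" and zero: "f \<zero>\<^bsub>V\<^esub> = \<zero>\<^bsub>W\<^esub>"
    and add: "\<And>x y. x \<in> carrier V \<Longrightarrow> y \<in> carrier V \<Longrightarrow> f (x \<oplus>\<^bsub>V\<^esub> y) = f x \<oplus>\<^bsub>W\<^esub> f y"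
    and smult: "\<And>r x. x \<in> carrier V \<Longrightarrow> f (r \<odot>\<^bsub>V\<^esub> x) = r \<odot>\<^bsub>W\<^esub> f x"
    and plots: "plots W = quot_plots (plots V) f"
  shows "DVect_hom V W f" and "subduction V W f"
proof -
  interpret V: dvspace V using V by unfold_locales
  have D: "diffeology (carrier W) (plots W)"
    unfolding plots by (rule diffeology_quot_plots[OF V.diffeo carrier])
  have cl: "f x \<in> carrier W" if "x \<in> carrier V" for x using carrier that by blast
  have ex: "\<exists>x\<in>carrier V. w = f x" if "w \<in> carrier W" for w using carrier that by blast
  have lift: "locally_lifts (plots V) f n U q" if "q \<in> plots W n U" for q n U
    using that by (simp add: plots quot_plots_def)
  have "dvs W"
  proof (rule dvsI[OF _ _ _ _ _ _ _ _ _ _ _ D])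
    show "\<zero>\<^bsub>W\<^esub> \<in> carrier W" using cl[of "\<zero>\<^bsub>V\<^esub>"] zero by simp
    fix x assume "x \<in> carrier W"
    then obtain x' where x: "x' \<in> carrier V" "x = f x'" using ex by blast
    show "r \<odot>\<^bsub>W\<^esub> x \<in> carrier W" for r using cl x by (simp flip: smult)
    show "\<zero>\<^bsub>W\<^esub> \<oplus>\<^bsub>W\<^esub> x = x" "0 \<odot>\<^bsub>W\<^esub> x = \<zero>\<^bsub>W\<^esub>" "1 \<odot>\<^bsub>W\<^esub> x = x"
      using x by (simp_all flip: zero add smult)
    show "(r + s) \<odot>\<^bsub>W\<^esub> x = r \<odot>\<^bsub>W\<^esub> x \<oplus>\<^bsub>W\<^esub> s \<odot>\<^bsub>W\<^esub> x" "(r * s) \<odot>\<^bsub>W\<^esub> x = r \<odot>\<^bsub>W\<^esub> (s \<odot>\<^bsub>W\<^esub> x)" for r s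
      using x by (simp_all flip: add smult add: V.smult_l_distr V.smult_assoc1)
    fix y assume "y \<in> carrier W"
    then obtain y' where y: "y' \<in> carrier V" "y = f y'" using ex by blast
    show "x \<oplus>\<^bsub>W\<^esub> y \<in> carrier W" using x y cl by (simp flip: add)
    show "x \<oplus>\<^bsub>W\<^esub> y = y \<oplus>\<^bsub>W\<^esub> x" using x y V.a_comm[of x' y'] by (simp flip: add)
    show "r \<odot>\<^bsub>W\<^esub> (x \<oplus>\<^bsub>W\<^esub> y) = r \<odot>\<^bsub>W\<^esub> x \<oplus>\<^bsub>W\<^esub> r \<odot>\<^bsub>W\<^esub> y" for r
      using x y by (simp flip: add smult add: V.smult_r_distr)
    fix z assume "z \<in> carrier W"
    then obtain z' where z: "z' \<in> carrier V" "z = f z'" using ex by blast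
    show "x \<oplus>\<^bsub>W\<^esub> y \<oplus>\<^bsub>W\<^esub> z = x \<oplus>\<^bsub>W\<^esub> (y \<oplus>\<^bsub>W\<^esub> z)" using x y z by (simp flip: add add: V.a_assoc)
  next
    fix n U q assume q: "q \<in> plots W n U"
    have oU: "eopen n U" by (rule diffeology_open[OF D q])
    show "(\<lambda>x. p x \<oplus>\<^bsub>W\<^esub> q x) \<in> plots W n U" if p: "p \<in> plots W n U" for p
      unfolding plots quot_plots_def locally_lifts_def
    proof (intro CollectI conjI ballI oU)
      fix x assume x: "x \<in> U"
      obtain U1 p1 where 1: "eopen n U1" "x \<in> U1" "U1 \<subseteq> U" "p1 \<in> plots V n U1"
        "\<And>y. y \<in> U1 \<Longrightarrow> f (p1 y) = p y" by (rule locally_liftsE[OF lift[OF p] x]) (rule that)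
      obtain U2 p2 where 2: "eopen n U2" "x \<in> U2" "U2 \<subseteq> U" "p2 \<in> plots V n U2"
        "\<And>y. y \<in> U2 \<Longrightarrow> f (p2 y) = q y" by (rule locally_liftsE[OF lift[OF q] x]) (rule that)
      have o: "eopen n (U1 \<inter> U2)" using 1 2 by blast
      have r: "p1 \<in> plots V n (U1 \<inter> U2)" "p2 \<in> plots V n (U1 \<inter> U2)"
        using diffeology_restrict[OF V.diffeo 1(4) o] diffeology_restrict[OF V.diffeo 2(4) o] by auto
      show "\<exists>U'. eopen n U' \<and> x \<in> U' \<and> U' \<subseteq> U \<and>
          (\<exists>r\<in>plots V n U'. \<forall>y\<in>U'. f (r y) = p y \<oplus>\<^bsub>W\<^esub> q y)"
        using o 1 2 V.plot_closed[OF r(1)] V.plot_closed[OF r(2)]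
        by (intro exI[of _ "U1 \<inter> U2"] conjI bexI[OF _ V.add_plot[OF r]]) (auto simp: add)
    qed
    show "(\<lambda>x. r x \<odot>\<^bsub>W\<^esub> q x) \<in> plots W n U" if r: "r \<in> real_plots n U" for r
      unfolding plots quot_plots_def locally_lifts_def
    proof (intro CollectI conjI ballI oU)
      fix x assume x: "x \<in> U"
      obtain U2 p2 where 2: "eopen n U2" "x \<in> U2" "U2 \<subseteq> U" "p2 \<in> plots V n U2"
        "\<And>y. y \<in> U2 \<Longrightarrow> f (p2 y) = q y" by (rule locally_liftsE[OF lift[OF q] x]) (rule that)
      have r': "r \<in> real_plots n U2" using r 2 smooth_on_subset by (auto simp: real_plots_def)
      show "\<exists>U'. eopen n U' \<and> x \<in> U' \<and> U' \<subseteq> U \<and>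
          (\<exists>p\<in>plots V n U'. \<forall>y\<in>U'. f (p y) = r y \<odot>\<^bsub>W\<^esub> q y)"
        using 2 V.plot_closed[OF 2(4)]
        by (intro exI[of _ U2] conjI bexI[OF _ V.smult_plot[OF r' 2(4)]]) (auto simp: smult)
    qed
  qed
  moreover have "(\<lambda>x. f (p x)) \<in> plots W n U" if "p \<in> plots V n U" for p n U
    unfolding plots quot_plots_def
    using diffeology_open[OF V.diffeo that] by (intro CollectI conjI locally_liftsI[where p = p] that refl)
  ultimately show hom: "DVect_hom V W f"
    using V cl add smult by (auto simp: DVect_hom_def smooth_linear_def smooth_map_def o_def)
  show "subduction V W f"
    by (rule subductionI[OF hom]) (simp add: plots quot_plots_def)
qed

definition subspace_of :: "'a dvs \<Rightarrow> 'a set \<Rightarrow> bool" where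
  "subspace_of V K \<longleftrightarrow> K \<subseteq> carrier V \<and> \<zero>\<^bsub>V\<^esub> \<in> K \<and> (\<forall>x\<in>K. \<forall>y\<in>K. x \<oplus>\<^bsub>V\<^esub> y \<in> K) \<and>
    (\<forall>r. \<forall>x\<in>K. r \<odot>\<^bsub>V\<^esub> x \<in> K)"

lemma dvs_subspace: "dvs V \<Longrightarrow> subspace_of V K \<Longrightarrow> dvs (dvs_sub V K)"
  by (rule dvs_dvs_sub) (auto simp: subspace_of_def)

context dvspace
begin

text \<open>Subtraction goes through the scalar -1 because smooth linear maps are specified by
  addition and scalars; additive inverses never have to be transported.\<close>

abbreviation diff :: "'a \<Rightarrow> 'a \<Rightarrow> 'a" where
  "diff x y \<equiv> x \<oplus>\<^bsub>V\<^esub> (-1) \<odot>\<^bsub>V\<^esub> y"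

lemma diff_self: "x \<in> carrier V \<Longrightarrow> diff x x = \<zero>\<^bsub>V\<^esub>"
  using smult_l_distr[of 1 "-1" x] by simp

lemma diff_add: "x \<in> carrier V \<Longrightarrow> y \<in> carrier V \<Longrightarrow> diff x y \<oplus>\<^bsub>V\<^esub> y = x"
  using diff_self[of y] a_comm[of y "(-1) \<odot>\<^bsub>V\<^esub> y"] by (simp add: a_assoc)

lemma diff_eq_zero: "x \<in> carrier V \<Longrightarrow> y \<in> carrier V \<Longrightarrow> diff x y = \<zero>\<^bsub>V\<^esub> \<Longrightarrow> x = y"
  using diff_add[of x y] by simp

context
  fixes K assumes K: "subspace_of V K"
begin

lemma subspaceD:
  "x \<in> K \<Longrightarrow> x \<in> carrier V" "\<zero>\<^bsub>V\<^esub> \<in> K" "x \<in> K \<Longrightarrow> y \<in> K \<Longrightarrow> x \<oplus>\<^bsub>V\<^esub> y \<in> K" "x \<in> K \<Longrightarrow> r \<odot>\<^bsub>V\<^esub> x \<in> K"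
  using K by (auto simp: subspace_of_def)

lemma mem_coset: "y \<in> K +>\<^bsub>V\<^esub> x \<longleftrightarrow> (\<exists>k\<in>K. y = k \<oplus>\<^bsub>V\<^esub> x)"
  by (auto simp: a_r_coset_def')

lemma coset_shift:
  assumes k: "k \<in> K" and x: "x \<in> carrier V"
  shows "K +>\<^bsub>V\<^esub> (k \<oplus>\<^bsub>V\<^esub> x) = K +>\<^bsub>V\<^esub> x"
proof (intro Set.set_eqI iffI)
  fix y assume "y \<in> K +>\<^bsub>V\<^esub> (k \<oplus>\<^bsub>V\<^esub> x)"
  then obtain h where h: "h \<in> K" "y = h \<oplus>\<^bsub>V\<^esub> (k \<oplus>\<^bsub>V\<^esub> x)" unfolding mem_coset by blast
  then have "y = (h \<oplus>\<^bsub>V\<^esub> k) \<oplus>\<^bsub>V\<^esub> x" using k x subspaceD by (simp add: a_assoc)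
  then show "y \<in> K +>\<^bsub>V\<^esub> x" unfolding mem_coset using h k subspaceD by blast
next
  fix y assume "y \<in> K +>\<^bsub>V\<^esub> x"
  then obtain h where h: "h \<in> K" "y = h \<oplus>\<^bsub>V\<^esub> x" unfolding mem_coset by blast
  then have "y = diff h k \<oplus>\<^bsub>V\<^esub> (k \<oplus>\<^bsub>V\<^esub> x)"
    using k x subspaceD diff_add[of h k] a_assoc[of "diff h k" k x] by simp
  moreover have "diff h k \<in> K" using h k subspaceD by blast
  ultimately show "y \<in> K +>\<^bsub>V\<^esub> (k \<oplus>\<^bsub>V\<^esub> x)" unfolding mem_coset by blast
qed

lemma coset_eq_zero_iff: "x \<in> carrier V \<Longrightarrow> K +>\<^bsub>V\<^esub> x = K \<longleftrightarrow> x \<in> K"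
proof -
  have K0: "K +>\<^bsub>V\<^esub> \<zero>\<^bsub>V\<^esub> = K" using subspaceD by (force simp: mem_coset)
  show ?thesis if x: "x \<in> carrier V"
  proof
    assume "K +>\<^bsub>V\<^esub> x = K"
    moreover have "x \<in> K +>\<^bsub>V\<^esub> x" using x subspaceD(2) by (force simp: mem_coset)
    ultimately show "x \<in> K" by simp
  next
    assume "x \<in> K"
    then show "K +>\<^bsub>V\<^esub> x = K" using coset_shift[of x "\<zero>\<^bsub>V\<^esub>"] K0 subspaceD by simp
  qed
qed

text \<open>An instance of \<open>dvs_image\<close>. The content is that setwise addition and the
  union in the scalar multiplication of \<open>dvs_quot\<close> act through representatives: the
  cosets united there all coincide, and there is at least one.\<close>

lemma dvs_quot_hom:
  shows "DVect_hom V (dvs_quot V K) (\<lambda>x. K +>\<^bsub>V\<^esub> x)"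
    and "subduction V (dvs_quot V K) (\<lambda>x. K +>\<^bsub>V\<^esub> x)"
proof -
  have carrier: "(\<lambda>x. K +>\<^bsub>V\<^esub> x) ` carrier V = carrier (dvs_quot V K)"
    by (auto simp: dvs_quot_def A_RCOSETS_def')
  have zero: "K +>\<^bsub>V\<^esub> \<zero>\<^bsub>V\<^esub> = \<zero>\<^bsub>dvs_quot V K\<^esub>"
    using coset_eq_zero_iff[of "\<zero>\<^bsub>V\<^esub>"] subspaceD(2) by (simp add: dvs_quot_def)
  have add: "K +>\<^bsub>V\<^esub> (x \<oplus>\<^bsub>V\<^esub> y) = (K +>\<^bsub>V\<^esub> x) \<oplus>\<^bsub>dvs_quot V K\<^esub> (K +>\<^bsub>V\<^esub> y)"
    if x: "x \<in> carrier V" and y: "y \<in> carrier V" for x y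
  proof -
    have swap: "h \<oplus>\<^bsub>V\<^esub> x \<oplus>\<^bsub>V\<^esub> (k \<oplus>\<^bsub>V\<^esub> y) = h \<oplus>\<^bsub>V\<^esub> k \<oplus>\<^bsub>V\<^esub> (x \<oplus>\<^bsub>V\<^esub> y)" if "h \<in> K" "k \<in> K" for h k
      using that x y subspaceD(1) by (simp add: a_ac)
    have "z \<in> K +>\<^bsub>V\<^esub> (x \<oplus>\<^bsub>V\<^esub> y) \<longleftrightarrow> z \<in> set_add V (K +>\<^bsub>V\<^esub> x) (K +>\<^bsub>V\<^esub> y)" for z
    proof
      assume "z \<in> K +>\<^bsub>V\<^esub> (x \<oplus>\<^bsub>V\<^esub> y)"
      then obtain h where h: "h \<in> K" "z = h \<oplus>\<^bsub>V\<^esub> (x \<oplus>\<^bsub>V\<^esub> y)" unfolding mem_coset by blast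
      then have z: "z = (h \<oplus>\<^bsub>V\<^esub> x) \<oplus>\<^bsub>V\<^esub> (\<zero>\<^bsub>V\<^esub> \<oplus>\<^bsub>V\<^esub> y)" using swap[OF h(1) subspaceD(2)] subspaceD h by simp
      then show "z \<in> set_add V (K +>\<^bsub>V\<^esub> x) (K +>\<^bsub>V\<^esub> y)"
      proof -
        have "h \<oplus>\<^bsub>V\<^esub> x \<in> K +>\<^bsub>V\<^esub> x" "\<zero>\<^bsub>V\<^esub> \<oplus>\<^bsub>V\<^esub> y \<in> K +>\<^bsub>V\<^esub> y"
          using h(1) subspaceD(2) by (auto simp: mem_coset)
        then show ?thesis unfolding set_add_def' z by blast
      qed
    next
      assume "z \<in> set_add V (K +>\<^bsub>V\<^esub> x) (K +>\<^bsub>V\<^esub> y)"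
      then obtain h k where "h \<in> K" "k \<in> K" "z = (h \<oplus>\<^bsub>V\<^esub> x) \<oplus>\<^bsub>V\<^esub> (k \<oplus>\<^bsub>V\<^esub> y)"
        unfolding set_add_def' by (auto simp: mem_coset)
      then have "h \<oplus>\<^bsub>V\<^esub> k \<in> K" "z = h \<oplus>\<^bsub>V\<^esub> k \<oplus>\<^bsub>V\<^esub> (x \<oplus>\<^bsub>V\<^esub> y)" using swap subspaceD(3) by simp_all
      then show "z \<in> K +>\<^bsub>V\<^esub> (x \<oplus>\<^bsub>V\<^esub> y)" unfolding mem_coset by blast
    qed
    then show ?thesis by (auto simp: dvs_quot_def)
  qed
  have smult: "K +>\<^bsub>V\<^esub> (r \<odot>\<^bsub>V\<^esub> x) = r \<odot>\<^bsub>dvs_quot V K\<^esub> (K +>\<^bsub>V\<^esub> x)" if x: "x \<in> carrier V" for r x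
  proof -
    have "K +>\<^bsub>V\<^esub> (r \<odot>\<^bsub>V\<^esub> y) = K +>\<^bsub>V\<^esub> (r \<odot>\<^bsub>V\<^esub> x)" if y: "y \<in> K +>\<^bsub>V\<^esub> x" for y
    proof -
      obtain h where h: "h \<in> K" "y = h \<oplus>\<^bsub>V\<^esub> x" using y unfolding mem_coset by blast
      then have "r \<odot>\<^bsub>V\<^esub> y = r \<odot>\<^bsub>V\<^esub> h \<oplus>\<^bsub>V\<^esub> r \<odot>\<^bsub>V\<^esub> x" using x subspaceD(1) by (simp add: smult_r_distr)
      then show ?thesis using coset_shift[OF subspaceD(4)[OF h(1)]] x by simp
    qed
    moreover have "x \<in> K +>\<^bsub>V\<^esub> x" using x subspaceD(2) by (force simp: mem_coset)
    then have "K +>\<^bsub>V\<^esub> x \<noteq> {}" by blast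
    ultimately have "(\<Union>y\<in>K +>\<^bsub>V\<^esub> x. K +>\<^bsub>V\<^esub> (r \<odot>\<^bsub>V\<^esub> y)) = K +>\<^bsub>V\<^esub> (r \<odot>\<^bsub>V\<^esub> x)"
      by (intro SUP_eq_const)
    then show ?thesis by (simp add: dvs_quot_def)
  qed
  show "DVect_hom V (dvs_quot V K) (\<lambda>x. K +>\<^bsub>V\<^esub> x)" "subduction V (dvs_quot V K) (\<lambda>x. K +>\<^bsub>V\<^esub> x)"
    using dvs_image[OF dvs carrier zero add smult] by (simp_all add: dvs_quot_def)
qed

end

end

section \<open>Smooth linear relations\<close>

text \<open>Two values over one x differ by a value over 0, so \<open>zero\<close> gives uniqueness.
  Lifting constant plots on the one-point space gives existence. Smoothness is local, so smooth
  selections near each point suffice, and by uniqueness they agree with f.\<close>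

theorem DVect_hom_of_relation:
  assumes X: "dvs X" and Y: "dvs Y"
    and closed: "\<And>x y. R x y \<Longrightarrow> x \<in> carrier X \<and> y \<in> carrier Y"
    and add: "\<And>x y x' y'. R x y \<Longrightarrow> R x' y' \<Longrightarrow> R (x \<oplus>\<^bsub>X\<^esub> x') (y \<oplus>\<^bsub>Y\<^esub> y')"
    and smult: "\<And>r x y. R x y \<Longrightarrow> R (r \<odot>\<^bsub>X\<^esub> x) (r \<odot>\<^bsub>Y\<^esub> y)"
    and zero: "\<And>y. R \<zero>\<^bsub>X\<^esub> y \<Longrightarrow> y = \<zero>\<^bsub>Y\<^esub>"
    and lifts: "\<And>n U p x. p \<in> plots X n U \<Longrightarrow> x \<in> U \<Longrightarrow> \<exists>U'. eopen n U' \<and> x \<in> U' \<and> U' \<subseteq> U \<and> (\<exists>q\<in>plots Y n U'. \<forall>z\<in>U'. R (p z) (q z))"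
  obtains f where "DVect_hom X Y f" and "\<And>x y. x \<in> carrier X \<Longrightarrow> f x = y \<longleftrightarrow> R x y"
proof -
  interpret X: dvspace X using X by unfold_locales
  interpret Y: dvspace Y using Y by unfold_locales
  have single: "y = y'" if "R x y" "R x y'" for x y y'
  proof -
    have "R (X.diff x x) (Y.diff y y')" using that add smult by blast
    then have "Y.diff y y' = \<zero>\<^bsub>Y\<^esub>" using X.diff_self closed[OF that(1)] zero by simp
    then show ?thesis using Y.diff_eq_zero closed that by blast
  qed
  have total: "\<exists>y. R x y" if x: "x \<in> carrier X" for x
  proof -
    let ?U = "Espace 0"
    have o: "(\<lambda>_. 0) \<in> ?U" by (simp add: topspace_Euclidean_space)
    have "(\<lambda>_. x) \<in> plots X 0 ?U" by (rule diffeology_const[OF X.diffeo x]) simp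
    from lifts[OF this o] show ?thesis by blast
  qed
  define f where "f x = (THE y. R x y)" for x
  have fR: "R x (f x)" if "x \<in> carrier X" for x
    unfolding f_def using total[OF that] single by (blast intro: theI)
  have iff: "f x = y \<longleftrightarrow> R x y" if "x \<in> carrier X" for x y
    using fR[OF that] single by blast
  have "(\<lambda>x. f (p x)) \<in> plots Y n U" if p: "p \<in> plots X n U" for n U p
  proof (rule plot_local[OF Y.diffeo])
    fix x assume x: "x \<in> U"
    obtain U' q where q: "eopen n U'" "x \<in> U'" "U' \<subseteq> U" "q \<in> plots Y n U'"
      "\<forall>z\<in>U'. R (p z) (q z)" using lifts[OF p x] by blast
    have "(\<lambda>x. f (p x)) \<in> plots Y n U'"
      by (rule diffeology_cong[OF Y.diffeo q(4)]) (use iff X.plot_closed[OF p] q in blast)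
    then show "\<exists>U'. eopen n U' \<and> x \<in> U' \<and> U' \<subseteq> U \<and> (\<lambda>x. f (p x)) \<in> plots Y n U'"
      using q by blast
  qed
  moreover have "f (x \<oplus>\<^bsub>X\<^esub> y) = f x \<oplus>\<^bsub>Y\<^esub> f y" if "x \<in> carrier X" "y \<in> carrier X" for x y
    using iff[of "x \<oplus>\<^bsub>X\<^esub> y"] add fR that by simp
  moreover have "f (r \<odot>\<^bsub>X\<^esub> x) = r \<odot>\<^bsub>Y\<^esub> f x" if "x \<in> carrier X" for r x
    using iff[of "r \<odot>\<^bsub>X\<^esub> x"] smult fR that by simp
  ultimately have "DVect_hom X Y f"
    using X Y closed[OF fR] by (auto simp: DVect_hom_def smooth_linear_def smooth_map_def o_def)
  then show thesis using that iff by blast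
qed

lemma subductionD:
  assumes "subduction V W f"
  shows "f ` carrier V = carrier W" and "q \<in> plots W n U \<Longrightarrow> locally_lifts (plots V) f n U q"
  using assms by (auto simp: subduction_map_def)

text \<open>The universal property of subductions: plots of X' come locally from plots of X, and
  there F o q is the smooth map h.\<close>

lemma DVect_hom_factor:
  assumes q: "DVect_hom X X' q" "subduction X X' q" and h: "DVect_hom X Y h"
    and F: "\<And>x. x \<in> carrier X \<Longrightarrow> F (q x) = h x"
  shows "DVect_hom X' Y F"
proof -
  interpret X: dvspace X using DVect_homD(1)[OF q(1)] by unfold_locales
  interpret Y: dvspace Y using DVect_homD(2)[OF h] by unfold_locales
  have ex: "\<exists>x\<in>carrier X. x' = q x" if "x' \<in> carrier X'" for x'
    using subductionD(1)[OF q(2)] that by blast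
  have "F x' \<in> carrier Y" if "x' \<in> carrier X'" for x'
    using ex[OF that] F DVect_homD(3)[OF h] by auto
  moreover have "F (x \<oplus>\<^bsub>X'\<^esub> y) = F x \<oplus>\<^bsub>Y\<^esub> F y" if xy: "x \<in> carrier X'" "y \<in> carrier X'" for x y
  proof -
    obtain x0 y0 where "x0 \<in> carrier X" "x = q x0" "y0 \<in> carrier X" "y = q y0"
      using ex xy by blast
    then show ?thesis
      by (simp add: F DVect_homD(4)[OF h] flip: DVect_homD(4)[OF q(1)])
  qed
  moreover have "F (r \<odot>\<^bsub>X'\<^esub> x) = r \<odot>\<^bsub>Y\<^esub> F x" if x: "x \<in> carrier X'" for r x
  proof -
    obtain x0 where "x0 \<in> carrier X" "x = q x0" using ex x by blast
    then show ?thesis by (simp add: F DVect_homD(5)[OF h] flip: DVect_homD(5)[OF q(1)])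
  qed
  moreover have "(\<lambda>x. F (p x)) \<in> plots Y n U" if p: "p \<in> plots X' n U" for p n U
  proof (rule plot_local[OF Y.diffeo])
    fix x assume x: "x \<in> U"
    obtain U' p' where U': "eopen n U'" "x \<in> U'" "U' \<subseteq> U" "p' \<in> plots X n U'"
      "\<And>y. y \<in> U' \<Longrightarrow> q (p' y) = p y"
      by (rule locally_liftsE[OF subductionD(2)[OF q(2) p] x]) (rule that)
    have "(\<lambda>x. F (p x)) \<in> plots Y n U'"
      by (rule diffeology_cong[OF Y.diffeo DVect_homD(6)[OF h U'(4)]])
        (use U'(5) F X.plot_closed[OF U'(4)] in metis)
    then show "\<exists>U'. eopen n U' \<and> x \<in> U' \<and> U' \<subseteq> U \<and> (\<lambda>x. F (p x)) \<in> plots Y n U'"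
      using U' by blast
  qed
  ultimately show ?thesis
    using DVect_homD(2)[OF q(1)] Y.dvs by (auto simp: DVect_hom_def smooth_linear_def smooth_map_def o_def)
qed

section \<open>Subspaces, kernels and images\<close>

lemma DVect_hom_sub:
  assumes f: "DVect_hom V W f" and K: "subspace_of V K"
  shows "DVect_hom (dvs_sub V K) W f"
proof -
  have "x \<in> carrier V" if "x \<in> K" for x using K that by (auto simp: subspace_of_def)
  then have "smooth_linear (dvs_sub V K) W f"
    using DVect_homD(4-6)[OF f] funcset_mem[OF DVect_homD(3)[OF f]]
    by (simp add: smooth_linear_def smooth_map_def dvs_sub_def sub_plots_def o_def)
  then show ?thesis using dvs_subspace[OF DVect_homD(1)[OF f] K] DVect_homD(2)[OF f] by (simp add: DVect_hom_def)
qed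

lemma DVect_hom_into_sub:
  assumes f: "DVect_hom V W f" and K: "subspace_of W K" and im: "\<And>x. x \<in> carrier V \<Longrightarrow> f x \<in> K"
  shows "DVect_hom V (dvs_sub W K) f"
proof -
  interpret V: dvspace V using DVect_homD(1)[OF f] by unfold_locales
  have "f \<circ> p \<in> plots (dvs_sub W K) n U" if "p \<in> plots V n U" for p n U
    using DVect_homD(6)[OF f that] V.plot_closed[OF that] im by (auto simp: dvs_sub_def sub_plots_def o_def)
  then show ?thesis
    using f im dvs_subspace[OF DVect_homD(2)[OF f] K]
    by (auto simp: DVect_hom_def smooth_linear_def smooth_map_def) (auto simp: dvs_sub_def)
qed

lemma a_kernel_iff: "x \<in> a_kernel V W f \<longleftrightarrow> x \<in> carrier V \<and> f x = \<zero>\<^bsub>W\<^esub>"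
  by (auto simp: a_kernel_def')

lemma DVect_hom_diff:
  assumes f: "DVect_hom V W f" and "x \<in> carrier V" "y \<in> carrier V"
  shows "f (x \<oplus>\<^bsub>V\<^esub> (-1) \<odot>\<^bsub>V\<^esub> y) = f x \<oplus>\<^bsub>W\<^esub> (-1) \<odot>\<^bsub>W\<^esub> f y"
proof -
  interpret V: dvspace V using DVect_homD(1)[OF f] by unfold_locales
  show ?thesis using assms by (simp add: DVect_homD(4,5)[OF f])
qed

lemma subspace_a_kernel:
  assumes f: "DVect_hom V W f"
  shows "subspace_of V (a_kernel V W f)"
proof -
  interpret V: dvspace V using DVect_homD(1)[OF f] by unfold_locales
  interpret W: dvspace W using DVect_homD(2)[OF f] by unfold_locales
  show ?thesis
    using DVect_hom_zero[OF f] by (auto simp: subspace_of_def a_kernel_iff DVect_homD(4,5)[OF f])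
qed

lemma subspace_image:
  assumes f: "DVect_hom V W f"
  shows "subspace_of W (f ` carrier V)"
proof -
  interpret V: dvspace V using DVect_homD(1)[OF f] by unfold_locales
  have "\<exists>z\<in>carrier V. f x \<oplus>\<^bsub>W\<^esub> f y = f z" if "x \<in> carrier V" "y \<in> carrier V" for x y
    using that DVect_homD(4)[OF f that] by (intro bexI[of _ "x \<oplus>\<^bsub>V\<^esub> y"]) auto
  moreover have "\<exists>z\<in>carrier V. r \<odot>\<^bsub>W\<^esub> f x = f z" if "x \<in> carrier V" for x r
    using that DVect_homD(5)[OF f that] by (intro bexI[of _ "r \<odot>\<^bsub>V\<^esub> x"]) auto
  moreover have "\<zero>\<^bsub>W\<^esub> \<in> f ` carrier V" using DVect_hom_zero[OF f] by (metis V.zero_closed imageI)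
  moreover have "f ` carrier V \<subseteq> carrier W" using DVect_homD(3)[OF f] by auto
  ultimately show ?thesis by (simp add: subspace_of_def image_iff)
qed

section \<open>The connecting homomorphism\<close>

text \<open>\<open>A1 \<rightarrow> B1 \<rightarrow> C1\<close> and \<open>A2 \<rightarrow> B2\<close> are consecutive rows of a short exact sequence of cochain
  complexes with differentials \<open>a\<close> and \<open>b\<close>; ZC and ZA are the cocycles in C1 and A2. The
  quotient \<open>qC\<close> of ZC is left open, so that both the cohomology of the third complex and the space
  of maps which its cocycles in degree 0 are isomorphic to are instances.\<close>

theorem connecting_hom:
  fixes A1 :: "'a1 dvs" and B1 :: "'b1 dvs" and C1 :: "'c1 dvs" and A2 :: "'a2 dvs" and B2 :: "'b2 dvs"
    and XC :: "'xc dvs" and YA :: "'ya dvs"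
  assumes f1: "DVect_hom A1 B1 f1" and g1: "DVect_hom B1 C1 g1" and f2: "DVect_hom A2 B2 f2"
    and a: "DVect_hom A1 A2 a" and b: "DVect_hom B1 B2 b"
    and comm: "\<And>t. t \<in> carrier A1 \<Longrightarrow> b (f1 t) = f2 (a t)"
    and exact1: "f1 ` carrier A1 = a_kernel B1 C1 g1" and sub1: "subduction B1 C1 g1"
    and ind2: "induction_map (carrier A2) (plots A2) (plots B2) f2"
    and ZC: "ZC \<subseteq> carrier C1" "\<And>s. s \<in> carrier B1 \<Longrightarrow> g1 s \<in> ZC \<longleftrightarrow> b s \<in> f2 ` carrier A2"
    and ZA: "ZA \<subseteq> carrier A2" "\<And>y s. y \<in> carrier A2 \<Longrightarrow> s \<in> carrier B1 \<Longrightarrow> f2 y = b s \<Longrightarrow> y \<in> ZA"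
    and qC: "DVect_hom (dvs_sub C1 ZC) XC qC" "subduction (dvs_sub C1 ZC) XC qC"
    and kC: "\<And>z. z \<in> ZC \<Longrightarrow> qC z = \<zero>\<^bsub>XC\<^esub> \<Longrightarrow> \<exists>s\<in>carrier B1. b s = \<zero>\<^bsub>B2\<^esub> \<and> g1 s = z"
    and rA: "DVect_hom (dvs_sub A2 ZA) YA rA" "subduction (dvs_sub A2 ZA) YA rA"
    and kA: "\<And>y. y \<in> ZA \<Longrightarrow> rA y = \<zero>\<^bsub>YA\<^esub> \<longleftrightarrow> y \<in> a ` carrier A1"
  obtains \<delta> where "DVect_hom XC YA \<delta>"
    and "a_kernel XC YA \<delta> = (\<lambda>s. qC (g1 s)) ` {s \<in> carrier B1. b s = \<zero>\<^bsub>B2\<^esub>}"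
    and "\<delta> ` carrier XC = rA ` {y \<in> ZA. f2 y \<in> b ` carrier B1}"
proof -
  interpret A1: dvspace A1 using DVect_homD(1)[OF f1] by unfold_locales
  interpret B1: dvspace B1 using DVect_homD(1)[OF g1] by unfold_locales
  interpret C1: dvspace C1 using DVect_homD(2)[OF g1] by unfold_locales
  interpret A2: dvspace A2 using DVect_homD(1)[OF f2] by unfold_locales
  interpret B2: dvspace B2 using DVect_homD(2)[OF f2] by unfold_locales
  interpret XC: dvspace XC using DVect_homD(2)[OF qC(1)] by unfold_locales
  interpret YA: dvspace YA using DVect_homD(2)[OF rA(1)] by unfold_locales
  interpret SC: dvspace "dvs_sub C1 ZC" using DVect_homD(1)[OF qC(1)] by unfold_locales
  interpret SA: dvspace "dvs_sub A2 ZA" using DVect_homD(1)[OF rA(1)] by unfold_locales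
  have sub_simps: "carrier (dvs_sub V K) = K" "add (dvs_sub V K) = add V" "smult (dvs_sub V K) = smult V"
    "zero (dvs_sub V K) = zero V" for V :: "'x dvs" and K by (simp_all add: dvs_sub_def)
  note inj2 = ind2[unfolded induction_map_def, THEN conjunct1]
  have cl: "t \<in> carrier A1 \<Longrightarrow> f1 t \<in> carrier B1" "s \<in> carrier B1 \<Longrightarrow> g1 s \<in> carrier C1"
    "y \<in> carrier A2 \<Longrightarrow> f2 y \<in> carrier B2" "t \<in> carrier A1 \<Longrightarrow> a t \<in> carrier A2"
    "s \<in> carrier B1 \<Longrightarrow> b s \<in> carrier B2" for t s y
    using DVect_homD(3)[OF f1] DVect_homD(3)[OF g1] DVect_homD(3)[OF f2] DVect_homD(3)[OF a] DVect_homD(3)[OF b]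
    by auto
  have clq: "z \<in> ZC \<Longrightarrow> qC z \<in> carrier XC" "y \<in> ZA \<Longrightarrow> rA y \<in> carrier YA" for z y
    using DVect_homD(3)[OF qC(1)] DVect_homD(3)[OF rA(1)] by (auto simp: sub_simps)
  have ker1: "f1 t \<in> carrier B1 \<and> g1 (f1 t) = \<zero>\<^bsub>C1\<^esub>" if "t \<in> carrier A1" for t
  proof -
    have "f1 t \<in> a_kernel B1 C1 g1" using that by (simp flip: exact1)
    then show ?thesis by (simp add: a_kernel_iff)
  qed
  define R where "R \<zeta> \<eta> \<longleftrightarrow> (\<exists>s\<in>carrier B1. \<exists>y\<in>carrier A2. f2 y = b s \<and> \<zeta> = qC (g1 s) \<and> \<eta> = rA y)" for \<zeta> \<eta>
  have ZCI: "g1 s \<in> ZC" if "s \<in> carrier B1" "y \<in> carrier A2" "f2 y = b s" for s y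
    using ZC(2)[OF that(1)] that(2,3) by (metis imageI)
  have RI: "R (qC (g1 s)) (rA y)" if "s \<in> carrier B1" "y \<in> carrier A2" "f2 y = b s" for s y
    using that unfolding R_def by blast
  have RE: "\<exists>s y. s \<in> carrier B1 \<and> y \<in> carrier A2 \<and> y \<in> ZA \<and> g1 s \<in> ZC \<and> f2 y = b s \<and> \<zeta> = qC (g1 s) \<and> \<eta> = rA y"
    if "R \<zeta> \<eta>" for \<zeta> \<eta>
    using that ZA(2) ZCI unfolding R_def by metis
  obtain \<delta> where \<delta>: "DVect_hom XC YA \<delta>" "\<And>\<zeta> \<eta>. \<zeta> \<in> carrier XC \<Longrightarrow> \<delta> \<zeta> = \<eta> \<longleftrightarrow> R \<zeta> \<eta>"
  proof (rule DVect_hom_of_relation[OF XC.dvs YA.dvs, of R])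
    show "\<zeta> \<in> carrier XC \<and> \<eta> \<in> carrier YA" if "R \<zeta> \<eta>" for \<zeta> \<eta>
      using RE[OF that] clq by blast
    show "R (\<zeta> \<oplus>\<^bsub>XC\<^esub> \<zeta>') (\<eta> \<oplus>\<^bsub>YA\<^esub> \<eta>')" if R: "R \<zeta> \<eta>" "R \<zeta>' \<eta>'" for \<zeta> \<eta> \<zeta>' \<eta>'
    proof -
      obtain s y where 1: "s \<in> carrier B1" "y \<in> carrier A2" "y \<in> ZA" "g1 s \<in> ZC" "f2 y = b s" "\<zeta> = qC (g1 s)" "\<eta> = rA y"
        using RE[OF R(1)] by blast
      obtain s' y' where 2: "s' \<in> carrier B1" "y' \<in> carrier A2" "y' \<in> ZA" "g1 s' \<in> ZC" "f2 y' = b s'" "\<zeta>' = qC (g1 s')" "\<eta>' = rA y'"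
        using RE[OF R(2)] by blast
      have "R (qC (g1 (s \<oplus>\<^bsub>B1\<^esub> s'))) (rA (y \<oplus>\<^bsub>A2\<^esub> y'))"
        by (rule RI) (use 1 2 in \<open>simp_all add: DVect_homD(4)[OF f2] DVect_homD(4)[OF b]\<close>)
      then show ?thesis
        using 1 2 DVect_homD(4)[OF qC(1)] DVect_homD(4)[OF rA(1)] by (simp add: DVect_homD(4)[OF g1] sub_simps)
    qed
    show "R (r \<odot>\<^bsub>XC\<^esub> \<zeta>) (r \<odot>\<^bsub>YA\<^esub> \<eta>)" if R: "R \<zeta> \<eta>" for r \<zeta> \<eta>
    proof -
      obtain s y where 1: "s \<in> carrier B1" "y \<in> carrier A2" "y \<in> ZA" "g1 s \<in> ZC" "f2 y = b s" "\<zeta> = qC (g1 s)" "\<eta> = rA y"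
        using RE[OF R] by blast
      have "R (qC (g1 (r \<odot>\<^bsub>B1\<^esub> s))) (rA (r \<odot>\<^bsub>A2\<^esub> y))"
        by (rule RI) (use 1 in \<open>simp_all add: DVect_homD(5)[OF f2] DVect_homD(5)[OF b]\<close>)
      then show ?thesis
        using 1 DVect_homD(5)[OF qC(1)] DVect_homD(5)[OF rA(1)] by (simp add: DVect_homD(5)[OF g1] sub_simps)
    qed
    show "\<eta> = \<zero>\<^bsub>YA\<^esub>" if R: "R \<zero>\<^bsub>XC\<^esub> \<eta>" for \<eta>
    proof -
      obtain s y where 1: "s \<in> carrier B1" "y \<in> carrier A2" "y \<in> ZA" "g1 s \<in> ZC" "f2 y = b s" "\<zero>\<^bsub>XC\<^esub> = qC (g1 s)" "\<eta> = rA y"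
        using RE[OF R] by blast
      \<comment> \<open>Since g1 s represents 0, it also lifts to some s0 killed by b. Then s - s0
        comes from A1 and has the same image under b as s, which exhibits y as a coboundary.\<close>
      obtain s0 where s0: "s0 \<in> carrier B1" "b s0 = \<zero>\<^bsub>B2\<^esub>" "g1 s0 = g1 s" using kC[OF 1(4)] 1(6) by metis
      have "g1 (B1.diff s s0) = \<zero>\<^bsub>C1\<^esub>"
        using s0 1 cl by (simp add: DVect_hom_diff[OF g1] C1.diff_self)
      then have "B1.diff s s0 \<in> f1 ` carrier A1" unfolding exact1 using 1 s0 by (simp add: a_kernel_iff)
      then obtain t where t: "t \<in> carrier A1" "B1.diff s s0 = f1 t" by blast
      have "b (B1.diff s s0) = b s" using s0 1 cl by (simp add: DVect_hom_diff[OF b])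
      then have "f2 y = f2 (a t)" using t comm 1 by simp
      then have "y = a t" using inj2 1 t cl by (auto dest: inj_onD)
      then show ?thesis using kA[OF 1(3)] t 1 by blast
    qed
    fix n U p x assume p: "p \<in> plots XC n U" and x: "x \<in> U"
    obtain U1 z where 1: "eopen n U1" "x \<in> U1" "U1 \<subseteq> U" "z \<in> plots (dvs_sub C1 ZC) n U1"
      "\<And>u. u \<in> U1 \<Longrightarrow> qC (z u) = p u"
      by (rule locally_liftsE[OF subductionD(2)[OF qC(2) p] x]) (rule that)
    have z: "z \<in> plots C1 n U1" "\<And>u. u \<in> U1 \<Longrightarrow> z u \<in> ZC"
      using 1(4) by (auto simp: dvs_sub_def sub_plots_def)
    obtain U2 s where 2: "eopen n U2" "x \<in> U2" "U2 \<subseteq> U1" "s \<in> plots B1 n U2"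
      "\<And>u. u \<in> U2 \<Longrightarrow> g1 (s u) = z u"
      by (rule locally_liftsE[OF subductionD(2)[OF sub1 z(1)] 1(2)]) (rule that)
    have sB: "s u \<in> carrier B1" if "u \<in> U2" for u using B1.plot_closed[OF 2(4) that] .
    have "b (s u) \<in> f2 ` carrier A2" if "u \<in> U2" for u
      using ZC(2)[OF sB[OF that]] 2(3,5) z(2) that by auto
    then have "\<exists>y. \<forall>u\<in>U2. y u \<in> carrier A2 \<and> f2 (y u) = b (s u)"
      by (intro bchoice) (metis imageE)
    then obtain y where y: "\<And>u. u \<in> U2 \<Longrightarrow> y u \<in> carrier A2" "\<And>u. u \<in> U2 \<Longrightarrow> f2 (y u) = b (s u)" by blast
    \<comment> \<open>The pull-back y is chosen pointwise and is a plot nevertheless: f2 y = b s is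
      one, and f2 is an induction.\<close>
    have "f2 \<circ> y \<in> plots B2 n U2"
      by (rule diffeology_cong[OF B2.diffeo DVect_homD(6)[OF b 2(4)]]) (simp add: y)
    moreover have "y \<in> U2 \<rightarrow> carrier A2" using y by blast
    ultimately have "y \<in> plots A2 n U2" using ind2 unfolding induction_map_def by blast
    moreover have "y u \<in> ZA" if "u \<in> U2" for u using ZA(2) y sB that by blast
    ultimately have "y \<in> plots (dvs_sub A2 ZA) n U2" by (simp add: dvs_sub_def sub_plots_def)
    from DVect_homD(6)[OF rA(1) this] have "(\<lambda>u. rA (y u)) \<in> plots YA n U2" .
    moreover have "R (p u) (rA (y u))" if "u \<in> U2" for u
    proof -
      have "p u = qC (g1 (s u))" using 1(5)[of u] 2(3,5) that by auto
      then show ?thesis using RI[OF sB y] that by simp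
    qed
    ultimately show "\<exists>U'. eopen n U' \<and> x \<in> U' \<and> U' \<subseteq> U \<and>
        (\<exists>q\<in>plots YA n U'. \<forall>z\<in>U'. R (p z) (q z))"
      using 1 2 by (intro exI[of _ U2] conjI bexI[of _ "\<lambda>u. rA (y u)"]) auto
  qed (rule that)
  have \<delta>I: "\<delta> (qC (g1 s)) = rA y" "qC (g1 s) \<in> carrier XC"
    if "s \<in> carrier B1" "y \<in> carrier A2" "f2 y = b s" for s y
    using \<delta>(2) RI[OF that] clq(1)[OF ZCI[OF that]] by auto
  have \<delta>E: "\<exists>s y. s \<in> carrier B1 \<and> y \<in> carrier A2 \<and> y \<in> ZA \<and> f2 y = b s \<and> \<zeta> = qC (g1 s) \<and> \<delta> \<zeta> = rA y"
    if "\<zeta> \<in> carrier XC" for \<zeta>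
    using RE[of \<zeta> "\<delta> \<zeta>"] \<delta>(2)[OF that] by blast
  have rA0: "rA \<zero>\<^bsub>A2\<^esub> = \<zero>\<^bsub>YA\<^esub>" using DVect_hom_zero[OF rA(1)] by (simp add: sub_simps)
  have "a_kernel XC YA \<delta> = (\<lambda>s. qC (g1 s)) ` {s \<in> carrier B1. b s = \<zero>\<^bsub>B2\<^esub>}"
  proof (intro Set.set_eqI iffI)
    fix \<zeta> assume "\<zeta> \<in> a_kernel XC YA \<delta>"
    then have \<zeta>: "\<zeta> \<in> carrier XC" "\<delta> \<zeta> = \<zero>\<^bsub>YA\<^esub>" by (auto simp: a_kernel_iff)
    obtain s y where s: "s \<in> carrier B1" "y \<in> carrier A2" "y \<in> ZA" "f2 y = b s" "\<zeta> = qC (g1 s)" "\<delta> \<zeta> = rA y"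
      using \<delta>E[OF \<zeta>(1)] by blast
    then obtain t where t: "t \<in> carrier A1" "y = a t" using kA \<zeta>(2) by auto
    \<comment> \<open>Correcting s by f1 t makes it a cocycle and leaves g1 s unchanged.\<close>
    define s' where "s' = B1.diff s (f1 t)"
    have "b s' = \<zero>\<^bsub>B2\<^esub>"
      using s t cl by (simp add: s'_def DVect_hom_diff[OF b] comm B2.diff_self flip: s(4))
    moreover have "g1 s' = g1 s" using s t cl ker1[OF t(1)] by (simp add: s'_def DVect_hom_diff[OF g1])
    moreover have "s' \<in> carrier B1" using s t cl by (simp add: s'_def)
    ultimately show "\<zeta> \<in> (\<lambda>s. qC (g1 s)) ` {s \<in> carrier B1. b s = \<zero>\<^bsub>B2\<^esub>}"
      using s(5) by (intro image_eqI[of _ _ s']) auto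
  next
    fix \<zeta> assume "\<zeta> \<in> (\<lambda>s. qC (g1 s)) ` {s \<in> carrier B1. b s = \<zero>\<^bsub>B2\<^esub>}"
    then obtain s where s: "s \<in> carrier B1" "b s = \<zero>\<^bsub>B2\<^esub>" "\<zeta> = qC (g1 s)" by blast
    have "f2 \<zero>\<^bsub>A2\<^esub> = b s" using s DVect_hom_zero[OF f2] by simp
    from \<delta>I[OF s(1) _ this] show "\<zeta> \<in> a_kernel XC YA \<delta>" using s rA0 by (simp add: a_kernel_iff)
  qed
  moreover have "\<delta> ` carrier XC = rA ` {y \<in> ZA. f2 y \<in> b ` carrier B1}"
  proof (intro Set.set_eqI iffI)
    fix \<eta> assume "\<eta> \<in> \<delta> ` carrier XC"
    then obtain \<zeta> where "\<zeta> \<in> carrier XC" "\<eta> = \<delta> \<zeta>" by blast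
    then show "\<eta> \<in> rA ` {y \<in> ZA. f2 y \<in> b ` carrier B1}" using \<delta>E[of \<zeta>] by auto
  next
    fix \<eta> assume "\<eta> \<in> rA ` {y \<in> ZA. f2 y \<in> b ` carrier B1}"
    then obtain y s where "y \<in> ZA" "s \<in> carrier B1" "f2 y = b s" "\<eta> = rA y" by blast
    then show "\<eta> \<in> \<delta> ` carrier XC" using \<delta>I[of s y] ZA(1) by (metis image_eqI subsetD)
  qed
  ultimately show thesis using that \<delta>(1) by blast
qed

section \<open>Left exactness of the functor of smooth linear maps\<close>

context
  fixes W1 :: "'w1 dvs" and W2 :: "'w2 dvs" and W3 :: "'w3 dvs" and i \<pi> and V :: "'v dvs"
  assumes ex: "short_exact W1 W2 W3 i \<pi>" and V: "dvs V"
begin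

lemma short_exactD:
  "DVect_hom W1 W2 i" "DVect_hom W2 W3 \<pi>" "inj_on i (carrier W1)" "i ` carrier W1 = a_kernel W2 W3 \<pi>"
  "induction_map (carrier W1) (plots W1) (plots W2) i" "subduction W2 W3 \<pi>"
  using ex by (auto simp: short_exact_def)

lemma Linf_inj: "inj_on (Linf_map V i) (carrier (Linf V W1))"
proof (rule inj_onI)
  fix \<phi> \<psi> assume *: "\<phi> \<in> carrier (Linf V W1)" "\<psi> \<in> carrier (Linf V W1)" "Linf_map V i \<phi> = Linf_map V i \<psi>"
  show "\<phi> = \<psi>"
  proof (rule Linf_eqI[OF *(1,2)])
    fix x assume x: "x \<in> carrier V"
    have "i (\<phi> x) = i (\<psi> x)" using fun_cong[OF *(3), of x] x by (simp add: Linf_map_apply)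
    moreover have "\<phi> x \<in> carrier W1" "\<psi> x \<in> carrier W1"
      using * x by (auto simp: Linf_carrier_iff smooth_linear_def)
    ultimately show "\<phi> x = \<psi> x" using short_exactD(3) by (auto dest: inj_onD)
  qed
qed

text \<open>Plots of \<open>Linf\<close> are tested after evaluation on plots of V, and for
  evaluated families the claim is the induction property of i.\<close>

lemma Linf_induction:
  "induction_map (carrier (Linf V W1)) (plots (Linf V W1)) (plots (Linf V W2)) (Linf_map V i)"
proof -
  note hom = Linf_map_hom[OF V short_exactD(1)]
  interpret V: dvspace V using V by unfold_locales
  interpret W2: dvspace W2 using DVect_homD(2)[OF short_exactD(1)] by unfold_locales
  have "q \<in> plots (Linf V W1) n U"
    if q: "q \<in> U \<rightarrow> carrier (Linf V W1)" and iq: "Linf_map V i \<circ> q \<in> plots (Linf V W2) n U" for q n U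
    unfolding Linf_plots_iff
  proof (intro conjI allI ballI q)
    show "eopen n U" using iq by (simp add: Linf_plots_iff)
    fix m S a b assume a: "a \<in> euclidean_plots n U m S" and b: "b \<in> plots V m S"
    have bV: "b z \<in> carrier V" if "z \<in> S" for z using V.plot_closed[OF b that] .
    have "(\<lambda>z. (Linf_map V i \<circ> q) (a z) (b z)) \<in> plots W2 m S"
      using iq a b unfolding Linf_plots_iff by blast
    then have "i \<circ> (\<lambda>z. q (a z) (b z)) \<in> plots W2 m S"
      by (rule diffeology_cong[OF W2.diffeo]) (simp add: Linf_map_apply bV)
    moreover have "(\<lambda>z. q (a z) (b z)) \<in> S \<rightarrow> carrier W1"
    proof
      fix z assume z: "z \<in> S"
      then have "a z \<in> U" using a by (auto simp: euclidean_plots_def)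
      then have "q (a z) \<in> carrier (Linf V W1)" using q by blast
      then show "q (a z) (b z) \<in> carrier W1" using bV[OF z] by (auto simp: Linf_carrier_iff smooth_linear_def)
    qed
    ultimately show "(\<lambda>z. q (a z) (b z)) \<in> plots W1 m S"
      using short_exactD(5) unfolding induction_map_def by blast
  qed
  then show ?thesis
    unfolding induction_map_def using Linf_inj DVect_homD(6)[OF hom] by (auto simp: o_def)
qed

text \<open>A map killed by \<pi> factors pointwise through i. The factor is linear because i is
  injective and smooth because i is an induction.\<close>

lemma Linf_exact:
  "exact_at (Linf V W1) (Linf V W2) (Linf V W3) (Linf_map V i) (Linf_map V \<pi>)"
  unfolding exact_at_def
proof (intro Set.set_eqI iffI)
  note hi = short_exactD(1) and hp = short_exactD(2)
  note d = DVect_homD(1,2)[OF hi] DVect_homD(2)[OF hp]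
  interpret V: dvspace V using V by unfold_locales
  interpret W1: dvspace W1 using d by unfold_locales
  interpret W2: dvspace W2 using d by unfold_locales
  have ker: "w \<in> carrier W2 \<and> \<pi> w = \<zero>\<^bsub>W3\<^esub> \<longleftrightarrow> w \<in> i ` carrier W1" for w
    unfolding short_exactD(4) by (simp add: a_kernel_iff)
  have zero: "\<zero>\<^bsub>Linf V W3\<^esub> = (\<lambda>x\<in>carrier V. \<zero>\<^bsub>W3\<^esub>)" by (simp add: Linf_simps)
  {
    fix \<phi> assume "\<phi> \<in> Linf_map V i ` carrier (Linf V W1)"
    then obtain \<psi> where \<psi>: "\<psi> \<in> carrier (Linf V W1)" "\<phi> = Linf_map V i \<psi>" by blast
    have \<phi>: "\<phi> \<in> carrier (Linf V W2)" using \<psi> DVect_homD(3)[OF Linf_map_hom[OF V hi]] by auto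
    have "Linf_map V \<pi> \<phi> = \<zero>\<^bsub>Linf V W3\<^esub>"
    proof (rule Linf_eqI)
      show "Linf_map V \<pi> \<phi> \<in> carrier (Linf V W3)" using \<phi> DVect_homD(3)[OF Linf_map_hom[OF V hp]] by auto
      interpret L3: dvspace "Linf V W3" using dvs_Linf[OF V d(3)] by unfold_locales
      show "\<zero>\<^bsub>Linf V W3\<^esub> \<in> carrier (Linf V W3)" by simp
      fix x assume x: "x \<in> carrier V"
      then have "\<psi> x \<in> carrier W1" using \<psi> by (auto simp: Linf_carrier_iff smooth_linear_def)
      then show "Linf_map V \<pi> \<phi> x = \<zero>\<^bsub>Linf V W3\<^esub> x"
        using x \<psi>(2) ker by (auto simp: Linf_map_apply zero)
    qed
    then show "\<phi> \<in> a_kernel (Linf V W2) (Linf V W3) (Linf_map V \<pi>)" using \<phi> by (simp add: a_kernel_iff)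
  }
  fix \<phi> assume "\<phi> \<in> a_kernel (Linf V W2) (Linf V W3) (Linf_map V \<pi>)"
  then have \<phi>: "\<phi> \<in> carrier (Linf V W2)" "Linf_map V \<pi> \<phi> = \<zero>\<^bsub>Linf V W3\<^esub>" by (auto simp: a_kernel_iff)
  note h\<phi> = Linf_hom[OF V d(2) \<phi>(1)]
  have "\<phi> x \<in> i ` carrier W1" if x: "x \<in> carrier V" for x
    using fun_cong[OF \<phi>(2), of x] x DVect_homD(3)[OF h\<phi>] by (auto simp: zero Linf_map_apply simp flip: ker)
  then have "\<exists>\<psi>. \<forall>x\<in>carrier V. \<psi> x \<in> carrier W1 \<and> i (\<psi> x) = \<phi> x" by (intro bchoice) (metis imageE)
  then obtain \<psi> where \<psi>: "\<And>x. x \<in> carrier V \<Longrightarrow> \<psi> x \<in> carrier W1" "\<And>x. x \<in> carrier V \<Longrightarrow> i (\<psi> x) = \<phi> x" by blast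
  have eqI: "u = v" if "u \<in> carrier W1" "v \<in> carrier W1" "i u = i v" for u v
    using short_exactD(3) that by (auto dest: inj_onD)
  have "\<psi> \<circ> p \<in> plots W1 n U" if p: "p \<in> plots V n U" for p n U
  proof -
    have "i \<circ> (\<psi> \<circ> p) \<in> plots W2 n U"
      by (rule diffeology_cong[OF W2.diffeo DVect_homD(6)[OF h\<phi> p]]) (simp add: \<psi> V.plot_closed[OF p])
    moreover have "\<psi> \<circ> p \<in> U \<rightarrow> carrier W1" using \<psi> V.plot_closed[OF p] by auto
    ultimately show ?thesis using short_exactD(5) unfolding induction_map_def by blast
  qed
  then have "DVect_hom V W1 \<psi>"
    using V d \<psi> by (auto simp: DVect_hom_def smooth_linear_def smooth_map_def DVect_homD(4,5)[OF hi]
        DVect_homD(4,5)[OF h\<phi>] intro!: eqI)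
  from restrict_in_Linf[OF this] have r: "restrict \<psi> (carrier V) \<in> carrier (Linf V W1)" .
  moreover have "\<phi> = Linf_map V i (restrict \<psi> (carrier V))"
    by (rule Linf_eqI[OF \<phi>(1)]) (use r DVect_homD(3)[OF Linf_map_hom[OF V hi]] \<psi> in \<open>auto simp: Linf_map_apply\<close>)
  ultimately show "\<phi> \<in> Linf_map V i ` carrier (Linf V W1)" by blast
qed

end

section \<open>The long exact sequence\<close>

lemma sub_simps [simp]:
  "carrier (dvs_sub V K) = K" "add (dvs_sub V K) = add V" "smult (dvs_sub V K) = smult V"
  "zero (dvs_sub V K) = zero V" "X +>\<^bsub>dvs_sub V K\<^esub> x = X +>\<^bsub>V\<^esub> x"
  by (simp_all add: dvs_sub_def a_r_coset_def')

text \<open>The degrees are shifted: \<open>e k\<close> is the differential from degree k + 1 to degree k, and \<open>H W k\<close>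
  is the cohomology in degree k + 1.\<close>

locale projective_complex =
  fixes Q :: "nat \<Rightarrow> 'p dvs" and e :: "nat \<Rightarrow> 'p \<Rightarrow> 'p"
  assumes proj: "\<And>k. projective (Q k)"
    and e: "\<And>k. DVect_hom (Q (Suc k)) (Q k) (e k)"
    and ee: "\<And>k x. x \<in> carrier (Q (Suc (Suc k))) \<Longrightarrow> e k (e (Suc k) x) = \<zero>\<^bsub>Q k\<^esub>"
begin

abbreviation L :: "'w dvs \<Rightarrow> nat \<Rightarrow> ('p \<Rightarrow> 'w) dvs" where
  "L W k \<equiv> Linf (Q k) W"

definition co :: "nat \<Rightarrow> ('p \<Rightarrow> 'w) \<Rightarrow> ('p \<Rightarrow> 'w)" where
  "co k \<phi> = compose (carrier (Q (Suc k))) \<phi> (e k)"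

definition Z :: "'w dvs \<Rightarrow> nat \<Rightarrow> ('p \<Rightarrow> 'w) set" where
  "Z W k = a_kernel (L W k) (L W (Suc k)) (co k)"

abbreviation ZL :: "'w dvs \<Rightarrow> nat \<Rightarrow> ('p \<Rightarrow> 'w) dvs" where
  "ZL W k \<equiv> dvs_sub (L W k) (Z W k)"

definition B :: "'w dvs \<Rightarrow> nat \<Rightarrow> ('p \<Rightarrow> 'w) set" where
  "B W k = co k ` carrier (L W k)"

definition H :: "'w dvs \<Rightarrow> nat \<Rightarrow> ('p \<Rightarrow> 'w) set dvs" where
  "H W k = dvs_quot (ZL W (Suc k)) (B W k)"

definition cls :: "'w dvs \<Rightarrow> nat \<Rightarrow> ('p \<Rightarrow> 'w) \<Rightarrow> ('p \<Rightarrow> 'w) set" where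
  "cls W k \<phi> = B W k +>\<^bsub>L W (Suc k)\<^esub> \<phi>"

definition H_map :: "'w' dvs \<Rightarrow> nat \<Rightarrow> ('w \<Rightarrow> 'w') \<Rightarrow> ('p \<Rightarrow> 'w) set \<Rightarrow> ('p \<Rightarrow> 'w') set" where
  "H_map W' k f X = (\<Union>\<phi>\<in>X. cls W' k (Linf_map (Q (Suc k)) f \<phi>))"

section \<open>Cohomology of the complex of smooth linear maps\<close>

lemma dvs_Q: "dvs (Q k)"
  using proj[of k] by (simp add: projective_def)

lemma co_hom: "dvs W \<Longrightarrow> DVect_hom (L W k) (L W (Suc k)) (co k)"
  using Linf_precompose_hom[OF e] by (simp add: co_def[abs_def])

lemma co_apply: "x \<in> carrier (Q (Suc k)) \<Longrightarrow> co k \<phi> x = \<phi> (e k x)"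
  by (simp add: co_def compose_def)

lemma e_closed: "x \<in> carrier (Q (Suc k)) \<Longrightarrow> e k x \<in> carrier (Q k)"
  using DVect_homD(3)[OF e] by auto

lemma Z_iff: "\<phi> \<in> Z W k \<longleftrightarrow> \<phi> \<in> carrier (L W k) \<and> co k \<phi> = \<zero>\<^bsub>L W (Suc k)\<^esub>"
  by (simp add: Z_def a_kernel_iff)

lemma co_natural: "co k (Linf_map (Q k) f \<phi>) = Linf_map (Q (Suc k)) f (co k \<phi>)"
  by (auto simp: co_def Linf_map_def compose_def fun_eq_iff e_closed)

context
  fixes W :: "'w dvs" assumes W: "dvs W"
begin

lemma co_in_Z:
  assumes \<phi>: "\<phi> \<in> carrier (L W k)"
  shows "co k \<phi> \<in> Z W (Suc k)"
proof -
  interpret L2: dvspace "L W (Suc (Suc k))" using dvs_Linf[OF dvs_Q W] by unfold_locales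
  have c: "co k \<phi> \<in> carrier (L W (Suc k))" using \<phi> DVect_homD(3)[OF co_hom[OF W]] by auto
  have "co (Suc k) (co k \<phi>) = \<zero>\<^bsub>L W (Suc (Suc k))\<^esub>"
  proof (rule Linf_eqI)
    show "co (Suc k) (co k \<phi>) \<in> carrier (L W (Suc (Suc k)))"
      using c DVect_homD(3)[OF co_hom[OF W]] by auto
    show "\<zero>\<^bsub>L W (Suc (Suc k))\<^esub> \<in> carrier (L W (Suc (Suc k)))" by simp
    show "co (Suc k) (co k \<phi>) x = \<zero>\<^bsub>L W (Suc (Suc k))\<^esub> x" if "x \<in> carrier (Q (Suc (Suc k)))" for x
      using that DVect_hom_zero[OF Linf_hom[OF dvs_Q W \<phi>]] by (simp add: co_apply e_closed ee Linf_simps)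
  qed
  then show ?thesis using c by (simp add: Z_iff)
qed

lemma Z_subspace: "subspace_of (L W k) (Z W k)"
  unfolding Z_def by (rule subspace_a_kernel[OF co_hom[OF W]])

lemma B_subspace: "subspace_of (ZL W (Suc k)) (B W k)"
  unfolding B_def
  by (rule subspace_image[OF DVect_hom_into_sub[OF co_hom[OF W] Z_subspace co_in_Z]])

lemma dvspace_Z: "dvspace (ZL W k)"
  by (rule dvspace.intro[OF dvs_subspace[OF dvs_Linf[OF dvs_Q W] Z_subspace]])

lemma cls_hom: "DVect_hom (ZL W (Suc k)) (H W k) (cls W k)"
  and cls_subduction: "subduction (ZL W (Suc k)) (H W k) (cls W k)"
  using dvspace.dvs_quot_hom[OF dvspace_Z B_subspace] by (simp_all add: H_def cls_def[abs_def])

lemma cls_eq_zero: "\<phi> \<in> Z W (Suc k) \<Longrightarrow> cls W k \<phi> = \<zero>\<^bsub>H W k\<^esub> \<longleftrightarrow> \<phi> \<in> B W k"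
  using dvspace.coset_eq_zero_iff[OF dvspace_Z B_subspace, of \<phi> k] by (simp add: H_def cls_def dvs_quot_def)

lemma H_carrier: "carrier (H W k) = cls W k ` Z W (Suc k)"
  using subductionD(1)[OF cls_subduction] by simp

end

section \<open>Functoriality in the coefficients\<close>

context
  fixes W :: "'w dvs" and W' :: "'w' dvs" and f assumes f: "DVect_hom W W' f"
begin

lemma Linf_map_Z:
  assumes "\<phi> \<in> Z W k"
  shows "Linf_map (Q k) f \<phi> \<in> Z W' k"
proof -
  note h = Linf_map_hom[OF dvs_Q f]
  have "co k (Linf_map (Q k) f \<phi>) = \<zero>\<^bsub>L W' (Suc k)\<^esub>"
    unfolding co_natural using assms DVect_hom_zero[OF h] by (simp add: Z_iff)
  then show ?thesis using assms DVect_homD(3)[OF h] by (auto simp: Z_iff)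
qed

lemma Linf_map_B:
  assumes "\<phi> \<in> B W k"
  shows "Linf_map (Q (Suc k)) f \<phi> \<in> B W' k"
  using assms funcset_mem[OF DVect_homD(3)[OF Linf_map_hom[OF dvs_Q f]]]
  by (auto simp: B_def co_natural[symmetric])

lemma Linf_map_Z_hom:
  "DVect_hom (ZL W k) (ZL W' k) (Linf_map (Q k) f)"
  using DVect_homD(1,2)[OF f] Linf_map_Z
  by (intro DVect_hom_into_sub DVect_hom_sub Linf_map_hom dvs_Q f Z_subspace) auto

text \<open>The union in \<open>H_map\<close> runs over all representatives. They differ by
  coboundaries, which the homomorphism G kills, so a nonempty family of equal cosets is
  united.\<close>

lemma H_map_cls:
  assumes \<phi>: "\<phi> \<in> Z W (Suc k)"
  shows "H_map W' k f (cls W k \<phi>) = cls W' k (Linf_map (Q (Suc k)) f \<phi>)"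
proof -
  note d = DVect_homD(1,2)[OF f]
  define G where "G \<psi> = cls W' k (Linf_map (Q (Suc k)) f \<psi>)" for \<psi>
  have G: "DVect_hom (ZL W (Suc k)) (H W' k) G"
    unfolding G_def by (rule DVect_hom_comp[OF Linf_map_Z_hom cls_hom[OF d(2)]])
  interpret S: dvspace "ZL W (Suc k)" by (rule dvspace_Z[OF d(1)])
  interpret H': dvspace "H W' k" using DVect_homD(2)[OF G] by unfold_locales
  have mem: "\<psi> \<in> cls W k \<phi> \<longleftrightarrow> (\<exists>h\<in>B W k. \<psi> = h \<oplus>\<^bsub>L W (Suc k)\<^esub> \<phi>)" for \<psi>
    using S.mem_coset[OF B_subspace[OF d(1)]] by (simp add: cls_def)
  have "G \<psi> = G \<phi>" if "\<psi> \<in> cls W k \<phi>" for \<psi>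
  proof -
    obtain h where h: "h \<in> B W k" "\<psi> = h \<oplus>\<^bsub>L W (Suc k)\<^esub> \<phi>" using \<open>\<psi> \<in> cls W k \<phi>\<close> mem by blast
    have hZ: "h \<in> Z W (Suc k)" using h(1) B_subspace[OF d(1), of k] by (auto simp: subspace_of_def)
    have "G h = \<zero>\<^bsub>H W' k\<^esub>"
      unfolding G_def using cls_eq_zero[OF d(2) Linf_map_Z[OF hZ]] Linf_map_B[OF h(1)] by simp
    moreover have "G \<phi> \<in> carrier (H W' k)" using funcset_mem[OF DVect_homD(3)[OF G], of \<phi>] \<phi> by simp
    ultimately show ?thesis using DVect_homD(4)[OF G, of h \<phi>] h(2) hZ \<phi> by simp
  qed
  moreover have "cls W k \<phi> \<noteq> {}"
  proof -
    have "\<zero>\<^bsub>L W (Suc k)\<^esub> \<in> B W k" using B_subspace[OF d(1), of k] by (simp add: subspace_of_def)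
    then have "\<zero>\<^bsub>L W (Suc k)\<^esub> \<oplus>\<^bsub>L W (Suc k)\<^esub> \<phi> \<in> cls W k \<phi>" unfolding mem by blast
    then show ?thesis by blast
  qed
  ultimately have "(\<Union>\<psi>\<in>cls W k \<phi>. G \<psi>) = G \<phi>" by (intro SUP_eq_const)
  then show ?thesis by (simp add: H_map_def G_def)
qed

lemma H_map_hom: "DVect_hom (H W k) (H W' k) (H_map W' k f)"
proof -
  note d = DVect_homD(1,2)[OF f]
  show ?thesis
    by (rule DVect_hom_factor[OF cls_hom[OF d(1)] cls_subduction[OF d(1)]
          DVect_hom_comp[OF Linf_map_Z_hom cls_hom[OF d(2)]]]) (simp add: H_map_cls)
qed

text \<open>Expressed through representatives, in the form in which \<open>connecting_hom\<close>
  describes the image of the connecting map.\<close>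

lemma H_map_kernel:
  "a_kernel (H W k) (H W' k) (H_map W' k f) =
    cls W k ` {\<phi> \<in> Z W (Suc k). Linf_map (Q (Suc k)) f \<phi> \<in> B W' k}"
  using H_carrier[OF DVect_homD(1)[OF f]] cls_eq_zero[OF DVect_homD(2)[OF f] Linf_map_Z]
  by (auto simp: a_kernel_iff H_map_cls)

end

section \<open>Exactness for a short exact sequence of coefficients\<close>

context
  fixes W1 :: "'w1 dvs" and W2 :: "'w2 dvs" and W3 :: "'w3 dvs" and i \<pi>
  assumes ex: "short_exact W1 W2 W3 i \<pi>"
begin

lemma homs: "DVect_hom W1 W2 i" "DVect_hom W2 W3 \<pi>" and dvss: "dvs W1" "dvs W2" "dvs W3"
  using ex by (auto simp: short_exact_def DVect_hom_def)

lemma row_exact: "Linf_map (Q k) i ` carrier (L W1 k) = a_kernel (L W2 k) (L W3 k) (Linf_map (Q k) \<pi>)"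
  using Linf_exact[OF ex dvs_Q] by (simp add: exact_at_def)

text \<open>The one place where the lifting property of the terms \<open>Q k\<close> enters the long
  exact sequence.\<close>

lemma row_subduction: "subduction (L W2 k) (L W3 k) (Linf_map (Q k) \<pi>)"
  using ex by (intro subduction_Linf_projective[OF proj]) (auto simp: short_exact_def)

text \<open>Composition with i commutes with the differential and is injective one degree higher, so
  \<open>co k y\<close> vanishes as soon as its image does.\<close>

lemma Z_reflect:
  assumes y: "y \<in> carrier (L W1 k)" and iy: "Linf_map (Q k) i y \<in> Z W2 k"
  shows "y \<in> Z W1 k"
proof -
  note h = Linf_map_hom[OF dvs_Q homs(1)]
  interpret L1: dvspace "L W1 (Suc k)" using dvs_Linf[OF dvs_Q dvss(1)] by unfold_locales
  have "Linf_map (Q (Suc k)) i (co k y) = Linf_map (Q (Suc k)) i \<zero>\<^bsub>L W1 (Suc k)\<^esub>"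
    using iy DVect_hom_zero[OF h] by (simp add: Z_iff co_natural)
  moreover have "co k y \<in> carrier (L W1 (Suc k))" using y DVect_homD(3)[OF co_hom[OF dvss(1)]] by auto
  ultimately have "co k y = \<zero>\<^bsub>L W1 (Suc k)\<^esub>" using Linf_inj[OF ex dvs_Q] by (auto dest: inj_onD)
  then show ?thesis using y by (simp add: Z_iff)
qed

text \<open>The quotient q of the cocycles is \<open>cls\<close> in positive degrees and
  \<open>desc\<close> in degree 0. Since \<open>H W1 k\<close> has cohomological degree k + 1, the
  map raises degree by one. The condition \<open>kC\<close> says that every cocycle with trivial
  class lifts to a cocycle.\<close>

lemma connecting:
  assumes qC: "DVect_hom (ZL W3 k) X q" "subduction (ZL W3 k) X q"
    and kC: "\<And>z. z \<in> Z W3 k \<Longrightarrow> q z = \<zero>\<^bsub>X\<^esub> \<Longrightarrow> \<exists>s\<in>Z W2 k. Linf_map (Q k) \<pi> s = z"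
  obtains \<delta> where "DVect_hom X (H W1 k) \<delta>"
    and "a_kernel X (H W1 k) \<delta> = (\<lambda>s. q (Linf_map (Q k) \<pi> s)) ` Z W2 k"
    and "exact_at X (H W1 k) (H W2 k) \<delta> (H_map W2 k i)"
proof (rule connecting_hom[OF Linf_map_hom[OF dvs_Q homs(1)] Linf_map_hom[OF dvs_Q homs(2)]
      Linf_map_hom[OF dvs_Q homs(1)] co_hom[OF dvss(1)] co_hom[OF dvss(2)] co_natural row_exact
      row_subduction Linf_induction[OF ex dvs_Q] _ _ _ _ qC _ cls_hom[OF dvss(1)] cls_subduction[OF dvss(1)]])
  show "Z W3 k \<subseteq> carrier (L W3 k)" "Z W1 (Suc k) \<subseteq> carrier (L W1 (Suc k))" by (auto simp: Z_iff)
  show "Linf_map (Q k) \<pi> s \<in> Z W3 k \<longleftrightarrow> co k s \<in> Linf_map (Q (Suc k)) i ` carrier (L W1 (Suc k))"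
    if s: "s \<in> carrier (L W2 k)" for s
    unfolding row_exact
    using s DVect_homD(3)[OF co_hom[OF dvss(2)]] DVect_homD(3)[OF Linf_map_hom[OF dvs_Q homs(2)]]
    by (auto simp: a_kernel_iff Z_iff co_natural)
  show "y \<in> Z W1 (Suc k)"
    if "y \<in> carrier (L W1 (Suc k))" "s \<in> carrier (L W2 k)" "Linf_map (Q (Suc k)) i y = co k s" for y s
    using that co_in_Z[OF dvss(2)] by (intro Z_reflect) auto
  show "\<exists>s\<in>carrier (L W2 k). co k s = \<zero>\<^bsub>L W2 (Suc k)\<^esub> \<and> Linf_map (Q k) \<pi> s = z"
    if "z \<in> Z W3 k" "q z = \<zero>\<^bsub>X\<^esub>" for z
    using kC[OF that] by (auto simp: Z_iff)
  show "cls W1 k y = \<zero>\<^bsub>H W1 k\<^esub> \<longleftrightarrow> y \<in> co k ` carrier (L W1 k)" if "y \<in> Z W1 (Suc k)" for y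
    using cls_eq_zero[OF dvss(1) that] by (simp add: B_def)
  fix \<delta> assume \<delta>: "DVect_hom X (H W1 k) \<delta>"
    "a_kernel X (H W1 k) \<delta> = (\<lambda>s. q (Linf_map (Q k) \<pi> s)) ` {s \<in> carrier (L W2 k). co k s = \<zero>\<^bsub>L W2 (Suc k)\<^esub>}"
    "\<delta> ` carrier X = cls W1 k ` {y \<in> Z W1 (Suc k). Linf_map (Q (Suc k)) i y \<in> co k ` carrier (L W2 k)}"
  have "{s \<in> carrier (L W2 k). co k s = \<zero>\<^bsub>L W2 (Suc k)\<^esub>} = Z W2 k" by (auto simp: Z_iff)
  then show thesis
    using that[OF \<delta>(1)] \<delta>(2,3) by (simp add: exact_at_def H_map_kernel[OF homs(1)] B_def)
qed

text \<open>If the image of a cocycle s is a coboundary co t, lift t to s' by surjectivity of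
  \<pi>_*. The cocycle s - co s' is in the class of s and is killed by \<pi>_*, so it comes from W1,
  and its preimage is a cocycle by \<open>Z_reflect\<close>.\<close>

lemma H_exact_middle: "exact_at (H W1 k) (H W2 k) (H W3 k) (H_map W2 k i) (H_map W3 k \<pi>)"
  unfolding exact_at_def
proof (intro Set.set_eqI iffI)
  let ?i = "\<lambda>k. Linf_map (Q k) i" and ?p = "\<lambda>k. Linf_map (Q k) \<pi>"
  note hi = Linf_map_hom[OF dvs_Q homs(1)] and hp = Linf_map_hom[OF dvs_Q homs(2)]
  interpret L2: dvspace "L W2 (Suc k)" using dvs_Linf[OF dvs_Q dvss(2)] by unfold_locales
  interpret L3: dvspace "L W3 (Suc k)" using dvs_Linf[OF dvs_Q dvss(3)] by unfold_locales
  interpret S: dvspace "ZL W2 (Suc k)" by (rule dvspace_Z[OF dvss(2)])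
  interpret H2: dvspace "H W2 k" using DVect_homD(2)[OF cls_hom[OF dvss(2)]] by unfold_locales
  {
    fix \<xi> assume "\<xi> \<in> H_map W2 k i ` carrier (H W1 k)"
    then obtain y where y: "y \<in> Z W1 (Suc k)" "\<xi> = cls W2 k (?i (Suc k) y)"
      by (auto simp: H_carrier[OF dvss(1)] H_map_cls[OF homs(1)])
    have "?i (Suc k) y \<in> a_kernel (L W2 (Suc k)) (L W3 (Suc k)) (?p (Suc k))"
      using y(1) by (simp add: Z_iff flip: row_exact)
    then have "?p (Suc k) (?i (Suc k) y) = \<zero>\<^bsub>L W3 (Suc k)\<^esub>" by (simp add: a_kernel_iff)
    moreover have "\<zero>\<^bsub>L W3 (Suc k)\<^esub> \<in> B W3 k" using B_subspace[OF dvss(3)] by (simp add: subspace_of_def)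
    ultimately show "\<xi> \<in> a_kernel (H W2 k) (H W3 k) (H_map W3 k \<pi>)"
      unfolding H_map_kernel[OF homs(2)] using y Linf_map_Z[OF homs(1) y(1)] by auto
  }
  fix \<xi> assume "\<xi> \<in> a_kernel (H W2 k) (H W3 k) (H_map W3 k \<pi>)"
  then obtain s where s: "s \<in> Z W2 (Suc k)" "?p (Suc k) s \<in> B W3 k" "\<xi> = cls W2 k s"
    unfolding H_map_kernel[OF homs(2)] by blast
  obtain t where t: "t \<in> carrier (L W3 k)" "?p (Suc k) s = co k t" using s(2) by (auto simp: B_def)
  obtain s' where s': "s' \<in> carrier (L W2 k)" "t = ?p k s'" using t(1) subductionD(1)[OF row_subduction] by blast
  have cs': "co k s' \<in> Z W2 (Suc k)" by (rule co_in_Z[OF dvss(2) s'(1)])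
  have c: "s \<in> carrier (L W2 (Suc k))" "co k s' \<in> carrier (L W2 (Suc k))" using s cs' by (auto simp: Z_iff)
  define u where "u = s \<oplus>\<^bsub>L W2 (Suc k)\<^esub> (-1) \<odot>\<^bsub>L W2 (Suc k)\<^esub> co k s'"
  have uZ: "u \<in> Z W2 (Suc k)" using S.a_closed S.smult_closed s(1) cs' by (simp add: u_def)
  have "?p (Suc k) (co k s') = ?p (Suc k) s" using t s' by (simp add: co_natural)
  moreover have "?p (Suc k) s \<in> carrier (L W3 (Suc k))" using c DVect_homD(3)[OF hp] by auto
  ultimately have "?p (Suc k) u = \<zero>\<^bsub>L W3 (Suc k)\<^esub>"
    using c by (simp add: u_def DVect_hom_diff[OF hp] L3.diff_self)
  then have "u \<in> ?i (Suc k) ` carrier (L W1 (Suc k))"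
    unfolding row_exact using uZ by (simp add: a_kernel_iff Z_iff)
  then obtain y where y: "y \<in> carrier (L W1 (Suc k))" "u = ?i (Suc k) y" by blast
  have yZ: "y \<in> Z W1 (Suc k)" using Z_reflect y uZ by simp
  have "cls W2 k (co k s') = \<zero>\<^bsub>H W2 k\<^esub>"
    using cls_eq_zero[OF dvss(2) cs'] s' by (simp add: B_def)
  moreover have "cls W2 k s \<in> carrier (H W2 k)" using s(1) by (simp add: H_carrier[OF dvss(2)])
  ultimately have "cls W2 k u = \<xi>"
    using DVect_hom_diff[OF cls_hom[OF dvss(2)], of s k "co k s'"] s cs' by (simp add: u_def)
  then show "\<xi> \<in> H_map W2 k i ` carrier (H W1 k)"
    using y yZ by (auto simp: H_carrier[OF dvss(1)] H_map_cls[OF homs(1)] intro!: image_eqI[of _ _ "cls W1 k y"])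
qed

lemma H_connecting:
  obtains \<delta> where "DVect_hom (H W3 k) (H W1 (Suc k)) \<delta>"
    and "exact_at (H W2 k) (H W3 k) (H W1 (Suc k)) (H_map W3 k \<pi>) \<delta>"
    and "exact_at (H W3 k) (H W1 (Suc k)) (H W2 (Suc k)) \<delta> (H_map W2 (Suc k) i)"
proof (rule connecting[OF cls_hom[OF dvss(3)] cls_subduction[OF dvss(3)]])
  \<comment> \<open>A coboundary lifts to a coboundary: z = co t, and if s lifts t then co s lifts
    z.\<close>
  fix z assume z: "z \<in> Z W3 (Suc k)" "cls W3 k z = \<zero>\<^bsub>H W3 k\<^esub>"
  then obtain t where t: "t \<in> carrier (L W3 k)" "z = co k t"
    using cls_eq_zero[OF dvss(3)] by (auto simp: B_def)
  obtain s where s: "s \<in> carrier (L W2 k)" "t = Linf_map (Q k) \<pi> s"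
    using t(1) subductionD(1)[OF row_subduction] by blast
  show "\<exists>s\<in>Z W2 (Suc k). Linf_map (Q (Suc k)) \<pi> s = z"
    using co_in_Z[OF dvss(2) s(1)] s t by (auto simp: co_natural)
next
  fix \<delta> assume \<delta>: "DVect_hom (H W3 k) (H W1 (Suc k)) \<delta>"
    "a_kernel (H W3 k) (H W1 (Suc k)) \<delta> = (\<lambda>s. cls W3 k (Linf_map (Q (Suc k)) \<pi> s)) ` Z W2 (Suc k)"
    "exact_at (H W3 k) (H W1 (Suc k)) (H W2 (Suc k)) \<delta> (H_map W2 (Suc k) i)"
  have "H_map W3 k \<pi> ` carrier (H W2 k) = (\<lambda>s. cls W3 k (Linf_map (Q (Suc k)) \<pi> s)) ` Z W2 (Suc k)"
    by (simp add: H_carrier[OF dvss(2)] image_image H_map_cls[OF homs(2)])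
  then show thesis using that \<delta> by (simp add: exact_at_def)
qed

end

end

subsection \<open>Degree zero\<close>

text \<open>The last two assumptions present V as the quotient of \<open>Q 0\<close> by the image of
  \<open>e 0\<close>, diffeology included. V keeps a type of its own.\<close>

locale augmented_projective_complex = projective_complex Q e
  for Q :: "nat \<Rightarrow> 'p dvs" and e +
  fixes V :: "'v dvs" and \<epsilon> :: "'p \<Rightarrow> 'v"
  assumes eps: "DVect_hom (Q 0) V \<epsilon>" and eps_sub: "subduction (Q 0) V \<epsilon>"
    and eps_ker: "a_kernel (Q 0) V \<epsilon> = e 0 ` carrier (Q (Suc 0))"
begin

lemma dvs_V: "dvs V"
  using DVect_homD(2)[OF eps] .

text \<open>The inverse of precomposition with \<epsilon>. The preimage is picked arbitrarily; on
  0-cocycles the choice is immaterial by \<open>desc_eps\<close>.\<close>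

definition desc :: "('p \<Rightarrow> 'w) \<Rightarrow> ('v \<Rightarrow> 'w)" where
  "desc \<phi> = (\<lambda>v\<in>carrier V. \<phi> (inv_into (carrier (Q 0)) \<epsilon> v))"

lemma eps_closed: "x \<in> carrier (Q 0) \<Longrightarrow> \<epsilon> x \<in> carrier V"
  using DVect_homD(3)[OF eps] by auto

section \<open>Cocycles of degree 0 as maps on V\<close>

context
  fixes W :: "'w dvs" assumes W: "dvs W"
begin

text \<open>Two preimages of a point differ by an element of the kernel of \<epsilon>, which is the
  image of \<open>e 0\<close>, and a 0-cocycle vanishes there.\<close>

lemma desc_eps:
  assumes \<phi>: "\<phi> \<in> Z W 0" and x: "x \<in> carrier (Q 0)"
  shows "desc \<phi> (\<epsilon> x) = \<phi> x"
proof -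
  interpret Q0: dvspace "Q 0" using dvs_Q by unfold_locales
  interpret V: dvspace V using dvs_V by unfold_locales
  interpret W: dvspace W using W by unfold_locales
  have \<phi>L: "\<phi> \<in> carrier (L W 0)" "co 0 \<phi> = \<zero>\<^bsub>L W (Suc 0)\<^esub>" using \<phi> by (auto simp: Z_iff)
  note h = Linf_hom[OF dvs_Q W \<phi>L(1)]
  define y where "y = inv_into (carrier (Q 0)) \<epsilon> (\<epsilon> x)"
  have y: "y \<in> carrier (Q 0)" "\<epsilon> y = \<epsilon> x"
    unfolding y_def using x by (auto intro: inv_into_into f_inv_into_f)
  have "\<epsilon> (Q0.diff y x) = \<zero>\<^bsub>V\<^esub>"
    using x y eps_closed[OF x] by (simp add: DVect_hom_diff[OF eps] V.diff_self)
  then have "Q0.diff y x \<in> e 0 ` carrier (Q (Suc 0))"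
    unfolding eps_ker[symmetric] using x y by (simp add: a_kernel_iff)
  then obtain t where t: "t \<in> carrier (Q (Suc 0))" "Q0.diff y x = e 0 t" by blast
  have "\<phi> (e 0 t) = \<zero>\<^bsub>W\<^esub>" using fun_cong[OF \<phi>L(2), of t] t(1) by (simp add: co_apply Linf_simps)
  then have "W.diff (\<phi> y) (\<phi> x) = \<zero>\<^bsub>W\<^esub>" using x y t DVect_hom_diff[OF h y(1) x] by simp
  then have "\<phi> y = \<phi> x" using W.diff_eq_zero DVect_homD(3)[OF h] x y by blast
  then show ?thesis using eps_closed[OF x] by (simp add: desc_def y_def)
qed

lemma desc_closed:
  assumes \<phi>: "\<phi> \<in> Z W 0"
  shows "desc \<phi> \<in> carrier (Linf V W)"
proof -
  have "\<phi> \<in> carrier (L W 0)" using \<phi> by (simp add: Z_iff)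
  from DVect_hom_factor[OF eps eps_sub Linf_hom[OF dvs_Q W this], of "desc \<phi>"] desc_eps[OF \<phi>]
  have "DVect_hom V W (desc \<phi>)" by simp
  moreover have "restrict (desc \<phi>) (carrier V) = desc \<phi>" by (auto simp: desc_def fun_eq_iff)
  ultimately show ?thesis using restrict_in_Linf[of V W "desc \<phi>"] by simp
qed

lemma desc_hom: "DVect_hom (ZL W 0) (Linf V W) desc"
proof -
  interpret V: dvspace V using dvs_V by unfold_locales
  interpret Q0: dvspace "Q 0" using dvs_Q by unfold_locales
  interpret W: dvspace W using W by unfold_locales
  have inv: "inv_into (carrier (Q 0)) \<epsilon> v \<in> carrier (Q 0)" if "v \<in> carrier V" for v
    using that subductionD(1)[OF eps_sub] by (auto intro: inv_into_into)
  have "(\<lambda>u. desc (p u)) \<in> plots (Linf V W) n U" if "p \<in> plots (ZL W 0) n U" for p n U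
  proof -
    have p: "p \<in> plots (L W 0) n U" "\<And>u. u \<in> U \<Longrightarrow> p u \<in> Z W 0"
      using that by (auto simp: dvs_sub_def sub_plots_def)
    show ?thesis
      unfolding Linf_plots_iff
    proof (intro conjI allI ballI)
      show "eopen n U" "(\<lambda>u. desc (p u)) \<in> U \<rightarrow> carrier (Linf V W)"
        using p desc_closed by (auto simp: Linf_plots_iff)
      fix m S a b assume a: "a \<in> euclidean_plots n U m S" and b: "b \<in> plots V m S"
      show "(\<lambda>z. desc (p (a z)) (b z)) \<in> plots W m S"
      \<comment> \<open>The preimages chosen in \<open>desc\<close> need not vary smoothly. Lifting
        b locally along \<epsilon> to a plot b' replaces them, with the same values by
        \<open>desc_eps\<close>.\<close>
      proof (rule plot_local[OF W.diffeo])
        fix x assume x: "x \<in> S"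
        obtain S' b' where S': "eopen m S'" "x \<in> S'" "S' \<subseteq> S" "b' \<in> plots (Q 0) m S'"
          "\<And>y. y \<in> S' \<Longrightarrow> \<epsilon> (b' y) = b y"
          by (rule locally_liftsE[OF subductionD(2)[OF eps_sub b] x]) (rule that)
        have oU: "eopen n U" using a by (simp add: euclidean_plots_def)
        have a': "a \<in> euclidean_plots n U m S'"
          by (rule diffeology_restrict[OF diffeology_euclidean_plots[OF oU] a S'(1,3)])
        have eq: "desc (p (a z)) (b z) = p (a z) (b' z)" if "z \<in> S'" for z
        proof -
          have "a z \<in> U" using a' that by (auto simp: euclidean_plots_def)
          from desc_eps[OF p(2)[OF this] Q0.plot_closed[OF S'(4) that]] show ?thesis
            by (simp add: S'(5)[OF that])
        qed
        have "(\<lambda>z. p (a z) (b' z)) \<in> plots W m S'" using p(1) a' S'(4) by (auto simp: Linf_plots_iff)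
        from diffeology_cong[OF W.diffeo this eq] have "(\<lambda>z. desc (p (a z)) (b z)) \<in> plots W m S'" .
        then show "\<exists>S'. eopen m S' \<and> x \<in> S' \<and> S' \<subseteq> S \<and>
            (\<lambda>z. desc (p (a z)) (b z)) \<in> plots W m S'" using S' by blast
      qed
    qed
  qed
  moreover have "desc (\<phi> \<oplus>\<^bsub>L W 0\<^esub> \<psi>) = desc \<phi> \<oplus>\<^bsub>Linf V W\<^esub> desc \<psi>" for \<phi> \<psi> :: "'p \<Rightarrow> 'w"
    by (auto simp: desc_def Linf_simps fun_eq_iff inv)
  moreover have "desc (r \<odot>\<^bsub>L W 0\<^esub> \<phi>) = r \<odot>\<^bsub>Linf V W\<^esub> desc \<phi>" for r and \<phi> :: "'p \<Rightarrow> 'w"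
    by (auto simp: desc_def Linf_simps fun_eq_iff inv)
  ultimately show ?thesis
    using desc_closed dvs_Linf[OF dvs_V W] dvspace.dvs[OF dvspace_Z[OF W]]
    by (auto simp: DVect_hom_def smooth_linear_def smooth_map_def o_def)
qed

text \<open>Precomposition with \<epsilon> is a globally smooth right inverse of
  \<open>desc\<close>; it provides the lifts that make \<open>desc\<close> a subduction.\<close>

lemma desc_section:
  assumes \<psi>: "\<psi> \<in> carrier (Linf V W)"
  shows "compose (carrier (Q 0)) \<psi> \<epsilon> \<in> Z W 0" and "desc (compose (carrier (Q 0)) \<psi> \<epsilon>) = \<psi>"
proof -
  interpret L1: dvspace "L W (Suc 0)" using dvs_Linf[OF dvs_Q W] by unfold_locales
  let ?\<phi> = "compose (carrier (Q 0)) \<psi> \<epsilon>"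
  have \<phi>: "?\<phi> \<in> carrier (L W 0)"
    using \<psi> DVect_homD(3)[OF Linf_precompose_hom[OF eps W]] by auto
  have "co 0 ?\<phi> = \<zero>\<^bsub>L W (Suc 0)\<^esub>"
  proof (rule Linf_eqI)
    show "co 0 ?\<phi> \<in> carrier (L W (Suc 0))" using \<phi> DVect_homD(3)[OF co_hom[OF W]] by auto
    show "\<zero>\<^bsub>L W (Suc 0)\<^esub> \<in> carrier (L W (Suc 0))" by simp
    fix x assume x: "x \<in> carrier (Q (Suc 0))"
    then have "e 0 x \<in> a_kernel (Q 0) V \<epsilon>" by (simp add: eps_ker)
    then show "co 0 ?\<phi> x = \<zero>\<^bsub>L W (Suc 0)\<^esub> x"
      using x DVect_hom_zero[OF Linf_hom[OF dvs_V W \<psi>]] by (simp add: a_kernel_iff co_apply compose_def Linf_simps)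
  qed
  then show Z: "?\<phi> \<in> Z W 0" using \<phi> by (simp add: Z_iff)
  show "desc ?\<phi> = \<psi>"
  proof (rule Linf_eqI[OF desc_closed[OF Z] \<psi>])
    fix v assume "v \<in> carrier V"
    then obtain x where "x \<in> carrier (Q 0)" "v = \<epsilon> x" using subductionD(1)[OF eps_sub] by blast
    then show "desc ?\<phi> v = \<psi> v" using desc_eps[OF Z, of x] by (simp add: compose_def)
  qed
qed

lemma desc_subduction: "subduction (ZL W 0) (Linf V W) desc"
proof (rule subductionI[OF desc_hom])
  fix n U q assume q: "q \<in> plots (Linf V W) n U"
  have o: "eopen n U" "\<And>u. u \<in> U \<Longrightarrow> q u \<in> carrier (Linf V W)"
    using q by (auto simp: Linf_plots_iff)
  have "(\<lambda>u. compose (carrier (Q 0)) (q u) \<epsilon>) \<in> plots (ZL W 0) n U"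
    using DVect_homD(6)[OF Linf_precompose_hom[OF eps W] q] desc_section(1) o(2)
    by (auto simp: dvs_sub_def sub_plots_def)
  then show "locally_lifts (plots (ZL W 0)) desc n U q"
    by (rule locally_liftsI[OF o(1)]) (simp add: desc_section(2) o(2))
qed

lemma desc_image: "desc ` Z W 0 = carrier (Linf V W)"
  using subductionD(1)[OF desc_subduction] by simp

end

lemma desc_Linf_map:
  assumes "\<phi> \<in> Z W 0"
  shows "desc (Linf_map (Q 0) f \<phi>) = Linf_map V f (desc \<phi>)"
proof -
  have "inv_into (carrier (Q 0)) \<epsilon> v \<in> carrier (Q 0)" if "v \<in> carrier V" for v
    using that subductionD(1)[OF eps_sub] by (auto intro: inv_into_into)
  then show ?thesis by (auto simp: desc_def Linf_map_def compose_def fun_eq_iff)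
qed

lemma Linf_connecting:
  assumes ex: "short_exact W1 W2 W3 i \<pi>"
  obtains \<delta> where "DVect_hom (Linf V W3) (H W1 0) \<delta>"
    and "exact_at (Linf V W2) (Linf V W3) (H W1 0) (Linf_map V \<pi>) \<delta>"
    and "exact_at (Linf V W3) (H W1 0) (H W2 0) \<delta> (H_map W2 0 i)"
proof (rule connecting[OF ex desc_hom[OF dvss(3)[OF ex]] desc_subduction[OF dvss(3)[OF ex]]])
  note d = dvss[OF ex]
  interpret S2: dvspace "ZL W2 0" by (rule dvspace_Z[OF d(2)])
  fix z assume z: "z \<in> Z W3 0" "desc z = \<zero>\<^bsub>Linf V W3\<^esub>"
  \<comment> \<open>By \<open>desc_eps\<close>, z x = desc z (\<epsilon> x) = 0. So
    \<open>desc\<close> is injective on cocycles, and only z = 0 has to be lifted.\<close>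
  have S3: "z = \<zero>\<^bsub>L W3 0\<^esub>"
  proof (rule Linf_eqI)
    interpret S3: dvspace "L W3 0" using dvs_Linf[OF dvs_Q d(3)] by unfold_locales
    show "z \<in> carrier (L W3 0)" using z(1) by (simp add: Z_iff)
    show "\<zero>\<^bsub>L W3 0\<^esub> \<in> carrier (L W3 0)" by simp
    show "z x = \<zero>\<^bsub>L W3 0\<^esub> x" if "x \<in> carrier (Q 0)" for x
      using desc_eps[OF d(3) z(1) that] z(2) that eps_closed[OF that] by (simp add: Linf_simps)
  qed
  have "Linf_map (Q 0) \<pi> \<zero>\<^bsub>L W2 0\<^esub> = z"
    using DVect_hom_zero[OF Linf_map_hom[OF dvs_Q homs(2)[OF ex]]] S3 by simp
  then show "\<exists>s\<in>Z W2 0. Linf_map (Q 0) \<pi> s = z"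
    using S2.zero_closed by (intro bexI[of _ "\<zero>\<^bsub>L W2 0\<^esub>"]) simp_all
next
  fix \<delta> assume \<delta>: "DVect_hom (Linf V W3) (H W1 0) \<delta>"
    "a_kernel (Linf V W3) (H W1 0) \<delta> = (\<lambda>s. desc (Linf_map (Q 0) \<pi> s)) ` Z W2 0"
    "exact_at (Linf V W3) (H W1 0) (H W2 0) \<delta> (H_map W2 0 i)"
  have "Linf_map V \<pi> ` carrier (Linf V W2) = (\<lambda>s. desc (Linf_map (Q 0) \<pi> s)) ` Z W2 0"
    unfolding desc_image[OF dvss(2)[OF ex], symmetric] image_image
    by (rule image_cong) (simp_all add: desc_Linf_map)
  then show thesis using that \<delta> by (simp add: exact_at_def)
qed

end

section \<open>Resolutions\<close>

lemma chain_complex_hom: "chain_complex C d \<Longrightarrow> DVect_hom (C k) (C (k - 1)) (d k)"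
  by (simp add: chain_complex_def)

context
  fixes C :: "int \<Rightarrow> 'p dvs" and d :: "int \<Rightarrow> 'p \<Rightarrow> 'p" and n :: int
  assumes complex: "chain_complex C d" and exact: "exact_at_spot C d n"
begin

lemma hom_Suc: "DVect_hom (C (n + 1)) (C n) (d (n + 1))"
  using chain_complex_hom[OF complex, of "n + 1"] by simp

lemma the_elem_coset:
  assumes x: "x \<in> carrier (C (n + 1))"
  shows "the_elem (d (n + 1) ` (a_kernel (C (n + 1)) (C n) (d (n + 1)) +>\<^bsub>C (n + 1)\<^esub> x)) = d (n + 1) x"
proof -
  let ?K = "a_kernel (C (n + 1)) (C n) (d (n + 1))"
  interpret A: dvspace "C (n + 1)" using DVect_homD(1)[OF hom_Suc] by unfold_locales
  interpret B: dvspace "C n" using DVect_homD(2)[OF hom_Suc] by unfold_locales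
  have dx: "d (n + 1) x \<in> carrier (C n)" using funcset_mem[OF DVect_homD(3)[OF hom_Suc] x] .
  have mem: "y \<in> ?K +>\<^bsub>C (n + 1)\<^esub> x \<longleftrightarrow> (\<exists>k\<in>?K. y = k \<oplus>\<^bsub>C (n + 1)\<^esub> x)" for y
    by (rule A.mem_coset[OF subspace_a_kernel[OF hom_Suc]])
  have "d (n + 1) (k \<oplus>\<^bsub>C (n + 1)\<^esub> x) = d (n + 1) x" if "k \<in> ?K" for k
    using that x dx by (simp add: a_kernel_iff DVect_homD(4)[OF hom_Suc])
  moreover have "\<zero>\<^bsub>C (n + 1)\<^esub> \<in> ?K" using DVect_hom_zero[OF hom_Suc] by (simp add: a_kernel_iff)
  ultimately have "d (n + 1) ` (?K +>\<^bsub>C (n + 1)\<^esub> x) = {d (n + 1) x}"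
    unfolding set_eq_iff image_iff Bex_def mem by auto
  then show ?thesis by simp
qed

lemma exact_at_spot_image:
  "d (n + 1) ` carrier (C (n + 1)) = a_kernel (C n) (C (n - 1)) (d n)"
proof -
  let ?K = "a_kernel (C (n + 1)) (C n) (d (n + 1))"
  have "(\<lambda>X. the_elem (d (n + 1) ` X)) ` carrier (dvs_quot (C (n + 1)) ?K) =
      a_kernel (C n) (dvs_sub (C (n - 1)) (d n ` carrier (C n))) (d n)"
    using exact by (simp add: exact_at_spot_def short_exact_def)
  moreover have "carrier (dvs_quot (C (n + 1)) ?K) = (\<lambda>x. ?K +>\<^bsub>C (n + 1)\<^esub> x) ` carrier (C (n + 1))"
    by (auto simp: dvs_quot_def A_RCOSETS_def')
  moreover have "a_kernel (C n) (dvs_sub (C (n - 1)) (d n ` carrier (C n))) (d n) =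
      a_kernel (C n) (C (n - 1)) (d n)"
    by (simp add: a_kernel_def')
  ultimately show ?thesis by (simp add: image_image the_elem_coset)
qed

text \<open>The induction half of exactness: q read modulo the kernel is a plot of the quotient, and
  plots of a quotient lift locally by definition. The pointwise preimages x serve only to name the
  cosets.\<close>

lemma exact_at_spot_lift:
  assumes q: "q \<in> plots (C n) m U" and im: "\<And>u. u \<in> U \<Longrightarrow> q u \<in> d (n + 1) ` carrier (C (n + 1))"
  shows "locally_lifts (plots (C (n + 1))) (d (n + 1)) m U q"
proof -
  let ?K = "a_kernel (C (n + 1)) (C n) (d (n + 1))"
  let ?j = "\<lambda>X. the_elem (d (n + 1) ` X)"
  interpret A: dvspace "C (n + 1)" using DVect_homD(1)[OF hom_Suc] by unfold_locales
  interpret B: dvspace "C n" using DVect_homD(2)[OF hom_Suc] by unfold_locales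
  have "\<exists>x. \<forall>u\<in>U. x u \<in> carrier (C (n + 1)) \<and> q u = d (n + 1) (x u)"
    by (intro bchoice) (use im in blast)
  then obtain x where x: "\<And>u. u \<in> U \<Longrightarrow> x u \<in> carrier (C (n + 1))" "\<And>u. u \<in> U \<Longrightarrow> q u = d (n + 1) (x u)"
    by blast
  define X where "X u = ?K +>\<^bsub>C (n + 1)\<^esub> x u" for u
  have "?j \<circ> X \<in> plots (C n) m U"
    by (rule diffeology_cong[OF B.diffeo q]) (simp add: X_def the_elem_coset x)
  moreover have "X \<in> U \<rightarrow> carrier (dvs_quot (C (n + 1)) ?K)"
  proof
    fix u assume "u \<in> U"
    then have "x u \<in> carrier (C (n + 1))" by (rule x(1))
    then show "X u \<in> carrier (dvs_quot (C (n + 1)) ?K)" by (auto simp: X_def dvs_quot_def A_RCOSETS_def')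
  qed
  moreover have "induction_map (carrier (dvs_quot (C (n + 1)) ?K)) (plots (dvs_quot (C (n + 1)) ?K)) (plots (C n)) ?j"
    using exact by (simp add: exact_at_spot_def short_exact_def)
  ultimately have "X \<in> plots (dvs_quot (C (n + 1)) ?K) m U"
    unfolding induction_map_def by blast
  then have lifts: "locally_lifts (plots (C (n + 1))) (\<lambda>x. ?K +>\<^bsub>C (n + 1)\<^esub> x) m U X"
    by (simp add: dvs_quot_def quot_plots_def)
  show ?thesis
    unfolding locally_lifts_def
  proof
    fix u assume u: "u \<in> U"
    obtain U' p where U': "eopen m U'" "u \<in> U'" "U' \<subseteq> U" "p \<in> plots (C (n + 1)) m U'"
      "\<And>y. y \<in> U' \<Longrightarrow> ?K +>\<^bsub>C (n + 1)\<^esub> p y = X y"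
      by (rule locally_liftsE[OF lifts u]) (rule that)
    have "d (n + 1) (p y) = q y" if "y \<in> U'" for y
    proof -
      have "d (n + 1) (p y) = ?j (X y)"
        using the_elem_coset[OF A.plot_closed[OF U'(4) that]] U'(5)[OF that] by simp
      also have "\<dots> = q y" using U'(3) that x by (auto simp: X_def the_elem_coset)
      finally show ?thesis .
    qed
    then show "\<exists>U'. eopen m U' \<and> u \<in> U' \<and> U' \<subseteq> U \<and>
        (\<exists>p\<in>plots (C (n + 1)) m U'. \<forall>y\<in>U'. d (n + 1) (p y) = q y)"
      using U' by blast
  qed
qed

end

lemma projective_resolution_augmented:
  fixes V :: "'v dvs" and C :: "int \<Rightarrow> 'p dvs"
  assumes res: "projective_resolution V C d"
  obtains \<epsilon> where "augmented_projective_complex (\<lambda>k. C (int k)) (\<lambda>k. d (int (Suc k))) V \<epsilon>"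
proof -
  have complex: "chain_complex C d" and exact: "\<And>n. exact_at_spot C d n"
    and zero: "\<And>n. n < -1 \<Longrightarrow> carrier (C n) = {\<zero>\<^bsub>C n\<^esub>}" and proj: "\<And>n. n \<ge> 0 \<Longrightarrow> projective (C n)"
    using res by (auto simp: projective_resolution_def)
  obtain f g where f: "DVect_hom V (C (-1)) f" and g: "DVect_hom (C (-1)) V g"
    and gf: "\<And>v. v \<in> carrier V \<Longrightarrow> g (f v) = v" and fg: "\<And>x. x \<in> carrier (C (-1)) \<Longrightarrow> f (g x) = x"
    using res by (auto simp: projective_resolution_def DVect_isomorphic_def)
  have d0: "DVect_hom (C 0) (C (-1)) (d 0)" using chain_complex_hom[OF complex, of 0] by simp
  have onto: "d 0 ` carrier (C 0) = carrier (C (-1))"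
  proof -
    \<comment> \<open>The term in degree -2 is zero, so exactness in degree -1 makes d 0
      surjective.\<close>
    have "d (-1) x = \<zero>\<^bsub>C (-2)\<^esub>" if "x \<in> carrier (C (-1))" for x
      using funcset_mem[OF DVect_homD(3)[OF chain_complex_hom[OF complex, of "-1"]] that] zero[of "-2"] by simp
    then show ?thesis using exact_at_spot_image[OF complex exact, of "-1"] by (auto simp: a_kernel_def')
  qed
  \<comment> \<open>The augmentation is d 0 followed by the isomorphism g from the term in degree -1
    to V.\<close>
  have eps: "DVect_hom (C 0) V (\<lambda>x. g (d 0 x))" by (rule DVect_hom_comp[OF d0 g])
  have "subduction (C 0) V (\<lambda>x. g (d 0 x))"
  proof (rule subductionI[OF eps])
    fix m U q assume q: "q \<in> plots V m U"
    interpret V: dvspace V using DVect_homD(1)[OF f] by unfold_locales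
    have fq: "(\<lambda>u. f (q u)) \<in> plots (C (-1)) m U" by (rule DVect_homD(6)[OF f q])
    have "f (q u) \<in> d 0 ` carrier (C 0)" if "u \<in> U" for u
      unfolding onto using funcset_mem[OF DVect_homD(3)[OF f] V.plot_closed[OF q that]] .
    then have lifts: "locally_lifts (plots (C 0)) (d 0) m U (\<lambda>u. f (q u))"
      using exact_at_spot_lift[OF complex exact, of "\<lambda>u. f (q u)" "-1"] fq by simp
    show "locally_lifts (plots (C 0)) (\<lambda>x. g (d 0 x)) m U q"
      unfolding locally_lifts_def
    proof
      fix u assume u: "u \<in> U"
      obtain U' p where U': "eopen m U'" "u \<in> U'" "U' \<subseteq> U" "p \<in> plots (C 0) m U'"
        "\<And>y. y \<in> U' \<Longrightarrow> d 0 (p y) = f (q y)"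
        by (rule locally_liftsE[OF lifts u]) (rule that)
      have "g (d 0 (p y)) = q y" if "y \<in> U'" for y
        using U'(3,5) that gf V.plot_closed[OF q] by auto
      then show "\<exists>U'. eopen m U' \<and> u \<in> U' \<and> U' \<subseteq> U \<and>
          (\<exists>p\<in>plots (C 0) m U'. \<forall>y\<in>U'. g (d 0 (p y)) = q y)"
        using U' by blast
    qed
  qed
  moreover have "a_kernel (C 0) V (\<lambda>x. g (d 0 x)) = d 1 ` carrier (C 1)"
  proof -
    have "g (d 0 x) = \<zero>\<^bsub>V\<^esub> \<longleftrightarrow> d 0 x = \<zero>\<^bsub>C (-1)\<^esub>" if "x \<in> carrier (C 0)" for x
      using fg[OF funcset_mem[OF DVect_homD(3)[OF d0] that]] DVect_hom_zero[OF f] DVect_hom_zero[OF g] by metis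
    then have "a_kernel (C 0) V (\<lambda>x. g (d 0 x)) = a_kernel (C 0) (C (-1)) (d 0)"
      by (auto simp: a_kernel_iff DVect_hom_zero[OF g])
    then show ?thesis using exact_at_spot_image[OF complex exact, of 0] by simp
  qed
  moreover have "DVect_hom (C (int (Suc k))) (C (int k)) (d (int (Suc k)))" for k
    using chain_complex_hom[OF complex, of "int (Suc k)"] by simp
  moreover have "d (int (Suc k)) (d (int (Suc (Suc k))) x) = \<zero>\<^bsub>C (int k)\<^esub>"
    if "x \<in> carrier (C (int (Suc (Suc k))))" for k x
  proof -
    have "\<forall>x\<in>carrier (C (int (Suc k) + 1)). d (int (Suc k)) (d (int (Suc k) + 1) x) = \<zero>\<^bsub>C (int (Suc k) - 1)\<^esub>"
      using complex unfolding chain_complex_def by blast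
    moreover have "int (Suc k) + 1 = int (Suc (Suc k))" "int (Suc k) - 1 = int k" by simp_all
    ultimately show ?thesis using that by metis
  qed
  ultimately have "augmented_projective_complex (\<lambda>k. C (int k)) (\<lambda>k. d (int (Suc k))) V (\<lambda>x. g (d 0 x))"
    using proj eps by unfold_locales simp_all
  then show thesis by (rule that)
qed

section \<open>Comparison with Ext\<close>

context projective_complex
begin

text \<open>Degree k + 1 involves only the terms from degree k on and the differentials
  \<open>d j\<close> with j > 0. Truncation alters the term in degree -1 and \<open>d 0\<close>, so
  it is invisible here.\<close>

lemma Ext_eq_H:
  fixes C :: "int \<Rightarrow> 'p dvs"
  assumes Q: "\<And>k. Q k = C (int k)" and e: "\<And>k. e k = d (int (Suc k))"
  shows "Ext C d (Suc k) W = H W k" and "Ext_map C d (Suc k) W f = H_map W k f"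
proof -
  have trunc: "trunc C (int j) = Q j" for j by (simp add: trunc_def Q)
  have complex: "Hom_complex (trunc C) W (int j) = L W j" for j
    by (simp add: Hom_complex_def trunc)
  have Suc: "int j + 1 = int (Suc j)" "int (Suc j) - 1 = int j" for j by simp_all
  have diff: "Hom_diff (trunc C) (trunc_diff C d) (int j) = (co j :: ('p \<Rightarrow> 'w) \<Rightarrow> _)" for j
    unfolding Hom_diff_def[abs_def] Suc(1) trunc co_def[abs_def] by (simp add: trunc_diff_def e)
  have Z: "cocycles (Hom_complex (trunc C) W) (Hom_diff (trunc C) (trunc_diff C d)) (int (Suc k)) = Z W (Suc k)"
    unfolding cocycles_def Suc(1) complex diff Z_def ..
  have B: "coboundaries (Hom_complex (trunc C) W) (Hom_diff (trunc C) (trunc_diff C d)) (int (Suc k)) = B W k"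
    unfolding coboundaries_def Suc(2) complex diff B_def ..
  show "Ext C d (Suc k) W = H W k"
    unfolding Ext_def cohomology_def Z B complex H_def ..
  show "Ext_map C d (Suc k) W f = H_map W k f"
    unfolding Ext_map_def[abs_def] Let_def B complex trunc H_map_def[abs_def] cls_def ..
qed

end

theorem theorem7p6:
  fixes W1 :: "'w1 dvs" and W2 :: "'w2 dvs" and W3 :: "'w3 dvs"
    and i :: "'w1 \<Rightarrow> 'w2" and \<pi> :: "'w2 \<Rightarrow> 'w3"
    and V :: "'v dvs" and C :: "int \<Rightarrow> 'p dvs" and d :: "int \<Rightarrow> 'p \<Rightarrow> 'p"
  assumes "short_exact W1 W2 W3 i \<pi>"
    and "dvs V"
    and "projective_resolution V C d"
  shows "\<exists>(\<delta>0 :: ('v \<Rightarrow> 'w3) \<Rightarrow> ('p \<Rightarrow> 'w1) set)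
          (\<delta> :: nat \<Rightarrow> ('p \<Rightarrow> 'w3) set \<Rightarrow> ('p \<Rightarrow> 'w1) set).
    DVect_hom (Linf V W1) (Linf V W2) (Linf_map V i) \<and>
    DVect_hom (Linf V W2) (Linf V W3) (Linf_map V \<pi>) \<and>
    DVect_hom (Linf V W3) (Ext C d 1 W1) \<delta>0 \<and>
    (\<forall>n\<ge>1. DVect_hom (Ext C d n W1) (Ext C d n W2) (Ext_map C d n W2 i)) \<and>
    (\<forall>n\<ge>1. DVect_hom (Ext C d n W2) (Ext C d n W3) (Ext_map C d n W3 \<pi>)) \<and>
    (\<forall>n\<ge>1. DVect_hom (Ext C d n W3) (Ext C d (n + 1) W1) (\<delta> n)) \<and>
    inj_on (Linf_map V i) (carrier (Linf V W1)) \<and>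
    exact_at (Linf V W1) (Linf V W2) (Linf V W3) (Linf_map V i) (Linf_map V \<pi>) \<and>
    exact_at (Linf V W2) (Linf V W3) (Ext C d 1 W1) (Linf_map V \<pi>) \<delta>0 \<and>
    exact_at (Linf V W3) (Ext C d 1 W1) (Ext C d 1 W2) \<delta>0 (Ext_map C d 1 W2 i) \<and>
    (\<forall>n\<ge>1. exact_at (Ext C d n W1) (Ext C d n W2) (Ext C d n W3)
       (Ext_map C d n W2 i) (Ext_map C d n W3 \<pi>)) \<and>
    (\<forall>n\<ge>1. exact_at (Ext C d n W2) (Ext C d n W3) (Ext C d (n + 1) W1)
       (Ext_map C d n W3 \<pi>) (\<delta> n)) \<and>
    (\<forall>n\<ge>1. exact_at (Ext C d n W3) (Ext C d (n + 1) W1) (Ext C d (n + 1) W2)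
       (\<delta> n) (Ext_map C d (n + 1) W2 i))"
proof -
  note ex = assms(1) and V = assms(2)
  define Q where "Q = (\<lambda>k. C (int k))"
  define e where "e = (\<lambda>k. d (int (Suc k)))"
  obtain \<epsilon> where "augmented_projective_complex Q e V \<epsilon>"
    unfolding Q_def e_def using projective_resolution_augmented[OF assms(3)] .
  then interpret augmented_projective_complex Q e V \<epsilon> .
  have Ext_eq: "Ext C d (Suc k) W = H W k" "Ext_map C d (Suc k) W f = H_map W k f" for k W f
    by (rule Ext_eq_H; simp add: Q_def e_def)+
  note hi = homs(1)[OF ex] and hp = homs(2)[OF ex]
  obtain \<delta>0 where \<delta>0: "DVect_hom (Linf V W3) (H W1 0) \<delta>0"
    "exact_at (Linf V W2) (Linf V W3) (H W1 0) (Linf_map V \<pi>) \<delta>0"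
    "exact_at (Linf V W3) (H W1 0) (H W2 0) \<delta>0 (H_map W2 0 i)"
    using Linf_connecting[OF ex] .
  have "\<exists>\<delta>. DVect_hom (H W3 k) (H W1 (Suc k)) \<delta> \<and>
      exact_at (H W2 k) (H W3 k) (H W1 (Suc k)) (H_map W3 k \<pi>) \<delta> \<and>
      exact_at (H W3 k) (H W1 (Suc k)) (H W2 (Suc k)) \<delta> (H_map W2 (Suc k) i)" for k
    using H_connecting[OF ex, of k] by blast
  then obtain \<delta> where \<delta>: "\<And>k. DVect_hom (H W3 k) (H W1 (Suc k)) (\<delta> k)"
    "\<And>k. exact_at (H W2 k) (H W3 k) (H W1 (Suc k)) (H_map W3 k \<pi>) (\<delta> k)"
    "\<And>k. exact_at (H W3 k) (H W1 (Suc k)) (H W2 (Suc k)) (\<delta> k) (H_map W2 (Suc k) i)" by metis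
  have shift: "(\<forall>n\<ge>1. P n) \<longleftrightarrow> (\<forall>k. P (Suc k))" for P :: "nat \<Rightarrow> bool"
    by (metis One_nat_def Suc_le_D le_add1 plus_1_eq_Suc)
  show ?thesis
    unfolding shift
    \<comment> \<open>The shifted map \<delta> k starts in degree k + 1, hence the index n - 1 for
      degree n.\<close>
    by (rule exI[of _ \<delta>0], rule exI[of _ "\<lambda>n. \<delta> (n - 1)"])
      (simp add: Ext_eq \<delta>0 \<delta> Linf_map_hom[OF V hi] Linf_map_hom[OF V hp] H_map_hom[OF hi] H_map_hom[OF hp]
        Linf_inj[OF ex V] Linf_exact[OF ex V] H_exact_middle[OF ex])
qed

end
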